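(* Let $\mu$ be a Borel measure of order $n$ on $\mathbb{R}^d$ and let $T$ be a Calderón–Zygmund operator of order $n$ with respect to $\mu$ with modulus of continuity $\omega$, satisfying the local $T(1)$ conditions (all as in the context). If $$\int_0^1\omega(t)\Big(1+\log\frac1t\Big)^{1/2}\frac{dt}{t}<\infty,$$ then $T$ acts boundedly on $L^2(\mu)$, i.e. there is a constant $C$ such that $\|Tf\|_{L^2(\mu)}\le C\|f\|_{L^2(\mu)}$ for all $f$ in the domain of $T$.
   Context: $\mu$ is a nonnegative Borel measure on $\mathbb{R}^d$ with $\mu(B(x,\rho))\le C_0\rho^n$ for all $x\in\mathbb{R}^d$, $\rho>0$ ($n>0$ fixed); $\mu$ need not be doubling. Cubes are half-open axis-parallel cubes; if $\mu(\mathbb{R}^d)<\infty$, $\mathbb{R}^d$ itself is also regarded as a cube. $\langle f,g\rangle=\int fg\,d\mu$. $T$ and its transpose $T^*$ are linear maps from a dense subspace $\mathcal{S}\subset L^2(\mu)$, containing the indicators of cubes, into $L^2(\mu)$, with $\langle Tf,g\rangle=\langle f,T^*g\rangle$ for $f,g\in\mathcal{S}$, and $Tf(x)=\int K(x,y)f(y)\,d\mu(y)$ for $x\notin\operatorname{supp}f$, where $|K(x,y)|\le C_1|x-y|^{-n}$ and $$|K(x,y)-K(x',y)|+|K(y,x)-K(y,x')|\le \frac{C_1}{|x-y|^n}\,\omega\Big(\frac{|x-x'|}{|x-y|}\Big)\quad\text{whenever }|x-x'|\le\tfrac12|x-y|.$$ Here $\omega:[0,\infty)\to[0,\infty)$ is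 increasing and subadditive ($\omega(a+b)\le\omega(a)+\omega(b)$) with $\omega(0)=0$. Local $T(1)$ conditions: there is $C_2$ with $\|T1_Q\|_{L^2(\mu)}\le C_2\mu(Q)^{1/2}$ and $\|T^*1_Q\|_{L^2(\mu)}\le C_2\mu(Q)^{1/2}$ for all cubes $Q\subset\mathbb{R}^d$. *)

theory Defs
  imports "HOL-Analysis.Analysis"
begin

text \<open>
  Elements of \<open>L\<^sup>2(\<mu>)\<close> are represented by square-integrable functions; identification
  up to null sets is made explicit where it matters. Scalars are complex, and the pairing is
  bilinear (no conjugation).
\<close>

definition L2 :: "'a measure \<Rightarrow> ('a \<Rightarrow> complex) set" where
  "L2 M = {f \<in> borel_measurable M. integrable M (\<lambda>x. (norm (f x))\<^sup>2)}"

definition L2_norm :: "'a measure \<Rightarrow> ('a \<Rightarrow> complex) \<Rightarrow> real" where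
  "L2_norm M f = sqrt (LINT x|M. (norm (f x))\<^sup>2)"

definition pairing :: "'a measure \<Rightarrow> ('a \<Rightarrow> complex) \<Rightarrow> ('a \<Rightarrow> complex) \<Rightarrow> complex" where
  "pairing M f g = (LINT x|M. f x * g x)"

text \<open>
  A subspace of the quotient space \<open>L\<^sup>2(\<mu>)\<close> corresponds to a linear space of functions which is
  closed under changing its elements on null sets.
\<close>

definition dense_L2_subspace :: "'a measure \<Rightarrow> ('a \<Rightarrow> complex) set \<Rightarrow> bool" where
  "dense_L2_subspace M S \<longleftrightarrow>
     S \<subseteq> L2 M \<and>
     (\<lambda>x. 0) \<in> S \<and>
     (\<forall>f\<in>S. \<forall>g\<in>S. (\<lambda>x. f x + g x) \<in> S) \<and>
     (\<forall>c. \<forall>f\<in>S. (\<lambda>x. c * f x) \<in> S) \<and>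
     (\<forall>f\<in>S. \<forall>g\<in>borel_measurable M. (AE x in M. f x = g x) \<longrightarrow> g \<in> S) \<and>
     (\<forall>f\<in>L2 M. \<forall>\<epsilon>>0. \<exists>g\<in>S. L2_norm M (\<lambda>x. f x - g x) < \<epsilon>)"

definition L2_linear_map ::
    "'a measure \<Rightarrow> ('a \<Rightarrow> complex) set \<Rightarrow> (('a \<Rightarrow> complex) \<Rightarrow> 'a \<Rightarrow> complex) \<Rightarrow> bool" where
  "L2_linear_map M S T \<longleftrightarrow>
     (\<forall>f\<in>S. T f \<in> L2 M) \<and>
     (\<forall>f\<in>S. \<forall>g\<in>S. (AE x in M. f x = g x) \<longrightarrow> (AE x in M. T f x = T g x)) \<and>
     (\<forall>f\<in>S. \<forall>g\<in>S. AE x in M. T (\<lambda>x. f x + g x) x = T f x + T g x) \<and>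
     (\<forall>c. \<forall>f\<in>S. AE x in M. T (\<lambda>x. c * f x) x = c * T f x)"

text \<open>The support of a class of functions: the complement of the largest open set on which
  the function vanishes almost everywhere.\<close>

definition ess_supp :: "'a::topological_space measure \<Rightarrow> ('a \<Rightarrow> complex) \<Rightarrow> 'a set" where
  "ess_supp M f = - \<Union>{U. open U \<and> (AE x in M. x \<in> U \<longrightarrow> f x = 0)}"

definition measure_of_order :: "real \<Rightarrow> real \<Rightarrow> 'a::euclidean_space measure \<Rightarrow> bool" where
  "measure_of_order n C\<^sub>0 M \<longleftrightarrow>
     sets M = sets borel \<and>
     (\<forall>x. \<forall>\<rho>>0. emeasure M (ball x \<rho>) \<le> ennreal (C\<^sub>0 * \<rho> powr n))"

text \<open>The whole space counts as a cube when it has finite measure.\<close>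

definition cubes :: "'a::euclidean_space measure \<Rightarrow> 'a set set" where
  "cubes M =
     {{x. \<forall>i\<in>Basis. a \<bullet> i \<le> x \<bullet> i \<and> x \<bullet> i < a \<bullet> i + l} | a l. l > 0} \<union>
     (if emeasure M UNIV < \<infinity> then {UNIV} else {})"

definition modulus_of_continuity :: "(real \<Rightarrow> real) \<Rightarrow> bool" where
  "modulus_of_continuity \<omega> \<longleftrightarrow>
     (\<forall>t\<ge>0. \<omega> t \<ge> 0) \<and> mono_on {0..} \<omega> \<and>
     (\<forall>a\<ge>0. \<forall>b\<ge>0. \<omega> (a + b) \<le> \<omega> a + \<omega> b) \<and> \<omega> 0 = 0"

text \<open>The values of the kernel on the diagonal are irrelevant and unconstrained.\<close>

definition CZ_kernel ::
    "real \<Rightarrow> real \<Rightarrow> (real \<Rightarrow> real) \<Rightarrow> ('a::euclidean_space \<Rightarrow> 'a \<Rightarrow> complex) \<Rightarrow> bool" where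
  "CZ_kernel n C\<^sub>1 \<omega> K \<longleftrightarrow>
     (\<forall>x y. x \<noteq> y \<longrightarrow> norm (K x y) \<le> C\<^sub>1 * norm (x - y) powr (- n)) \<and>
     (\<forall>x x' y. x \<noteq> y \<and> norm (x - x') \<le> norm (x - y) / 2 \<longrightarrow>
        norm (K x y - K x' y) + norm (K y x - K y x')
          \<le> C\<^sub>1 / norm (x - y) powr n * \<omega> (norm (x - x') / norm (x - y)))"

text \<open>\<open>T\<close> with transpose \<open>T'\<close>, both defined on \<open>S\<close>. As \<open>T f\<close> is only determined up to null
  sets, the kernel representation is required almost everywhere off the support of \<open>f\<close>.\<close>

definition CZ_operator ::
    "'a::euclidean_space measure \<Rightarrow> real \<Rightarrow> real \<Rightarrow> (real \<Rightarrow> real) \<Rightarrow> ('a \<Rightarrow> 'a \<Rightarrow> complex) \<Rightarrow>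
     ('a \<Rightarrow> complex) set \<Rightarrow> (('a \<Rightarrow> complex) \<Rightarrow> 'a \<Rightarrow> complex) \<Rightarrow>
     (('a \<Rightarrow> complex) \<Rightarrow> 'a \<Rightarrow> complex) \<Rightarrow> bool" where
  "CZ_operator M n C\<^sub>1 \<omega> K S T T' \<longleftrightarrow>
     CZ_kernel n C\<^sub>1 \<omega> K \<and>
     dense_L2_subspace M S \<and>
     (\<forall>Q\<in>cubes M. indicator Q \<in> S) \<and>
     L2_linear_map M S T \<and> L2_linear_map M S T' \<and>
     (\<forall>f\<in>S. \<forall>g\<in>S. pairing M (T f) g = pairing M f (T' g)) \<and>
     (\<forall>f\<in>S. AE x in M. x \<notin> ess_supp M f \<longrightarrow> T f x = (LINT y|M. K x y * f y))"

definition local_T1 ::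
    "'a::euclidean_space measure \<Rightarrow> real \<Rightarrow> (('a \<Rightarrow> complex) \<Rightarrow> 'a \<Rightarrow> complex) \<Rightarrow>
     (('a \<Rightarrow> complex) \<Rightarrow> 'a \<Rightarrow> complex) \<Rightarrow> bool" where
  "local_T1 M C\<^sub>2 T T' \<longleftrightarrow>
     (\<forall>Q\<in>cubes M. L2_norm M (T (indicator Q)) \<le> C\<^sub>2 * sqrt (measure M Q) \<and>
                  L2_norm M (T' (indicator Q)) \<le> C\<^sub>2 * sqrt (measure M Q))"

end

theory Submission
  imports Defs
begin

text \<open>
  On step functions over a fine mesh, the operator is a finite matrix, so everything up to the final
  density argument is a statement about finite sums that is uniform in the mesh. For a dyadic grid
  shifted by \<open>s\<close>, with conditional expectations \<open>E\<^sub>k\<close> and differences \<open>D\<^sub>k = E\<^sub>k\<^sub>-\<^sub>1 - E\<^sub>k\<close>, the form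
  \<open>\<langle>T f, g\<rangle>\<close> telescopes into the pieces \<open>\<langle>T D\<^sub>k f, E\<^sub>k\<^sub>-\<^sub>1 g\<rangle>\<close> and their transposes. Averaging over \<open>s\<close>, as in
  the probabilistic method of Nazarov, Treil and Volberg, one may restrict \<open>D\<^sub>k f\<close> to good cells, those
  which are far from the boundary of all their much larger ancestors.

  For a good cell \<open>I\<close> with an ancestor \<open>J\<close> of fixed relative size, write \<open>E\<^sub>k\<^sub>-\<^sub>1 g\<close> as its average over
  \<open>J\<close> plus an error. The average gives a paraproduct, bounded by testing and the Carleson embedding
  theorem. The error inside \<open>J\<close> is bounded by testing on the finitely many cells of \<open>J\<close>. The error at
  distance \<open>2\<^sup>i\<close> side lengths from \<open>I\<close> is at most \<open>\<omega>(2\<^sup>-\<^sup>i)\<close> times an averaging operator, applied to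
  \<open>E\<^sub>k\<^sub>-\<^sub>1 g - E\<^sub>k\<^sub>+\<^sub>2\<^sub>i\<^sub>+\<^sub>2 g\<close>. The squared norms of these differences sum over \<open>k\<close> to \<open>O(i)\<close>, whence the
  bound \<open>\<Sum>\<^sub>i \<omega>(2\<^sup>-\<^sup>i) \<surd>i\<close>, which is the integral in the hypothesis.
\<close>

section \<open>Martingale differences on a finite filtration\<close>

text \<open>Neighbouring cells may have wildly different masses, so a kernel bound can never be
  compared with the mass of a cell. Masses enter only where they cancel: in Schur's test the growth
  bound of a ball is divided out by the kernel size at the same distance, and in the testing
  estimates cells are counted instead of weighed.

  Goodness serves the far part. A point close to a cell may be separated from it by the boundary of
  a huge ancestor, and then no average over a moderately large common cell can be subtracted. For a
  good cell, a point at distance \<open>2 ^ i\<close> shares an ancestor about \<open>2 * i\<close>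
  generations up. The exponent \<open>2 * i\<close> makes a failure at scale \<open>i\<close> have
  probability of order \<open>2 ^ - i\<close>, which is summable, and it makes the averages differ
  by about \<open>2 * i\<close> martingale differences, so that Cauchy-Schwarz over the levels
  leaves the factor \<open>sqrt i\<close>.

  Shifts are finite in number and the weight of a good cell is normalised on each residue class, so
  the average over grids reproduces the form exactly and no bad part has to be absorbed into the
  left-hand side.\<close>

lemma sum_shift_diff_le:
  fixes a :: "nat \<Rightarrow> real"
  assumes "decseq a" "\<And>k. 0 \<le> a k"
  shows "(\<Sum>k<N. a k - a (k + j)) \<le> real j * a 0"
proof (induction j)
  case 0 then show ?case by simp
next
  case (Suc j)
  have "(\<Sum>k<N. a (k + j) - a (Suc (k + j))) = a j - a (N + j)"
    using sum_lessThan_telescope'[of "\<lambda>k. a (k + j)" N] by simp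
  also have "\<dots> \<le> a 0"
    using assms(1) assms(2)[of "N + j"] decseqD[OF assms(1), of 0 j] by simp
  finally have "(\<Sum>k<N. a (k + j) - a (Suc (k + j))) \<le> a 0" .
  moreover have "(\<Sum>k<N. a k - a (k + Suc j))
      = (\<Sum>k<N. a k - a (k + j)) + (\<Sum>k<N. a (k + j) - a (Suc (k + j)))"
    by (simp add: sum.distrib[symmetric])
  ultimately show ?case using Suc by (simp add: algebra_simps)
qed

lemma sum_mult_le_sqrt:
  fixes f g :: "'i \<Rightarrow> real"
  shows "(\<Sum>i\<in>A. f i * g i) \<le> sqrt (\<Sum>i\<in>A. (f i)\<^sup>2) * sqrt (\<Sum>i\<in>A. (g i)\<^sup>2)"
proof -
  have "(\<Sum>i\<in>A. f i * g i) \<le> (\<Sum>i\<in>A. \<bar>f i\<bar> * \<bar>g i\<bar>)"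
    by (rule sum_mono) (metis abs_ge_self abs_mult)
  also have "\<dots> \<le> L2_set f A * L2_set g A" by (rule L2_set_mult_ineq)
  finally show ?thesis by (simp add: L2_set_def)
qed

text \<open>The function \<open>x\<^sup>2 / y\<close> is the supremum of the linear functions
  \<open>2 * r * x - r\<^sup>2 * y\<close>, attained at \<open>r = x / y\<close>. Jensen's
  inequality for conditional averages then follows by freezing \<open>r\<close>.\<close>

lemma square_over_ge_tangent:
  fixes x y r :: real
  assumes "0 < y"
  shows "2 * r * x - r\<^sup>2 * y \<le> x\<^sup>2 / y"
proof -
  have "0 \<le> (x - r * y)\<^sup>2 / y" using assms by simp
  also have "\<dots> = x\<^sup>2 / y - (2 * r * x - r\<^sup>2 * y)"
    using assms by (simp add: field_simps power2_eq_square)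
  finally show ?thesis by simp
qed

lemma square_over_eq_tangent:
  fixes x y :: real
  shows "x\<^sup>2 / y = 2 * (x / y) * x - (x / y)\<^sup>2 * y"
  by (cases "y = 0") (simp_all add: power2_eq_square)

text \<open>Points of \<open>P\<close> are atoms with mass \<open>m\<close>, and
  \<open>c k p\<close> is the label of the cell of level \<open>k\<close> around \<open>p\<close>.
  Levels grow as the partition coarsens, against the usual indexing of martingales.\<close>

locale filtration =
  fixes P :: "'p set" and m :: "'p \<Rightarrow> real" and c :: "nat \<Rightarrow> 'p \<Rightarrow> 'l"
  assumes finP: "finite P"
    and m_pos: "p \<in> P \<Longrightarrow> 0 < m p"
    and c_Suc: "p \<in> P \<Longrightarrow> q \<in> P \<Longrightarrow> c k p = c k q \<Longrightarrow> c (Suc k) p = c (Suc k) q"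
begin

definition cell :: "nat \<Rightarrow> 'p \<Rightarrow> 'p set" where
  "cell k p = {q \<in> P. c k q = c k p}"

definition mass :: "nat \<Rightarrow> 'p \<Rightarrow> real" where
  "mass k p = sum m (cell k p)"

definition E :: "nat \<Rightarrow> ('p \<Rightarrow> real) \<Rightarrow> 'p \<Rightarrow> real" where
  "E k f p = (\<Sum>q\<in>cell k p. f q * m q) / mass k p"

text \<open>At \<open>k = 0\<close> the truncated subtraction makes this zero; sums of differences
  start at \<open>k = 1\<close>.\<close>

definition D :: "nat \<Rightarrow> ('p \<Rightarrow> real) \<Rightarrow> 'p \<Rightarrow> real" where
  "D k f p = E (k - 1) f p - E k f p"

definition ip :: "('p \<Rightarrow> real) \<Rightarrow> ('p \<Rightarrow> real) \<Rightarrow> real" where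
  "ip f g = (\<Sum>p\<in>P. f p * g p * m p)"

definition nrm :: "('p \<Rightarrow> real) \<Rightarrow> real" where
  "nrm f = sqrt (ip f f)"

text \<open>Measurability with respect to the partition into cells of level \<open>k\<close>. It
  becomes weaker as \<open>k\<close> decreases.\<close>

definition level :: "nat \<Rightarrow> ('p \<Rightarrow> real) \<Rightarrow> bool" where
  "level k u \<longleftrightarrow> (\<forall>p\<in>P. \<forall>q\<in>P. c k p = c k q \<longrightarrow> u p = u q)"

lemma levelD: "level k u \<Longrightarrow> p \<in> P \<Longrightarrow> q \<in> P \<Longrightarrow> c k p = c k q \<Longrightarrow> u p = u q"
  unfolding level_def by blast

lemma c_mono:
  assumes "p \<in> P" "q \<in> P" "c k p = c k q" "k \<le> l"
  shows "c l p = c l q"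
  using assms(4,1-3) by (induction l rule: dec_induct) (auto intro: c_Suc)

lemma level_mono: "level l u \<Longrightarrow> k \<le> l \<Longrightarrow> level k u"
  unfolding level_def using c_mono by blast

lemma level_comp2:
  assumes "level k u" "level k v" shows "level k (\<lambda>p. F (u p) (v p))"
  unfolding level_def using levelD[OF assms(1)] levelD[OF assms(2)] by metis

lemma level_const: "level k (\<lambda>_. z)"
  by (simp add: level_def)

lemmas level_mult = level_comp2[where F = "(*)"]
  and level_add = level_comp2[where F = "(+)"]
  and level_diff = level_comp2[where F = "(-)"]
  and level_divide = level_comp2[where F = "(/)"]

lemma level_power: "level k u \<Longrightarrow> level k (\<lambda>p. (u p) ^ j)"
  using level_comp2[where F = "\<lambda>x _. x ^ j"] .

lemma level_sum: "(\<And>i. i \<in> A \<Longrightarrow> level k (u i)) \<Longrightarrow> level k (\<lambda>p. \<Sum>i\<in>A. u i p)"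
  unfolding level_def by (metis (no_types, lifting) sum.cong)

lemma cell_cong: "c k p = c k q \<Longrightarrow> cell k p = cell k q"
  by (auto simp: cell_def)

lemma finite_cell [simp]: "finite (cell k p)"
  using finP by (simp add: cell_def)

lemma cell_subset: "cell k p \<subseteq> P"
  by (auto simp: cell_def)

lemma cell_self: "p \<in> P \<Longrightarrow> p \<in> cell k p"
  by (auto simp: cell_def)

lemma mass_pos:
  assumes "p \<in> P" shows "0 < mass k p"
  unfolding mass_def
proof (rule sum_pos)
  show "cell k p \<noteq> {}" using cell_self[OF assms] by blast
qed (use m_pos cell_subset in auto)

lemma mass_cong: "c k p = c k q \<Longrightarrow> mass k p = mass k q"
  by (simp add: mass_def cell_def)

lemma mass_mono:
  assumes "p \<in> P" "k \<le> l" shows "mass k p \<le> mass l p"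
  unfolding mass_def
proof (rule sum_mono2)
  show "cell k p \<subseteq> cell l p" unfolding cell_def using assms c_mono by blast
qed (use m_pos in \<open>auto dest: subsetD[OF cell_subset] intro: less_imp_le\<close>)

lemma level_E: "level k (E k f)"
  by (auto simp: level_def E_def mass_def cell_def)

section \<open>Conditional expectations as orthogonal projections\<close>

lemma ip_commute: "ip f g = ip g f"
  by (simp add: ip_def mult.commute mult.left_commute)

lemma ip_diff_left: "ip (\<lambda>p. f p - g p) h = ip f h - ip g h"
  by (simp add: ip_def algebra_simps sum_subtractf)

lemma ip_diff_right: "ip h (\<lambda>p. f p - g p) = ip h f - ip h g"
  by (simp add: ip_def algebra_simps sum_subtractf)

lemma ip_self_nonneg: "0 \<le> ip f f"
  unfolding ip_def by (intro sum_nonneg) (use m_pos in \<open>auto simp: less_imp_le\<close>)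

lemma nrm_nonneg [simp]: "0 \<le> nrm f"
  by (simp add: nrm_def ip_self_nonneg)

lemma nrm_square: "(nrm f)\<^sup>2 = ip f f"
  unfolding nrm_def by (rule real_sqrt_pow2) (rule ip_self_nonneg)

lemma nrm_square_sum: "(nrm f)\<^sup>2 = (\<Sum>p\<in>P. (f p)\<^sup>2 * m p)"
  unfolding nrm_square ip_def by (simp add: power2_eq_square)

lemma ip_le: "ip f g \<le> nrm f * nrm g"
proof -
  have "ip f g = (\<Sum>p\<in>P. (f p * sqrt (m p)) * (g p * sqrt (m p)))"
    unfolding ip_def by (rule sum.cong) (use m_pos in \<open>auto simp: less_imp_le\<close>)
  also have "\<dots> \<le> sqrt (\<Sum>p\<in>P. (f p * sqrt (m p))\<^sup>2) * sqrt (\<Sum>p\<in>P. (g p * sqrt (m p))\<^sup>2)"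
    by (rule sum_mult_le_sqrt)
  also have "\<dots> = nrm f * nrm g"
  proof -
    have "(\<Sum>p\<in>P. (h p * sqrt (m p))\<^sup>2) = ip h h" for h
      unfolding ip_def by (rule sum.cong) (use m_pos in \<open>auto simp: less_imp_le power2_eq_square\<close>)
    then show ?thesis by (simp add: nrm_def)
  qed
  finally show ?thesis .
qed

lemma nrm_abs: "nrm (\<lambda>p. \<bar>f p\<bar>) = nrm f"
  by (simp add: nrm_def ip_def)

lemma abs_ip_le: "\<bar>ip f g\<bar> \<le> nrm f * nrm g"
proof -
  have "\<bar>ip f g\<bar> \<le> ip (\<lambda>p. \<bar>f p\<bar>) (\<lambda>p. \<bar>g p\<bar>)"
    unfolding ip_def by (rule order_trans[OF sum_abs])
      (rule sum_mono, use m_pos in \<open>auto simp: abs_mult less_imp_le\<close>)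
  also have "\<dots> \<le> nrm f * nrm g" using ip_le[of "\<lambda>p. \<bar>f p\<bar>" "\<lambda>p. \<bar>g p\<bar>"] by (simp add: nrm_abs)
  finally show ?thesis .
qed

lemma sum_cell: "(\<Sum>q\<in>cell k p. h q) = (\<Sum>q\<in>P. if c k q = c k p then h q else 0)"
  unfolding cell_def by (rule sum.inter_filter[OF finP])

text \<open>After exchanging the two sums, the masses of a cell add up to the normalising
  denominator. This is the defining property of conditional expectation, from which the tower
  property and Pythagoras follow without further computation.\<close>

lemma E_adjoint:
  assumes "level k u"
  shows "ip u (E k f) = ip u f"
proof -
  have "u p * E k f p * m p
      = (\<Sum>q\<in>P. if c k q = c k p then u p * m p / mass k p * (f q * m q) else 0)" for p
  proof -
    have "u p * E k f p * m p = (u p * m p / mass k p) * (\<Sum>q\<in>cell k p. f q * m q)"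
      by (simp add: E_def)
    also have "\<dots> = (\<Sum>q\<in>cell k p. u p * m p / mass k p * (f q * m q))"
      by (rule sum_distrib_left)
    finally show ?thesis by (simp only: sum_cell)
  qed
  then have "ip u (E k f)
      = (\<Sum>p\<in>P. \<Sum>q\<in>P. if c k q = c k p then u p * m p / mass k p * (f q * m q) else 0)"
    by (simp only: ip_def)
  also have "\<dots> = (\<Sum>q\<in>P. \<Sum>p\<in>P. if c k q = c k p then u p * m p / mass k p * (f q * m q) else 0)"
    by (rule sum.swap)
  also have "\<dots> = (\<Sum>q\<in>P. u q * f q * m q)"
  proof (rule sum.cong)
    fix q assume q: "q \<in> P"
    have "(\<Sum>p\<in>P. if c k q = c k p then u p * m p / mass k p * (f q * m q) else 0)
        = (\<Sum>p\<in>P. if c k p = c k q then u q / mass k q * (f q * m q) * m p else 0)"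
    proof (rule sum.cong)
      fix p assume p: "p \<in> P"
      show "(if c k q = c k p then u p * m p / mass k p * (f q * m q) else 0)
        = (if c k p = c k q then u q / mass k q * (f q * m q) * m p else 0)"
      proof (cases "c k p = c k q")
        case True
        then show ?thesis using levelD[OF assms p q True] mass_cong[OF True] by simp
      qed auto
    qed simp
    also have "\<dots> = (\<Sum>p\<in>cell k q. u q / mass k q * (f q * m q) * m p)"
      by (simp only: sum_cell)
    also have "\<dots> = u q / mass k q * (f q * m q) * mass k q"
      unfolding mass_def sum_distrib_left ..
    also have "\<dots> = u q * f q * m q" using mass_pos[OF q, of k] by simp
    finally show "(\<Sum>p\<in>P. if c k q = c k p then u p * m p / mass k p * (f q * m q) else 0) = u q * f q * m q" .
  qed simp
  finally show ?thesis by (simp only: ip_def)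
qed

text \<open>Testing against the indicator of a single cell recovers the average over it, so inner
  products with functions of level \<open>k\<close> determine \<open>E k f\<close>.\<close>

lemma E_eqI:
  assumes "level k v" "\<And>u. level k u \<Longrightarrow> ip u f = ip u v" "p \<in> P"
  shows "E k f p = v p"
proof -
  let ?u = "\<lambda>q. if c k q = c k p then 1 else 0 :: real"
  have lu: "level k ?u" by (auto simp: level_def)
  have *: "ip ?u h = (\<Sum>q\<in>cell k p. h q * m q)" for h
    unfolding ip_def sum_cell by (rule sum.cong) auto
  have "(\<Sum>q\<in>cell k p. f q * m q) = (\<Sum>q\<in>cell k p. v q * m q)"
    using assms(2)[OF lu] * by simp
  also have "\<dots> = v p * mass k p"
    unfolding mass_def sum_distrib_left
  proof (rule sum.cong)
    fix q assume "q \<in> cell k p"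
    then have "v q = v p" using levelD[OF assms(1) _ assms(3)] by (simp add: cell_def)
    then show "v q * m q = v p * m q" by simp
  qed simp
  finally show ?thesis using mass_pos[OF assms(3), of k] by (simp add: E_def)
qed

lemma E_E: "k \<le> l \<Longrightarrow> p \<in> P \<Longrightarrow> E l (E k f) p = E l f p"
  by (rule E_eqI) (auto simp: level_E E_adjoint level_mono)

lemma E_diff: "E k (\<lambda>p. f p - g p) p = E k f p - E k g p"
  by (simp add: E_def left_diff_distrib sum_subtractf diff_divide_distrib)

lemma E_add: "E k (\<lambda>p. f p + g p) p = E k f p + E k g p"
  by (simp add: E_def distrib_right sum.distrib add_divide_distrib)

lemma E_sum: "E k (\<lambda>p. \<Sum>i\<in>A. f i p) p = (\<Sum>i\<in>A. E k (f i) p)"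
proof -
  have "(\<Sum>q\<in>cell k p. (\<Sum>i\<in>A. f i q) * m q) = (\<Sum>i\<in>A. \<Sum>q\<in>cell k p. f i q * m q)"
    unfolding sum_distrib_right by (rule sum.swap)
  then show ?thesis by (simp only: E_def sum_divide_distrib)
qed

lemma E_nonneg:
  assumes "\<And>q. q \<in> P \<Longrightarrow> 0 \<le> f q" "p \<in> P" shows "0 \<le> E k f p"
  unfolding E_def
proof (intro divide_nonneg_pos sum_nonneg mass_pos assms)
  fix q assume "q \<in> cell k p"
  then have "q \<in> P" using cell_subset by blast
  then show "0 \<le> f q * m q" using assms(1) m_pos[of q] by simp
qed

lemma E_mult_level:
  assumes "level k u" "p \<in> P" shows "E k (\<lambda>p. u p * f p) p = u p * E k f p"
proof -
  have "(\<Sum>q\<in>cell k p. u q * f q * m q) = u p * (\<Sum>q\<in>cell k p. f q * m q)"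
    unfolding sum_distrib_left
  proof (rule sum.cong)
    fix q assume "q \<in> cell k p"
    then have "u q = u p" using levelD[OF assms(1) _ assms(2)] by (simp add: cell_def)
    then show "u q * f q * m q = u p * (f q * m q)" by simp
  qed simp
  then show ?thesis by (simp add: E_def)
qed

section \<open>Orthogonality of martingale differences\<close>

lemma nrm_E_diff:
  assumes "k \<le> l"
  shows "(nrm (\<lambda>p. E k f p - E l f p))\<^sup>2 = (nrm (E k f))\<^sup>2 - (nrm (E l f))\<^sup>2"
proof -
  have "ip (E l f) (E k f) = ip (E l f) f"
    by (rule E_adjoint) (use level_E level_mono assms in blast)
  moreover have "ip (E l f) (E l f) = ip (E l f) f" by (rule E_adjoint) (rule level_E)
  ultimately show ?thesis
    by (simp add: nrm_square ip_diff_left ip_diff_right ip_commute[of "E k f" "E l f"])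
qed

lemma nrm_E_decseq: "decseq (\<lambda>k. (nrm (E k f))\<^sup>2)"
proof (rule decseq_SucI)
  show "(nrm (E (Suc k) f))\<^sup>2 \<le> (nrm (E k f))\<^sup>2" for k
    using nrm_E_diff[of k "Suc k" f] zero_le_power2[of "nrm (\<lambda>p. E k f p - E (Suc k) f p)"] by simp
qed

lemma nrm_E_le: "nrm (E k f) \<le> nrm f"
proof -
  have "(nrm (E k f))\<^sup>2 = ip (E k f) f" by (simp add: nrm_square E_adjoint level_E)
  also have "\<dots> \<le> nrm (E k f) * nrm f" by (rule ip_le)
  finally show ?thesis
    by (smt (verit) nrm_nonneg mult_le_cancel_left_pos power2_eq_square)
qed

text \<open>By Pythagoras each square is a difference of the decreasing sequence
  \<open>(nrm (E k g))\<^sup>2\<close> over at most \<open>j + 1\<close> steps, and each step of the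
  shift costs one telescoping sum. The freedom in \<open>\<kappa>\<close> serves both halves of the
  telescoped form, one of which contains \<open>E (k - 1) g\<close> and the other
  \<open>E k g\<close>.\<close>

lemma sum_nrm_E_diff:
  assumes "\<And>k. k - 1 \<le> \<kappa> k \<and> \<kappa> k \<le> k"
  shows "(\<Sum>k=1..N. (nrm (\<lambda>p. E (\<kappa> k) g p - E (k + j) g p))\<^sup>2) \<le> real (j + 1) * (nrm g)\<^sup>2"
proof -
  let ?a = "\<lambda>k. (nrm (E k g))\<^sup>2"
  have "(\<Sum>k=1..N. (nrm (\<lambda>p. E (\<kappa> k) g p - E (k + j) g p))\<^sup>2) \<le> (\<Sum>k=1..N. ?a (k - 1) - ?a (k + j))"
  proof (rule sum_mono)
    fix k
    have "\<kappa> k \<le> k + j" using assms[of k] by auto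
    then show "(nrm (\<lambda>p. E (\<kappa> k) g p - E (k + j) g p))\<^sup>2 \<le> ?a (k - 1) - ?a (k + j)"
      using nrm_E_diff[of "\<kappa> k" "k + j" g] decseqD[OF nrm_E_decseq[of g], of "k - 1" "\<kappa> k"] assms[of k]
      by simp
  qed
  also have "\<dots> = (\<Sum>k<N. ?a k - ?a (k + (j + 1)))"
    by (rule sum.reindex_bij_witness[of _ Suc "\<lambda>k. k - 1"]) auto
  also have "\<dots> \<le> real (j + 1) * ?a 0"
    by (rule sum_shift_diff_le) (auto simp: nrm_E_decseq)
  also have "\<dots> \<le> real (j + 1) * (nrm g)\<^sup>2"
    using nrm_E_le[of 0 g] by (intro mult_left_mono power_mono) auto
  finally show ?thesis .
qed

lemma sum_nrm_D: "(\<Sum>k=1..N. (nrm (D k f))\<^sup>2) \<le> (nrm f)\<^sup>2"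
  using sum_nrm_E_diff[of "\<lambda>k. k - 1" f 0 N] by (simp add: D_def[abs_def])

lemma level_D: "level (k - 1) (D k f)"
  unfolding D_def by (intro level_diff level_E level_mono[OF level_E]) simp

lemma E_D: "p \<in> P \<Longrightarrow> E k (D k f) p = 0"
  unfolding D_def E_diff by (simp add: E_E)

lemma ip_level_mean_zero:
  assumes "level k u" "\<And>p. p \<in> P \<Longrightarrow> E k h p = 0"
  shows "ip u h = 0"
proof -
  have "ip u h = ip u (E k h)" by (simp add: E_adjoint assms(1))
  also have "\<dots> = 0" by (simp add: ip_def assms(2))
  finally show ?thesis .
qed

text \<open>The Bellman function \<open>e\<^sup>2 / (1 + \<lambda>)\<close> of the average \<open>e\<close> and the accumulated Carleson mass
  \<open>\<lambda>\<close> decreases under averaging, by convexity, and drops by at least \<open>\<alpha> e\<^sup>2 / 4\<close> when the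
  density \<open>\<alpha>\<close> is added to \<open>\<lambda>\<close>.\<close>

lemma carleson_embedding_normalized:
  assumes nonneg: "\<And>l p. p \<in> P \<Longrightarrow> 0 \<le> \<alpha> l p"
    and carleson: "\<And>l p. p \<in> P \<Longrightarrow> (\<Sum>j\<le>l. E l (\<alpha> j) p) \<le> 1"
  shows "(\<Sum>l<L. ip (\<alpha> l) (\<lambda>p. (E l g p)\<^sup>2)) \<le> 4 * (nrm g)\<^sup>2"
proof -
  define lam where "lam l p = (\<Sum>j<l. E l (\<alpha> j) p)" for l p
  have lam_nonneg: "p \<in> P \<Longrightarrow> 0 \<le> lam l p" for l p
    unfolding lam_def by (intro sum_nonneg E_nonneg nonneg)
  have lev_lam: "level l (lam l)" for l
    unfolding lam_def by (intro level_sum level_E)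
  define \<Psi> where "\<Psi> l = (\<Sum>p\<in>P. (E l g p)\<^sup>2 / (1 + lam l p) * m p)" for l
  have step: "ip (\<alpha> l) (\<lambda>p. (E l g p)\<^sup>2) / 4 + \<Psi> (Suc l) \<le> \<Psi> l" for l
  proof -
    define mu where "mu p = lam l p + E l (\<alpha> l) p" for p
    have mu_sum: "mu p = (\<Sum>j\<le>l. E l (\<alpha> j) p)" for p
      by (simp add: mu_def lam_def lessThan_Suc_atMost[symmetric])
    have mu_le: "mu p \<le> 1" if "p \<in> P" for p using carleson that by (simp add: mu_sum)
    have al: "0 \<le> E l (\<alpha> l) p" if "p \<in> P" for p by (rule E_nonneg) (use nonneg that in auto)
    have mu_ge: "0 \<le> mu p" if "p \<in> P" for p using al lam_nonneg that by (simp add: mu_def)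
    have lam_mu: "lam (Suc l) p = E (Suc l) mu p" if "p \<in> P" for p
      unfolding lam_def mu_sum E_sum lessThan_Suc_atMost using that by (simp add: E_E)
    have "(E l g p)\<^sup>2 * E l (\<alpha> l) p / 4 + (E l g p)\<^sup>2 / (1 + mu p) \<le> (E l g p)\<^sup>2 / (1 + lam l p)"
      if p: "p \<in> P" for p
    proof -
      let ?b = "E l (\<alpha> l) p" and ?x = "lam l p"
      have "1 / (1 + ?x) - 1 / (1 + mu p) = ?b / ((1 + ?x) * (1 + mu p))"
        using lam_nonneg[OF p, of l] mu_ge[OF p] by (simp add: mu_def field_simps)
      \<comment> \<open>Both factors of the denominator are at most 2 because the accumulated mass
        stays below 1; this is the source of the constant 4.\<close>
      also have "\<dots> \<ge> ?b / (2 * 2)"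
        using lam_nonneg[OF p, of l] mu_ge[OF p] mu_le[OF p] al[OF p]
        by (intro divide_left_mono mult_mono mult_pos_pos) (auto simp: mu_def)
      finally have "?b / 4 + 1 / (1 + mu p) \<le> 1 / (1 + ?x)" by simp
      from mult_left_mono[OF this zero_le_power2[of "E l g p"]] show ?thesis
        by (simp add: distrib_left)
    qed
    then have "(\<Sum>p\<in>P. ((E l g p)\<^sup>2 * E l (\<alpha> l) p / 4 + (E l g p)\<^sup>2 / (1 + mu p)) * m p) \<le> \<Psi> l"
      unfolding \<Psi>_def by (intro sum_mono mult_right_mono) (use m_pos in \<open>auto simp: less_imp_le\<close>)
    moreover have "(\<Sum>p\<in>P. ((E l g p)\<^sup>2 * E l (\<alpha> l) p / 4 + (E l g p)\<^sup>2 / (1 + mu p)) * m p)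
       = ip (\<alpha> l) (\<lambda>p. (E l g p)\<^sup>2) / 4 + (\<Sum>p\<in>P. (E l g p)\<^sup>2 / (1 + mu p) * m p)"
    proof -
      have "ip (\<alpha> l) (\<lambda>p. (E l g p)\<^sup>2) = ip (\<lambda>p. (E l g p)\<^sup>2) (E l (\<alpha> l))"
        by (subst E_adjoint) (auto intro: level_power level_E ip_commute)
      then show ?thesis by (simp add: ip_def sum.distrib distrib_right sum_divide_distrib)
    qed
    moreover have "\<Psi> (Suc l) \<le> (\<Sum>p\<in>P. (E l g p)\<^sup>2 / (1 + mu p) * m p)"
    proof -
      \<comment> \<open>The optimal slope at the coarser level. It is constant on coarse cells, so
        the adjoint identity carries it to the finer level, where it is merely a competitor in the
        tangent bound.\<close>
      define r where "r p = E (Suc l) g p / (1 + lam (Suc l) p)" for p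
      have lr: "level (Suc l) r" unfolding r_def
        by (intro level_divide level_E level_add level_const lev_lam)
      have "\<Psi> (Suc l) = (\<Sum>p\<in>P. (2 * r p * E (Suc l) g p - (r p)\<^sup>2 * (1 + lam (Suc l) p)) * m p)"
        unfolding \<Psi>_def
      proof (rule sum.cong)
        fix p assume "p \<in> P"
        then have "0 < 1 + lam (Suc l) p" using lam_nonneg[of p "Suc l"] by simp
        then show "(E (Suc l) g p)\<^sup>2 / (1 + lam (Suc l) p) * m p
          = (2 * r p * E (Suc l) g p - (r p)\<^sup>2 * (1 + lam (Suc l) p)) * m p"
          unfolding r_def by (subst square_over_eq_tangent) simp
      qed simp
      also have "\<dots> = 2 * ip r (E (Suc l) g) - ip (\<lambda>p. (r p)\<^sup>2) (\<lambda>_. 1) - ip (\<lambda>p. (r p)\<^sup>2) (lam (Suc l))"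
        by (simp add: ip_def algebra_simps sum.distrib sum_subtractf sum_distrib_left)
      also have "ip r (E (Suc l) g) = ip r (E l g)"
        using E_adjoint[OF lr] E_adjoint[OF level_mono[OF lr], of l] by simp
      also have "ip (\<lambda>p. (r p)\<^sup>2) (lam (Suc l)) = ip (\<lambda>p. (r p)\<^sup>2) (E (Suc l) mu)"
        by (simp add: ip_def lam_mu)
      also have "\<dots> = ip (\<lambda>p. (r p)\<^sup>2) mu"
        by (intro E_adjoint level_power lr)
      also have "2 * ip r (E l g) - ip (\<lambda>p. (r p)\<^sup>2) (\<lambda>_. 1) - ip (\<lambda>p. (r p)\<^sup>2) mu
         = (\<Sum>p\<in>P. (2 * r p * E l g p - (r p)\<^sup>2 * (1 + mu p)) * m p)"
        by (simp add: ip_def algebra_simps sum.distrib sum_subtractf sum_distrib_left)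
      also have "\<dots> \<le> (\<Sum>p\<in>P. (E l g p)\<^sup>2 / (1 + mu p) * m p)"
        using mu_ge m_pos
        by (intro sum_mono mult_right_mono square_over_ge_tangent) (auto simp: less_imp_le add_pos_nonneg)
      finally show ?thesis .
    qed
    ultimately show ?thesis by linarith
  qed
  have "(\<Sum>l<L. ip (\<alpha> l) (\<lambda>p. (E l g p)\<^sup>2)) / 4 + \<Psi> L \<le> \<Psi> 0"
  proof (induction L)
    case (Suc L) then show ?case using step[of L] by (simp add: add_divide_distrib)
  qed simp
  moreover have "0 \<le> \<Psi> L"
    unfolding \<Psi>_def using lam_nonneg m_pos
    by (intro sum_nonneg mult_nonneg_nonneg divide_nonneg_nonneg) (auto simp: less_imp_le)
  moreover have "\<Psi> 0 = (nrm (E 0 g))\<^sup>2"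
    by (simp add: \<Psi>_def lam_def nrm_square_sum)
  moreover have "(nrm (E 0 g))\<^sup>2 \<le> (nrm g)\<^sup>2"
    using nrm_E_le by (intro power_mono) auto
  ultimately show ?thesis by linarith
qed

lemma carleson_embedding:
  assumes nonneg: "\<And>l p. p \<in> P \<Longrightarrow> 0 \<le> \<alpha> l p"
    and "0 < A"
    and carleson: "\<And>l p. p \<in> P \<Longrightarrow> (\<Sum>j\<le>l. \<Sum>q\<in>cell l p. \<alpha> j q * m q) \<le> A * mass l p"
  shows "(\<Sum>l<L. ip (\<alpha> l) (\<lambda>p. (E l g p)\<^sup>2)) \<le> 4 * A * (nrm g)\<^sup>2"
proof -
  have "(\<Sum>l<L. ip (\<lambda>p. \<alpha> l p / A) (\<lambda>p. (E l g p)\<^sup>2)) \<le> 4 * (nrm g)\<^sup>2"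
  proof (rule carleson_embedding_normalized)
    fix l p assume p: "p \<in> P"
    have "(\<Sum>j\<le>l. E l (\<lambda>p. \<alpha> j p / A) p) = (\<Sum>j\<le>l. \<Sum>q\<in>cell l p. \<alpha> j q * m q) / (A * mass l p)"
      by (simp add: E_def sum_divide_distrib)
    also have "\<dots> \<le> 1" using carleson[OF p] mass_pos[OF p] \<open>0 < A\<close> by simp
    finally show "(\<Sum>j\<le>l. E l (\<lambda>p. \<alpha> j p / A) p) \<le> 1" .
  qed (use nonneg \<open>0 < A\<close> in auto)
  moreover have "(\<Sum>l<L. ip (\<lambda>p. \<alpha> l p / A) (\<lambda>p. (E l g p)\<^sup>2)) = (\<Sum>l<L. ip (\<alpha> l) (\<lambda>p. (E l g p)\<^sup>2)) / A"
    by (simp add: ip_def sum_divide_distrib)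
  ultimately show ?thesis using \<open>0 < A\<close> by (simp add: field_simps)
qed

text \<open>Since \<open>h\<close> has mean zero on cells, the value of \<open>b\<close> at a
  representative of each cell may be subtracted, and only the oscillation of \<open>b\<close>
  survives. The oscillation bound is demanded only where \<open>h\<close> and \<open>F\<close> are
  nonzero, because the kernel is known to be smooth only at good cells and away from the
  ancestor.\<close>

lemma sum_mean_zero_le:
  assumes mean: "\<And>p. p \<in> P \<Longrightarrow> E k h p = 0" and F: "level k F"
    and osc: "\<And>p p'. p \<in> P \<Longrightarrow> p' \<in> P \<Longrightarrow> c k p' = c k p \<Longrightarrow> h p \<noteq> 0 \<Longrightarrow> F p \<noteq> 0
      \<Longrightarrow> \<bar>b p - b p'\<bar> \<le> \<beta> p"
  shows "\<bar>\<Sum>p\<in>P. h p * F p * b p * m p\<bar> \<le> (\<Sum>p\<in>P. \<bar>h p\<bar> * \<bar>F p\<bar> * \<beta> p * m p)"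
proof -
  \<comment> \<open>The choice depends on the label only, which makes \<open>b (rep p)\<close>
    constant on cells.\<close>
  define rep where "rep p = (SOME p'. p' \<in> P \<and> c k p' = c k p)" for p
  have rep: "rep p \<in> P" "c k (rep p) = c k p" if "p \<in> P" for p
    using someI[of "\<lambda>p'. p' \<in> P \<and> c k p' = c k p" p] that by (auto simp: rep_def)
  have rep_eq: "rep p = rep q" if "c k p = c k q" for p q
    unfolding rep_def that ..
  have "level k (\<lambda>p. b (rep p))" unfolding level_def using rep_eq by metis
  then have "ip (\<lambda>p. F p * b (rep p)) h = 0"
    by (intro ip_level_mean_zero[OF _ mean] level_mult F)
  then have "(\<Sum>p\<in>P. h p * F p * b p * m p) = (\<Sum>p\<in>P. h p * F p * (b p - b (rep p)) * m p)"
    by (simp add: ip_def algebra_simps sum_subtractf)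
  also have "\<bar>\<dots>\<bar> \<le> (\<Sum>p\<in>P. \<bar>h p\<bar> * \<bar>F p\<bar> * \<beta> p * m p)"
  proof (rule order_trans[OF sum_abs], rule sum_mono)
    fix p assume p: "p \<in> P"
    show "\<bar>h p * F p * (b p - b (rep p)) * m p\<bar> \<le> \<bar>h p\<bar> * \<bar>F p\<bar> * \<beta> p * m p"
    proof (cases "h p = 0 \<or> F p = 0")
      case False
      then have "\<bar>b p - b (rep p)\<bar> \<le> \<beta> p" using osc[OF p, of "rep p"] rep[OF p] by simp
      then show ?thesis using m_pos[OF p]
        by (simp add: abs_mult mult_left_mono mult_right_mono)
    qed auto
  qed
  finally show ?thesis .
qed

lemma nrm_E_diff_mono:
  assumes "j' \<le> j" "j \<le> l"
  shows "nrm (\<lambda>p. E j g p - E l g p) \<le> nrm (\<lambda>p. E j' g p - E l g p)"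
proof (rule power2_le_imp_le)
  show "(nrm (\<lambda>p. E j g p - E l g p))\<^sup>2 \<le> (nrm (\<lambda>p. E j' g p - E l g p))\<^sup>2"
    using nrm_E_diff[of j l g] nrm_E_diff[of j' l g] decseqD[OF nrm_E_decseq[of g] assms(1)] assms
    by simp
qed simp

text \<open>Multiplying \<open>D k f\<close> by a function of level \<open>k\<close> keeps it
  measurable at level \<open>k - 1\<close> and of mean zero on cells of level \<open>k\<close>, so
  it stays in the range of the projection \<open>D k\<close>.\<close>

lemma ip_level_D:
  assumes "level k u"
  shows "ip (\<lambda>p. u p * D k f p) t = ip (\<lambda>p. u p * D k f p) (D k t)"
proof -
  have "level (k - 1) (\<lambda>p. u p * D k f p)"
    by (intro level_mult level_D level_mono[OF assms]) simp
  then have "ip (\<lambda>p. u p * D k f p) (E (k - 1) t) = ip (\<lambda>p. u p * D k f p) t"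
    by (rule E_adjoint)
  moreover have "ip (\<lambda>p. u p * D k f p) (E k t) = ip (\<lambda>p. u p * E k t p) (D k f)"
    by (simp add: ip_def mult_ac)
  moreover have "\<dots> = 0"
    by (intro ip_level_mean_zero[of k] level_mult assms level_E E_D)
  ultimately show ?thesis unfolding D_def[of k t, abs_def] ip_diff_right by simp
qed

text \<open>Every cell of level \<open>j\<close> contributes at most one, whatever its mass.
  Counting cells takes the place of a doubling condition.\<close>

lemma sum_mass_ratio_le: "(\<Sum>q\<in>cell l p. m q / mass j q) \<le> card (c j ` cell l p)"
proof -
  have "(\<Sum>q\<in>cell l p. m q / mass j q)
      = (\<Sum>y\<in>c j ` cell l p. \<Sum>q\<in>{q \<in> cell l p. c j q = y}. m q / mass j q)"
    by (rule sum.image_gen) simp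
  also have "\<dots> \<le> (\<Sum>y\<in>c j ` cell l p. 1)"
  proof (rule sum_mono)
    fix y assume "y \<in> c j ` cell l p"
    then obtain q0 where q0: "q0 \<in> P" "y = c j q0" using cell_subset by blast
    have "(\<Sum>q\<in>{q \<in> cell l p. c j q = y}. m q / mass j q) = (\<Sum>q\<in>{q \<in> cell l p. c j q = y}. m q / mass j q0)"
    proof (rule sum.cong)
      fix q assume "q \<in> {q \<in> cell l p. c j q = y}"
      then show "m q / mass j q = m q / mass j q0" using mass_cong[of j q q0] q0(2) by simp
    qed simp
    also have "\<dots> \<le> (\<Sum>q\<in>cell j q0. m q / mass j q0)"
    proof (rule sum_mono2)
      show "{q \<in> cell l p. c j q = y} \<subseteq> cell j q0" using q0 by (auto simp: cell_def)
      show "0 \<le> m b / mass j q0" if "b \<in> cell j q0 - {q \<in> cell l p. c j q = y}" for b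
        using m_pos[of b] mass_pos[OF q0(1), of j] cell_subset that by (force intro: divide_nonneg_pos)
    qed simp
    also have "\<dots> = 1" using mass_pos[OF q0(1), of j] by (simp add: mass_def sum_divide_distrib[symmetric])
    finally show "(\<Sum>q\<in>{q \<in> cell l p. c j q = y}. m q / mass j q) \<le> 1" .
  qed
  finally show ?thesis by simp
qed

end

text \<open>Expanding the squares, a pair \<open>i, i'\<close> is counted for the \<open>j\<close>
  below both \<open>n i\<close> and \<open>n i'\<close>, hence at most
  \<open>min (n i) (n i')\<close> times, which is at most the geometric mean. Thus the sum with
  square-root weights that controls the far part also controls the Carleson tails.\<close>

lemma sum_square_tails_le:
  fixes om :: "nat \<Rightarrow> real" and n :: "nat \<Rightarrow> nat"
  assumes "\<And>i. 0 \<le> om i"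
  shows "(\<Sum>j<J. (\<Sum>i<L. if j < n i then om i else 0)\<^sup>2) \<le> (\<Sum>i<L. om i * sqrt (n i))\<^sup>2"
proof -
  have "(\<Sum>j<J. (\<Sum>i<L. if j < n i then om i else 0)\<^sup>2)
      = (\<Sum>j<J. \<Sum>i<L. \<Sum>i'<L. if j < n i \<and> j < n i' then om i * om i' else 0)"
    by (auto simp: power2_eq_square sum_product intro!: sum.cong)
  also have "\<dots> = (\<Sum>i<L. \<Sum>i'<L. \<Sum>j<J. if j < n i \<and> j < n i' then om i * om i' else 0)"
    by (subst sum.swap, rule sum.cong[OF refl], rule sum.swap)
  also have "\<dots> \<le> (\<Sum>i<L. \<Sum>i'<L. om i * sqrt (n i) * (om i' * sqrt (n i')))"
  proof (intro sum_mono)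
    fix i i'
    have "(\<Sum>j<J. if j < n i \<and> j < n i' then om i * om i' else 0)
        = (\<Sum>j | j < J \<and> j < n i \<and> j < n i'. om i * om i')"
      by (simp add: sum.inter_filter[symmetric])
    also have "\<dots> = card {j. j < J \<and> j < n i \<and> j < n i'} * (om i * om i')" by simp
    also have "\<dots> \<le> real (min (n i) (n i')) * (om i * om i')"
    proof (intro mult_right_mono)
      have "card {j. j < J \<and> j < n i \<and> j < n i'} \<le> card {..<min (n i) (n i')}"
        by (intro card_mono) auto
      then show "real (card {j. j < J \<and> j < n i \<and> j < n i'}) \<le> real (min (n i) (n i'))" by simp
    qed (use assms in simp)
    also have "\<dots> \<le> (sqrt (n i) * sqrt (n i')) * (om i * om i')"
    proof (intro mult_right_mono)
      let ?x = "real (min (n i) (n i'))"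
      have "?x = sqrt ?x * sqrt ?x" by simp
      also have "\<dots> \<le> sqrt (n i) * sqrt (n i')" by (intro mult_mono) auto
      finally show "?x \<le> sqrt (n i) * sqrt (n i')" .
    qed (use assms in simp)
    finally show "(\<Sum>j<J. if j < n i \<and> j < n i' then om i * om i' else 0)
      \<le> om i * sqrt (n i) * (om i' * sqrt (n i'))" by (simp add: mult_ac)
  qed
  also have "\<dots> = (\<Sum>i<L. om i * sqrt (n i))\<^sup>2"
    by (simp add: power2_eq_square sum_product)
  finally show ?thesis .
qed

section \<open>The form on a fixed grid\<close>

text \<open>What one grid has to provide. The weight \<open>w\<close> vanishes on bad cells;
  \<open>lev k p q\<close> is the dyadic distance in units of the side length of level
  \<open>k\<close>; \<open>V (k + i)\<close> bounds the mass within distance \<open>lev = i\<close>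
  and scales the kernel at that distance, so that actual masses of cells never appear in the far
  estimates. The number \<open>r\<close> is the relative level of the fixed ancestor, and
  \<open>far\<close> expresses goodness: two points separated at level \<open>k + r\<close> still
  share the cell \<open>2 * lev + 2\<close> levels up.\<close>

locale testing_kernel = filtration P m c
  for P :: "'p set" and m :: "'p \<Rightarrow> real" and c :: "nat \<Rightarrow> 'p \<Rightarrow> 'l" +
  fixes a :: "'p \<Rightarrow> 'p \<Rightarrow> real" and w :: "nat \<Rightarrow> 'p \<Rightarrow> real" and lev :: "nat \<Rightarrow> 'p \<Rightarrow> 'p \<Rightarrow> nat"
    and V om :: "nat \<Rightarrow> real" and r L :: nat and B Dn S :: real
  assumes w_cong: "p \<in> P \<Longrightarrow> q \<in> P \<Longrightarrow> c k p = c k q \<Longrightarrow> w k p = w k q"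
    and w_nonneg: "0 \<le> w k p" and w_le: "w k p \<le> 2"
    and testing: "p \<in> P \<Longrightarrow> (\<Sum>x\<in>P. (\<Sum>q\<in>cell k p. a x q * m q)\<^sup>2 * m x) \<le> B\<^sup>2 * mass k p"
    and B_nonneg: "0 \<le> B"
    and cells: "p \<in> P \<Longrightarrow> 1 \<le> k \<Longrightarrow> (\<Sum>q\<in>cell (k + r) p. m q / mass (k - 1) q) \<le> Dn"
    and Dn_nonneg: "0 \<le> Dn"
    and V_pos: "0 < V k"
    and lev_mass1: "p \<in> P \<Longrightarrow> (\<Sum>q | q \<in> P \<and> lev k p q = i. m q) \<le> V (k + i)"
    and lev_mass2: "q \<in> P \<Longrightarrow> (\<Sum>p | p \<in> P \<and> lev k p q = i. m p) \<le> V (k + i)"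
    and far: "1 \<le> k \<Longrightarrow> p \<in> P \<Longrightarrow> q \<in> P \<Longrightarrow> w k p \<noteq> 0 \<Longrightarrow> c (k + r) q \<noteq> c (k + r) p
      \<Longrightarrow> lev k p q < L \<and> c (k + 2 * lev k p q + 2) q = c (k + 2 * lev k p q + 2) p"
    and smooth: "1 \<le> k \<Longrightarrow> p \<in> P \<Longrightarrow> q \<in> P \<Longrightarrow> w k p \<noteq> 0 \<Longrightarrow> c (k + r) q \<noteq> c (k + r) p
      \<Longrightarrow> p' \<in> P \<Longrightarrow> c k p' = c k p
      \<Longrightarrow> \<bar>a p q - a p' q\<bar> \<le> om (lev k p q) / V (k + lev k p q)"
    and om_nonneg: "0 \<le> om i"
    and om_sum: "(\<Sum>i<L. om i * sqrt (2 * i + 3)) \<le> S"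
begin

section \<open>Weighted differences and Schur's test\<close>

definition h :: "nat \<Rightarrow> ('p \<Rightarrow> real) \<Rightarrow> 'p \<Rightarrow> real" where
  "h k f p = w k p * D k f p"

lemma level_w: "level k (w k)"
  unfolding level_def using w_cong by blast

lemma E_h: "p \<in> P \<Longrightarrow> E k (h k f) p = 0"
  unfolding h_def by (simp add: E_mult_level level_w E_D)

lemma abs_w_mult_le: "\<bar>w k p * x\<bar> \<le> 2 * \<bar>x\<bar>"
  using w_nonneg[of k p] w_le[of k p] by (simp add: abs_mult mult_right_mono)

lemma square_w_mult_le: "(w k p * x)\<^sup>2 \<le> 4 * x\<^sup>2"
proof -
  have "(w k p * x)\<^sup>2 = \<bar>w k p * x\<bar>\<^sup>2" by simp
  also have "\<dots> \<le> (2 * \<bar>x\<bar>)\<^sup>2" by (intro power_mono abs_w_mult_le) simp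
  finally show ?thesis by (simp add: power_mult_distrib)
qed

lemma nrm_h: "nrm (h k f) \<le> 2 * nrm (D k f)"
proof (rule power2_le_imp_le)
  have "(nrm (h k f))\<^sup>2 \<le> (\<Sum>p\<in>P. 4 * (D k f p)\<^sup>2 * m p)"
    unfolding nrm_square_sum h_def
    by (intro sum_mono mult_right_mono square_w_mult_le) (use m_pos in \<open>auto intro: less_imp_le\<close>)
  also have "\<dots> = (2 * nrm (D k f))\<^sup>2"
    by (simp add: power_mult_distrib nrm_square_sum sum_distrib_left mult.assoc)
  finally show "(nrm (h k f))\<^sup>2 \<le> (2 * nrm (D k f))\<^sup>2" .
qed simp

text \<open>Cauchy-Schwarz over the levels, the square function of \<open>f\<close> absorbing one
  factor. A bound \<open>Z\<close> on the squares becomes \<open>sqrt Z\<close>, which is how a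
  linear count of levels turns into a square root.\<close>

lemma sum_nrm_h_mult_le:
  assumes "(\<Sum>k=1..N. (z k)\<^sup>2) \<le> Z * (nrm g)\<^sup>2" "\<And>k. 0 \<le> z k" "0 \<le> Z"
  shows "(\<Sum>k=1..N. nrm (h k f) * z k) \<le> 2 * sqrt Z * (nrm f * nrm g)"
proof -
  have "(\<Sum>k=1..N. nrm (h k f) * z k) \<le> (\<Sum>k=1..N. 2 * (nrm (D k f) * z k))"
    using nrm_h assms(2) by (intro sum_mono) (simp add: mult_right_mono mult.assoc[symmetric])
  also have "\<dots> = 2 * (\<Sum>k=1..N. nrm (D k f) * z k)" by (simp add: sum_distrib_left)
  also have "\<dots> \<le> 2 * (sqrt (\<Sum>k=1..N. (nrm (D k f))\<^sup>2) * sqrt (\<Sum>k=1..N. (z k)\<^sup>2))"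
    by (intro mult_left_mono sum_mult_le_sqrt) simp
  also have "\<dots> \<le> 2 * (sqrt ((nrm f)\<^sup>2) * sqrt (Z * (nrm g)\<^sup>2))"
    by (intro mult_left_mono mult_mono real_sqrt_le_mono sum_nrm_D assms) (auto intro: sum_nonneg)
  also have "\<dots> = 2 * sqrt Z * (nrm f * nrm g)" by (simp add: real_sqrt_mult)
  finally show ?thesis .
qed

text \<open>Schur's test for the kernel \<open>lev k p q = i\<close>: Cauchy-Schwarz on pairs, with
  both marginals at most \<open>V (k + i)\<close>.\<close>

lemma schur:
  assumes "\<And>p. 0 \<le> x p" "\<And>p. 0 \<le> y p"
  shows "(\<Sum>q\<in>P. \<Sum>p\<in>P. if lev k p q = i then x p * y q * m p * m q else 0) \<le> V (k + i) * (nrm x * nrm y)"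
proof -
  let ?I = "\<lambda>p q. if lev k p q = i then 1 else 0 :: real"
  let ?f = "\<lambda>(q,p). ?I p q * (x p * sqrt (m p) * sqrt (m q))"
  let ?g = "\<lambda>(q,p). ?I p q * (y q * sqrt (m p) * sqrt (m q))"
  have "(\<Sum>q\<in>P. \<Sum>p\<in>P. if lev k p q = i then x p * y q * m p * m q else 0)
      = (\<Sum>z\<in>P \<times> P. ?f z * ?g z)"
    unfolding sum.cartesian_product
  proof (intro sum.cong, simp, clarify)
    fix p q assume "q \<in> P" "p \<in> P"
    then have "sqrt (m p) * sqrt (m p) = m p" "sqrt (m q) * sqrt (m q) = m q"
      using m_pos[of p] m_pos[of q] by simp_all
    then have "x p * sqrt (m p) * sqrt (m q) * (y q * sqrt (m p) * sqrt (m q)) = x p * y q * m p * m q"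
      by (metis (no_types, opaque_lifting) mult.assoc mult.left_commute)
    then show "(if lev k p q = i then x p * y q * m p * m q else 0)
      = ?I p q * (x p * sqrt (m p) * sqrt (m q)) * (?I p q * (y q * sqrt (m p) * sqrt (m q)))" by auto
  qed
  also have "\<dots> \<le> sqrt (\<Sum>z\<in>P \<times> P. (?f z)\<^sup>2) * sqrt (\<Sum>z\<in>P \<times> P. (?g z)\<^sup>2)"
    by (rule sum_mult_le_sqrt)
  also have "\<dots> \<le> sqrt (V (k + i) * (nrm x)\<^sup>2) * sqrt (V (k + i) * (nrm y)\<^sup>2)"
  proof (intro mult_mono real_sqrt_le_mono)
    have sq: "(?I p q * (t * sqrt (m p) * sqrt (m q)))\<^sup>2 = ?I p q * (t\<^sup>2 * m p * m q)"
      if "p \<in> P" "q \<in> P" for p q t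
      using m_pos[OF that(1)] m_pos[OF that(2)] by (simp add: power_mult_distrib)
    have "(\<Sum>z\<in>P \<times> P. (?f z)\<^sup>2) = (\<Sum>q\<in>P. \<Sum>p\<in>P. ?I p q * ((x p)\<^sup>2 * m p * m q))"
      unfolding sum.cartesian_product by (intro sum.cong) (auto simp: sq)
    also have "\<dots> = (\<Sum>p\<in>P. \<Sum>q\<in>P. ?I p q * ((x p)\<^sup>2 * m p * m q))" by (rule sum.swap)
    also have "\<dots> = (\<Sum>p\<in>P. (x p)\<^sup>2 * m p * (\<Sum>q | q \<in> P \<and> lev k p q = i. m q))"
      by (intro sum.cong) (auto simp: sum.inter_filter[OF finP] sum_distrib_left intro!: sum.cong)
    also have "\<dots> \<le> (\<Sum>p\<in>P. (x p)\<^sup>2 * m p * V (k + i))"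
      using lev_mass1 m_pos by (intro sum_mono mult_left_mono mult_nonneg_nonneg) (auto intro: less_imp_le)
    finally show "(\<Sum>z\<in>P \<times> P. (?f z)\<^sup>2) \<le> V (k + i) * (nrm x)\<^sup>2"
      by (simp add: nrm_square_sum sum_distrib_left mult_ac)
    have "(\<Sum>z\<in>P \<times> P. (?g z)\<^sup>2) = (\<Sum>q\<in>P. \<Sum>p\<in>P. ?I p q * ((y q)\<^sup>2 * m p * m q))"
      unfolding sum.cartesian_product by (intro sum.cong) (auto simp: sq)
    also have "\<dots> = (\<Sum>q\<in>P. (y q)\<^sup>2 * m q * (\<Sum>p | p \<in> P \<and> lev k p q = i. m p))"
      by (intro sum.cong) (auto simp: sum.inter_filter[OF finP] sum_distrib_left mult_ac intro!: sum.cong)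
    also have "\<dots> \<le> (\<Sum>q\<in>P. (y q)\<^sup>2 * m q * V (k + i))"
      using lev_mass2 m_pos by (intro sum_mono mult_left_mono mult_nonneg_nonneg) (auto intro: less_imp_le)
    finally show "(\<Sum>z\<in>P \<times> P. (?g z)\<^sup>2) \<le> V (k + i) * (nrm y)\<^sup>2"
      by (simp add: nrm_square_sum sum_distrib_left mult_ac)
  qed (auto intro: sum_nonneg simp: less_imp_le[OF V_pos])
  also have "\<dots> = V (k + i) * (nrm x * nrm y)"
    using V_pos[of "k + i"] by (simp add: real_sqrt_mult)
  finally show ?thesis .
qed

lemma schur_left:
  assumes "\<And>p. 0 \<le> x p" "\<And>p. 0 \<le> y p"
  shows "(\<Sum>q\<in>P. \<Sum>p\<in>P. if lev k p q = i then x p * y p * m p * m q else 0) \<le> V (k + i) * (nrm x * nrm y)"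
proof -
  have "(\<Sum>q\<in>P. \<Sum>p\<in>P. if lev k p q = i then x p * y p * m p * m q else 0)
      = (\<Sum>p\<in>P. x p * y p * m p * (\<Sum>q | q \<in> P \<and> lev k p q = i. m q))"
    by (subst sum.swap)
      (auto simp: sum.inter_filter[OF finP] sum_distrib_left intro!: sum.cong)
  also have "\<dots> \<le> (\<Sum>p\<in>P. x p * y p * m p * V (k + i))"
    using lev_mass1 m_pos assms
    by (intro sum_mono mult_left_mono mult_nonneg_nonneg) (auto intro: less_imp_le)
  also have "\<dots> = V (k + i) * ip x y" by (simp add: ip_def sum_distrib_left mult_ac)
  also have "\<dots> \<le> V (k + i) * (nrm x * nrm y)"
    using V_pos[of "k + i"] by (intro mult_left_mono ip_le) simp
  finally show ?thesis .
qed

text \<open>Cancellation of \<open>h k f\<close> replaces the kernel by its oscillation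
  \<open>om i / V (k + i)\<close> on the pairs with \<open>lev = i\<close>. Such pairs share a cell
  of level \<open>k + (2 * i + 2)\<close>, so the average of \<open>g\<close> over that cell can be
  subtracted from both \<open>E j g q\<close> and \<open>E (k + r) g p\<close>. Schur's test
  produces the factor \<open>V (k + i)\<close> that cancels the denominator.\<close>

lemma far_part:
  assumes k: "1 \<le> k" and j: "k - 1 \<le> j" "j \<le> k"
  shows "\<bar>\<Sum>p\<in>P. \<Sum>q\<in>P. if c (k + r) q \<noteq> c (k + r) p
      then a p q * m p * m q * h k f p * (E j g q - E (k + r) g p) else 0\<bar>
    \<le> (\<Sum>i<L. 2 * om i * (nrm (h k f) * nrm (\<lambda>p. E (k - 1) g p - E (k + (2 * i + 2)) g p)))"
proof -
  define F where "F q p = (if c (k + r) q \<noteq> c (k + r) p then E j g q - E (k + r) g p else 0)" for q p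
  define \<beta> where "\<beta> q p = om (lev k p q) / V (k + lev k p q)" for q p
  define u where "u i q = \<bar>E j g q - E (k + (2 * i + 2)) g q\<bar>" for i q
  \<comment> \<open>The minimum differs from \<open>k + r\<close> only for small \<open>i\<close>,
    where it makes \<open>v i\<close> vanish. For pairs in different cells of level
    \<open>k + r\<close> the common ancestor lies strictly higher, and the minimum is
    \<open>k + r\<close>.\<close>
  define v where "v i p = \<bar>E (min (k + r) (k + (2 * i + 2))) g p - E (k + (2 * i + 2)) g p\<bar>" for i p
  have \<beta>_nonneg: "0 \<le> \<beta> q p" for p q
    by (simp add: \<beta>_def om_nonneg V_pos less_imp_le)
  have levF: "level k (F q)" for q
  proof -
    have "c (k + r) p = c (k + r) p'" "E (k + r) g p = E (k + r) g p'"
      if "p \<in> P" "p' \<in> P" "c k p = c k p'" for p p'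
      using c_mono[OF that, of "k + r"] levelD[OF level_E that(1,2), of "k + r"] by auto
    then show ?thesis unfolding level_def F_def by metis
  qed
  have "(\<Sum>p\<in>P. \<Sum>q\<in>P. if c (k + r) q \<noteq> c (k + r) p
      then a p q * m p * m q * h k f p * (E j g q - E (k + r) g p) else 0)
     = (\<Sum>q\<in>P. m q * (\<Sum>p\<in>P. h k f p * F q p * a p q * m p))"
    by (subst sum.swap) (auto simp: F_def sum_distrib_left mult_ac intro!: sum.cong)
  also have "\<bar>\<dots>\<bar> \<le> (\<Sum>q\<in>P. m q * (\<Sum>p\<in>P. \<bar>h k f p\<bar> * \<bar>F q p\<bar> * \<beta> q p * m p))"
  proof (rule order_trans[OF sum_abs], rule sum_mono)
    fix q assume q: "q \<in> P"
    have "\<bar>\<Sum>p\<in>P. h k f p * F q p * a p q * m p\<bar> \<le> (\<Sum>p\<in>P. \<bar>h k f p\<bar> * \<bar>F q p\<bar> * \<beta> q p * m p)"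
    proof (rule sum_mean_zero_le[OF E_h levF])
      fix p p' assume "p \<in> P" "p' \<in> P" "c k p' = c k p" "h k f p \<noteq> 0" "F q p \<noteq> 0"
      then show "\<bar>a p q - a p' q\<bar> \<le> \<beta> q p"
        unfolding \<beta>_def using smooth[OF k _ q] by (auto simp: h_def F_def split: if_splits)
    qed
    then show "\<bar>m q * (\<Sum>p\<in>P. h k f p * F q p * a p q * m p)\<bar>
       \<le> m q * (\<Sum>p\<in>P. \<bar>h k f p\<bar> * \<bar>F q p\<bar> * \<beta> q p * m p)"
      using m_pos[OF q] by (simp add: abs_mult)
  qed
  also have "\<dots> \<le> (\<Sum>q\<in>P. m q * (\<Sum>p\<in>P. \<Sum>i<L.
      if lev k p q = i then om i / V (k + i) * (\<bar>h k f p\<bar> * (u i q + v i p) * m p) else 0))"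
  proof (intro sum_mono mult_left_mono)
    fix q p assume q: "q \<in> P" and p: "p \<in> P"
    let ?i = "lev k p q"
    let ?R = "\<lambda>i. om i / V (k + i) * (\<bar>h k f p\<bar> * (u i q + v i p) * m p)"
    have Rnn: "0 \<le> ?R i" for i
      using om_nonneg V_pos m_pos[OF p] by (simp add: u_def v_def less_imp_le)
    show "\<bar>h k f p\<bar> * \<bar>F q p\<bar> * \<beta> q p * m p \<le> (\<Sum>i<L. if ?i = i then ?R i else 0)"
    proof (cases "h k f p = 0 \<or> F q p = 0")
      case True
      then show ?thesis using Rnn by (auto intro: sum_nonneg)
    next
      case False
      then have w: "w k p \<noteq> 0" and cc: "c (k + r) q \<noteq> c (k + r) p"
        by (auto simp: h_def F_def split: if_splits)
      note fr = far[OF k p q w cc]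
      have cc': "c (k + (2 * ?i + 2)) q = c (k + (2 * ?i + 2)) p" using fr by (simp add: add.assoc)
      have "r < 2 * ?i + 2"
        using c_mono[OF q p cc', of "k + r"] cc by (meson add_le_mono leI le_refl)
      moreover have "E (k + (2 * ?i + 2)) g q = E (k + (2 * ?i + 2)) g p"
        by (rule levelD[OF level_E q p cc'])
      ultimately have "\<bar>F q p\<bar> \<le> u ?i q + v ?i p"
        unfolding F_def u_def v_def using cc by (simp add: min_def)
      then have "\<bar>h k f p\<bar> * \<bar>F q p\<bar> * \<beta> q p * m p \<le> \<bar>h k f p\<bar> * (u ?i q + v ?i p) * \<beta> q p * m p"
        using m_pos[OF p] \<beta>_nonneg by (intro mult_right_mono mult_left_mono) auto
      also have "\<dots> = (\<Sum>i<L. if ?i = i then ?R i else 0)"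
        using fr by (simp add: \<beta>_def)
      finally show ?thesis .
    qed
  qed (use m_pos in \<open>auto intro: less_imp_le\<close>)
  also have "\<dots> = (\<Sum>i<L. om i / V (k + i) *
      ((\<Sum>q\<in>P. \<Sum>p\<in>P. if lev k p q = i then \<bar>h k f p\<bar> * u i q * m p * m q else 0)
      + (\<Sum>q\<in>P. \<Sum>p\<in>P. if lev k p q = i then \<bar>h k f p\<bar> * v i p * m p * m q else 0)))"
    (is "?lhs = ?rhs")
  proof -
    have "?lhs = (\<Sum>q\<in>P. \<Sum>p\<in>P. \<Sum>i<L. 
      if lev k p q = i then om i / V (k + i) * (\<bar>h k f p\<bar> * (u i q + v i p) * m p * m q) else 0)"
      unfolding sum_distrib_left by (intro sum.cong) auto
    also have "\<dots> = (\<Sum>q\<in>P. \<Sum>i<L. \<Sum>p\<in>P. 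
      if lev k p q = i then om i / V (k + i) * (\<bar>h k f p\<bar> * (u i q + v i p) * m p * m q) else 0)"
      by (intro sum.cong refl sum.swap)
    also have "\<dots> = (\<Sum>i<L. \<Sum>q\<in>P. \<Sum>p\<in>P. 
      if lev k p q = i then om i / V (k + i) * (\<bar>h k f p\<bar> * (u i q + v i p) * m p * m q) else 0)"
      by (rule sum.swap)
    also have "\<dots> = ?rhs"
      unfolding sum.distrib[symmetric] sum_distrib_left
      by (intro sum.cong) (auto simp: algebra_simps)
    finally show ?thesis .
  qed
  also have "\<dots> \<le> (\<Sum>i<L. om i / V (k + i) *
      (V (k + i) * (nrm (h k f) * nrm (u i)) + V (k + i) * (nrm (h k f) * nrm (v i))))"
  proof (intro sum_mono mult_left_mono add_mono)
    fix i
    show "(\<Sum>q\<in>P. \<Sum>p\<in>P. if lev k p q = i then \<bar>h k f p\<bar> * u i q * m p * m q else 0)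
      \<le> V (k + i) * (nrm (h k f) * nrm (u i))"
      using schur[of "\<lambda>p. \<bar>h k f p\<bar>" "u i" k i] by (simp add: nrm_abs u_def)
    show "(\<Sum>q\<in>P. \<Sum>p\<in>P. if lev k p q = i then \<bar>h k f p\<bar> * v i p * m p * m q else 0)
      \<le> V (k + i) * (nrm (h k f) * nrm (v i))"
      using schur_left[of "\<lambda>p. \<bar>h k f p\<bar>" "v i" k i] by (simp add: nrm_abs v_def)
  qed (use om_nonneg V_pos in \<open>simp add: less_imp_le\<close>)
  also have "\<dots> \<le> (\<Sum>i<L. 2 * om i * (nrm (h k f) * nrm (\<lambda>p. E (k - 1) g p - E (k + (2 * i + 2)) g p)))"
  proof (rule sum_mono)
    fix i
    let ?z = "nrm (\<lambda>p. E (k - 1) g p - E (k + (2 * i + 2)) g p)"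
    have "nrm (u i) \<le> ?z" unfolding u_def nrm_abs by (rule nrm_E_diff_mono) (use j in auto)
    moreover have "nrm (v i) \<le> ?z" unfolding v_def nrm_abs by (rule nrm_E_diff_mono) auto
    ultimately have "nrm (u i) + nrm (v i) \<le> 2 * ?z" by simp
    then have "om i * (nrm (h k f) * (nrm (u i) + nrm (v i))) \<le> om i * (nrm (h k f) * (2 * ?z))"
      using om_nonneg by (intro mult_left_mono) auto
    moreover have "om i / V (k + i) * (V (k + i) * (nrm (h k f) * nrm (u i)) + V (k + i) * (nrm (h k f) * nrm (v i)))
        = om i * (nrm (h k f) * (nrm (u i) + nrm (v i)))"
      using V_pos[of "k + i"] by (simp add: field_simps)
    ultimately show "om i / V (k + i) * (V (k + i) * (nrm (h k f) * nrm (u i)) + V (k + i) * (nrm (h k f) * nrm (v i)))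
      \<le> 2 * om i * (nrm (h k f) * ?z)" by simp
  qed
  finally show ?thesis .
qed

lemma sum_far_part:
  "(\<Sum>k=1..N. \<Sum>i<L. 2 * om i * (nrm (h k f) * nrm (\<lambda>p. E (k - 1) g p - E (k + (2 * i + 2)) g p)))
    \<le> 4 * S * (nrm f * nrm g)"
proof -
  have "(\<Sum>k=1..N. \<Sum>i<L. 2 * om i * (nrm (h k f) * nrm (\<lambda>p. E (k - 1) g p - E (k + (2 * i + 2)) g p)))
    = (\<Sum>i<L. 2 * om i * (\<Sum>k=1..N. nrm (h k f) * nrm (\<lambda>p. E (k - 1) g p - E (k + (2 * i + 2)) g p)))"
    by (subst sum.swap) (simp add: sum_distrib_left)
  \<comment> \<open>A shift by \<open>2 * i + 2\<close> from level \<open>k\<close>, started one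
    level lower, spans \<open>2 * i + 3\<close> levels.\<close>
  also have "\<dots> \<le> (\<Sum>i<L. 2 * om i * (2 * sqrt (real (2 * i + 2 + 1)) * (nrm f * nrm g)))"
    using om_nonneg by (intro sum_mono mult_left_mono sum_nrm_h_mult_le sum_nrm_E_diff) auto
  also have "\<dots> = 4 * (\<Sum>i<L. om i * sqrt (2 * i + 3)) * (nrm f * nrm g)"
    by (simp add: sum_distrib_left sum_distrib_right mult_ac add.commute)
  also have "\<dots> \<le> 4 * S * (nrm f * nrm g)"
    using om_sum by (intro mult_right_mono mult_left_mono) auto
  finally show ?thesis .
qed

section \<open>Interaction inside the ancestor\<close>

lemma testing_E:
  assumes "q \<in> P"
  shows "(\<Sum>x\<in>P. (E j (a x) q)\<^sup>2 * m x) \<le> B\<^sup>2 / mass j q"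
proof -
  have mp: "0 < mass j q" by (rule mass_pos[OF assms])
  have "(\<Sum>x\<in>P. (E j (a x) q)\<^sup>2 * m x) = (\<Sum>x\<in>P. (\<Sum>q\<in>cell j q. a x q * m q)\<^sup>2 * m x) / (mass j q)\<^sup>2"
    by (simp only: E_def power_divide sum_divide_distrib[of _ P] times_divide_eq_left)
  also have "\<dots> \<le> B\<^sup>2 * mass j q / (mass j q)\<^sup>2"
    by (intro divide_right_mono testing assms) simp
  also have "\<dots> = B\<^sup>2 / mass j q" using mp by (simp add: power2_eq_square)
  finally show ?thesis .
qed

text \<open>As \<open>u\<close> is constant on cells of level \<open>j\<close>, each row of the
  kernel may be replaced by its averages \<open>E j (a p)\<close>, whose square norms in
  \<open>p\<close> are given by testing on those cells. Cauchy-Schwarz inside the ancestor then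
  costs the sum of the mass ratios, which \<open>Dn\<close> bounds.\<close>

lemma near_part:
  assumes k: "1 \<le> k" and j: "k - 1 \<le> j" "j \<le> k + r" and u: "level j u"
  shows "\<bar>\<Sum>p\<in>P. \<Sum>q\<in>P. if c (k + r) q = c (k + r) p then a p q * m p * m q * x p * u q else 0\<bar>
    \<le> B * sqrt Dn * (nrm x * nrm u)"
proof -
  define U where "U p = (\<Sum>q\<in>cell (k + r) p. (u q)\<^sup>2 * m q)" for p
  define W where "W p = (\<Sum>q\<in>cell (k + r) p. (E j (a p) q)\<^sup>2 * m q)" for p
  define y where "y p = (\<Sum>q\<in>cell (k + r) p. a p q * u q * m q)" for p
  have UW: "0 \<le> U p" "0 \<le> W p" for p
    unfolding U_def W_def by (auto intro!: sum_nonneg mult_nonneg_nonneg less_imp_le[OF m_pos] simp: cell_def)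
  have U_cong: "U p = U q" if "c (k + r) q = c (k + r) p" for p q
    unfolding U_def using cell_cong[OF that] by simp
  have y_le: "\<bar>y p\<bar> \<le> sqrt (U p) * sqrt (W p)" for p
  proof -
    \<comment> \<open>Cutting \<open>u\<close> off outside the ancestor keeps it at level
      \<open>j\<close>, because \<open>j\<close> does not exceed \<open>k + r\<close>.\<close>
    let ?u = "\<lambda>q. if c (k + r) q = c (k + r) p then u q else 0"
    have lu: "level j ?u"
      unfolding level_def using levelD[OF u] c_mono[OF _ _ _ j(2)] by metis
    have "y p = ip ?u (a p)"
      unfolding y_def ip_def sum_cell by (intro sum.cong) auto
    also have "\<dots> = ip ?u (E j (a p))" by (simp add: E_adjoint lu)
    also have "\<dots> = (\<Sum>q\<in>cell (k + r) p. (u q * sqrt (m q)) * (E j (a p) q * sqrt (m q)))"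
      unfolding ip_def sum_cell using m_pos by (intro sum.cong) (auto simp: less_imp_le)
    finally have y: "y p = \<dots>" .
    have sq: "(t * sqrt (m q))\<^sup>2 = t\<^sup>2 * m q" if "q \<in> cell (k + r) p" for q t
      using that m_pos[of q] by (simp add: cell_def power_mult_distrib)
    have "\<bar>y p\<bar> \<le> (\<Sum>q\<in>cell (k + r) p. \<bar>u q * sqrt (m q)\<bar> * \<bar>E j (a p) q * sqrt (m q)\<bar>)"
      unfolding y by (rule order_trans[OF sum_abs]) (simp add: abs_mult)
    also have "\<dots> \<le> sqrt (\<Sum>q\<in>cell (k + r) p. \<bar>u q * sqrt (m q)\<bar>\<^sup>2)
        * sqrt (\<Sum>q\<in>cell (k + r) p. \<bar>E j (a p) q * sqrt (m q)\<bar>\<^sup>2)"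
      by (rule sum_mult_le_sqrt)
    also have "\<dots> = sqrt (U p) * sqrt (W p)"
      by (simp add: U_def W_def sq)
    finally show ?thesis .
  qed
  have nrm_y: "nrm y \<le> B * sqrt Dn * nrm u"
  proof (rule power2_le_imp_le)
    have "(nrm y)\<^sup>2 \<le> (\<Sum>p\<in>P. U p * W p * m p)"
      unfolding nrm_square_sum
    proof (intro sum_mono mult_right_mono)
      fix p
      have "(y p)\<^sup>2 \<le> (sqrt (U p) * sqrt (W p))\<^sup>2"
        using power_mono[OF y_le[of p], of 2] by simp
      then show "(y p)\<^sup>2 \<le> U p * W p" using UW by (simp add: power_mult_distrib)
    qed (use m_pos in \<open>auto intro: less_imp_le\<close>)
    also have "\<dots> = (\<Sum>p\<in>P. \<Sum>q\<in>P. if c (k + r) q = c (k + r) p then U q * m q * ((E j (a p) q)\<^sup>2 * m p) else 0)"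
    proof (intro sum.cong refl)
      fix p
      have "U p * W p * m p = (\<Sum>q\<in>P. if c (k + r) q = c (k + r) p then U p * ((E j (a p) q)\<^sup>2 * m q) * m p else 0)"
        unfolding W_def sum_cell[symmetric] sum_distrib_left sum_distrib_right ..
      also have "\<dots> = (\<Sum>q\<in>P. if c (k + r) q = c (k + r) p then U q * m q * ((E j (a p) q)\<^sup>2 * m p) else 0)"
      proof (intro sum.cong refl)
        fix q
        show "(if c (k + r) q = c (k + r) p then U p * ((E j (a p) q)\<^sup>2 * m q) * m p else 0)
          = (if c (k + r) q = c (k + r) p then U q * m q * ((E j (a p) q)\<^sup>2 * m p) else 0)"
          using U_cong[of q p] by simp
      qed
      finally show "U p * W p * m p
        = (\<Sum>q\<in>P. if c (k + r) q = c (k + r) p then U q * m q * ((E j (a p) q)\<^sup>2 * m p) else 0)" .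
    qed
    also have "\<dots> = (\<Sum>q\<in>P. \<Sum>p\<in>P. if c (k + r) q = c (k + r) p then U q * m q * ((E j (a p) q)\<^sup>2 * m p) else 0)"
      by (rule sum.swap)
    also have "\<dots> \<le> (\<Sum>q\<in>P. U q * m q * (\<Sum>p\<in>P. (E j (a p) q)\<^sup>2 * m p))"
      unfolding sum_distrib_left using UW m_pos
      by (intro sum_mono) (auto intro!: mult_nonneg_nonneg intro: less_imp_le)
    also have "\<dots> \<le> (\<Sum>q\<in>P. U q * m q * (B\<^sup>2 / mass (k - 1) q))"
    proof (intro sum_mono mult_left_mono)
      fix q assume q: "q \<in> P"
      have "B\<^sup>2 / mass j q \<le> B\<^sup>2 / mass (k - 1) q"
        using mass_mono[OF q j(1)] mass_pos[OF q] by (intro divide_left_mono mult_pos_pos) auto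
      then show "(\<Sum>p\<in>P. (E j (a p) q)\<^sup>2 * m p) \<le> B\<^sup>2 / mass (k - 1) q"
        using testing_E[OF q, of j] by simp
    qed (use UW m_pos in \<open>auto intro!: mult_nonneg_nonneg intro: less_imp_le\<close>)
    also have "\<dots> = (\<Sum>q\<in>P. \<Sum>q'\<in>P. if c (k + r) q' = c (k + r) q
        then B\<^sup>2 * ((u q')\<^sup>2 * m q' * (m q / mass (k - 1) q)) else 0)"
      unfolding U_def sum_cell sum_distrib_left sum_distrib_right
      by (intro sum.cong) auto
    also have "\<dots> = (\<Sum>q'\<in>P. \<Sum>q\<in>P. if c (k + r) q' = c (k + r) q
        then B\<^sup>2 * ((u q')\<^sup>2 * m q' * (m q / mass (k - 1) q)) else 0)"
      by (rule sum.swap)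
    also have "\<dots> = (\<Sum>q'\<in>P. B\<^sup>2 * ((u q')\<^sup>2 * m q' * (\<Sum>q\<in>cell (k + r) q'. m q / mass (k - 1) q)))"
      unfolding sum_cell sum_distrib_left by (intro sum.cong) auto
    also have "\<dots> \<le> (\<Sum>q'\<in>P. B\<^sup>2 * ((u q')\<^sup>2 * m q' * Dn))"
      using cells k m_pos by (intro sum_mono mult_left_mono mult_nonneg_nonneg) (auto intro: less_imp_le)
    also have "\<dots> = B\<^sup>2 * Dn * (nrm u)\<^sup>2"
      by (simp add: nrm_square_sum sum_distrib_left mult_ac)
    also have "\<dots> = (B * sqrt Dn * nrm u)\<^sup>2"
      using Dn_nonneg by (simp add: power_mult_distrib)
    finally show "(nrm y)\<^sup>2 \<le> (B * sqrt Dn * nrm u)\<^sup>2" .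
  qed (use B_nonneg Dn_nonneg in auto)
  have "(\<Sum>p\<in>P. \<Sum>q\<in>P. if c (k + r) q = c (k + r) p then a p q * m p * m q * x p * u q else 0)
    = ip x y"
    unfolding ip_def y_def sum_cell sum_distrib_left sum_distrib_right
    by (intro sum.cong) auto
  also have "\<bar>\<dots>\<bar> \<le> nrm x * nrm y" by (rule abs_ip_le)
  also have "\<dots> \<le> nrm x * (B * sqrt Dn * nrm u)"
    using nrm_y by (intro mult_left_mono) auto
  finally show ?thesis by (simp add: mult_ac)
qed

section \<open>The paraproduct and its Carleson condition\<close>

definition tau :: "'p \<Rightarrow> real" where
  "tau p = (\<Sum>q\<in>P. a p q * m q)"

lemma om_sum': "(\<Sum>i<L. om i * sqrt (2 * i + 2)) \<le> S"
proof -
  have "(\<Sum>i<L. om i * sqrt (2 * i + 2)) \<le> (\<Sum>i<L. om i * sqrt (2 * i + 3))"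
    using om_nonneg by (intro sum_mono mult_left_mono real_sqrt_le_mono) auto
  then show ?thesis using om_sum by linarith
qed

lemma S_nonneg: "0 \<le> S"
  using om_sum' om_nonneg sum_nonneg[of "{..<L}" "\<lambda>i. om i * sqrt (2 * i + 2)"] by fastforce

text \<open>The mass \<open>\<Omega> (l - k)\<close> is what the kernel can carry from a cell of level \<open>k\<close> to the
  outside of its ancestor of level \<open>l\<close>.\<close>

lemma outside_part:
  assumes k: "1 \<le> k" "k + r \<le> l" and R: "z \<in> P"
  defines "t \<equiv> \<lambda>p. \<Sum>q\<in>P - cell l z. a p q * m q"
  shows "(\<Sum>p\<in>cell l z. (w k p * D k t p)\<^sup>2 * m p)
    \<le> 4 * (\<Sum>i<L. if l - k < 2 * i + 2 then om i else 0)\<^sup>2 * mass l z"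
proof -
  define Om where "Om = (\<Sum>i<L. if l - k < 2 * i + 2 then om i else 0)"
  define X where "X = (\<Sum>p\<in>cell l z. (w k p * D k t p)\<^sup>2 * m p)"
  \<comment> \<open>With the weight squared, \<open>X\<close> becomes a linear pairing with
    \<open>t\<close>, to which cancellation and smoothness apply. The result bounds \<open>X\<close>
    by a multiple of \<open>sqrt X\<close>, and dividing by \<open>sqrt X\<close> closes the
    estimate.\<close>
  define v where "v p = (if c l p = c l z then (w k p)\<^sup>2 else 0)" for p
  define th where "th p = v p * D k t p" for p
  have Om_nonneg: "0 \<le> Om" unfolding Om_def using om_nonneg by (intro sum_nonneg) auto
  have lv: "level k v"
    unfolding level_def v_def using w_cong c_mono[of _ _ k l] k(2) by (metis add_leD1)
  have Eth: "E k th p = 0" if "p \<in> P" for p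
    unfolding th_def using that by (simp add: E_mult_level lv E_D)
  have X_nonneg: "0 \<le> X"
    unfolding X_def by (auto intro!: sum_nonneg mult_nonneg_nonneg less_imp_le[OF m_pos] simp: cell_def)
  have "X = ip (\<lambda>p. v p * D k t p) (D k t)"
    unfolding X_def ip_def sum_cell v_def by (intro sum.cong) (auto simp: power2_eq_square)
  also have "\<dots> = ip th t" unfolding th_def using ip_level_D[OF lv] by simp
  also have "\<dots> = (\<Sum>q\<in>P - cell l z. m q * (\<Sum>p\<in>P. th p * 1 * a p q * m p))"
    unfolding ip_def t_def sum_distrib_left sum_distrib_right
    by (subst sum.swap) (auto simp: mult_ac intro!: sum.cong)
  also have "\<dots> \<le> (\<Sum>q\<in>P - cell l z. m q * (\<Sum>p\<in>P. \<bar>th p\<bar> * \<bar>1\<bar> * (om (lev k p q) / V (k + lev k p q)) * m p))"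
  proof (rule sum_mono)
    fix q assume q: "q \<in> P - cell l z"
    have "\<bar>\<Sum>p\<in>P. th p * 1 * a p q * m p\<bar>
        \<le> (\<Sum>p\<in>P. \<bar>th p\<bar> * \<bar>1\<bar> * (om (lev k p q) / V (k + lev k p q)) * m p)"
    proof (rule sum_mean_zero_le[where F = "\<lambda>_. 1" and b = "\<lambda>p. a p q"
          and \<beta> = "\<lambda>p. om (lev k p q) / V (k + lev k p q)", OF Eth level_const])
      fix p p' assume *: "p \<in> P" "p' \<in> P" "c k p' = c k p" "th p \<noteq> 0"
      then have "w k p \<noteq> 0" "c l p = c l z" by (auto simp: th_def v_def split: if_splits)
      moreover have "c (k + r) q \<noteq> c (k + r) p"
        using c_mono[of q p "k + r" l] q * k(2) \<open>c l p = c l z\<close> by (auto simp: cell_def)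
      ultimately show "\<bar>a p q - a p' q\<bar> \<le> om (lev k p q) / V (k + lev k p q)"
        using smooth[OF k(1) *(1) _ _ _ *(2,3)] q by blast
    qed
    then show "m q * (\<Sum>p\<in>P. th p * 1 * a p q * m p)
        \<le> m q * (\<Sum>p\<in>P. \<bar>th p\<bar> * \<bar>1\<bar> * (om (lev k p q) / V (k + lev k p q)) * m p)"
      using q m_pos[of q] by (intro mult_left_mono) auto
  qed
  also have "\<dots> = (\<Sum>p\<in>P. \<bar>th p\<bar> * m p * (\<Sum>q\<in>P - cell l z. om (lev k p q) / V (k + lev k p q) * m q))"
    unfolding sum_distrib_left by (subst sum.swap) (auto simp: mult_ac intro!: sum.cong)
  also have "\<dots> \<le> (\<Sum>p\<in>P. \<bar>th p\<bar> * m p * Om)"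
  proof (rule sum_mono)
    fix p assume p: "p \<in> P"
    show "\<bar>th p\<bar> * m p * (\<Sum>q\<in>P - cell l z. om (lev k p q) / V (k + lev k p q) * m q) \<le> \<bar>th p\<bar> * m p * Om"
    proof (cases "th p = 0")
      case False
      then have w: "w k p \<noteq> 0" and cl: "c l p = c l z" by (auto simp: th_def v_def split: if_splits)
      have "(\<Sum>q\<in>P - cell l z. om (lev k p q) / V (k + lev k p q) * m q)
          \<le> (\<Sum>q\<in>P - cell l z. \<Sum>i<L. if lev k p q = i \<and> l - k < 2 * i + 2 then om i / V (k + i) * m q else 0)"
      proof (rule sum_mono)
        fix q assume q: "q \<in> P - cell l z"
        have ne: "c l q \<noteq> c l p" using q cl by (auto simp: cell_def)
        then have "c (k + r) q \<noteq> c (k + r) p" using c_mono[of q p "k + r" l] q p k(2) by auto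
        then have fr: "lev k p q < L" "c (k + 2 * lev k p q + 2) q = c (k + 2 * lev k p q + 2) p"
          using far[OF k(1) p _ w] q by auto
        \<comment> \<open>The point \<open>q\<close> lies outside the cell of level
          \<open>l\<close>, so the cell shared with \<open>p\<close> must be of higher level. This
          restricts the sum to the tail defining \<open>Om\<close>.\<close>
        have "l < k + 2 * lev k p q + 2"
          using c_mono[OF _ p fr(2), of l] q ne by (meson DiffD1 leI)
        then have "l - k < 2 * lev k p q + 2" by simp
        then have "(if lev k p q = i \<and> l - k < 2 * i + 2 then om i / V (k + i) * m q else 0)
          = (if i = lev k p q then om i / V (k + i) * m q else 0)" for i by auto
        then show "om (lev k p q) / V (k + lev k p q) * m q
          \<le> (\<Sum>i<L. if lev k p q = i \<and> l - k < 2 * i + 2 then om i / V (k + i) * m q else 0)"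
          using fr(1) by simp
      qed
      also have "\<dots> \<le> (\<Sum>q\<in>P. \<Sum>i<L. if lev k p q = i \<and> l - k < 2 * i + 2 then om i / V (k + i) * m q else 0)"
        using finP by (intro sum_mono2) (auto intro!: sum_nonneg mult_nonneg_nonneg divide_nonneg_nonneg
            less_imp_le[OF m_pos] less_imp_le[OF V_pos] om_nonneg)
      also have "\<dots> = (\<Sum>i<L. \<Sum>q\<in>P. if lev k p q = i \<and> l - k < 2 * i + 2 then om i / V (k + i) * m q else 0)"
        by (rule sum.swap)
      also have "\<dots> = (\<Sum>i<L. if l - k < 2 * i + 2 then om i / V (k + i) * (\<Sum>q | q \<in> P \<and> lev k p q = i. m q) else 0)"
        by (intro sum.cong) (auto simp: sum.inter_filter[OF finP] sum_distrib_left intro!: sum.cong)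
      also have "\<dots> \<le> Om"
        unfolding Om_def
      proof (rule sum_mono)
        fix i
        have "om i / V (k + i) * (\<Sum>q | q \<in> P \<and> lev k p q = i. m q) \<le> om i / V (k + i) * V (k + i)"
          using om_nonneg V_pos lev_mass1[OF p] by (intro mult_left_mono) (auto simp: less_imp_le)
        then show "(if l - k < 2 * i + 2 then om i / V (k + i) * (\<Sum>q | q \<in> P \<and> lev k p q = i. m q) else 0)
          \<le> (if l - k < 2 * i + 2 then om i else 0)" using V_pos[of "k + i"] by simp
      qed
      finally show ?thesis using m_pos[OF p] by (intro mult_left_mono) auto
    qed simp
  qed
  also have "\<dots> = Om * (\<Sum>p\<in>P. \<bar>th p\<bar> * m p)"
    by (simp add: sum_distrib_left mult_ac)
  also have "(\<Sum>p\<in>P. \<bar>th p\<bar> * m p) \<le> (\<Sum>p\<in>cell l z. (2 * \<bar>w k p * D k t p\<bar> * sqrt (m p)) * sqrt (m p))"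
    unfolding sum_cell
  proof (rule sum_mono)
    fix p assume p: "p \<in> P"
    have "\<bar>(w k p)\<^sup>2 * D k t p\<bar> \<le> 2 * \<bar>w k p * D k t p\<bar>"
      using abs_w_mult_le[of k p "w k p * D k t p"] by (simp add: power2_eq_square mult.assoc)
    then have "\<bar>(w k p)\<^sup>2 * D k t p\<bar> * m p \<le> 2 * \<bar>w k p * D k t p\<bar> * m p"
      using m_pos[OF p] by (intro mult_right_mono) auto
    also have "\<dots> = 2 * \<bar>w k p * D k t p\<bar> * sqrt (m p) * sqrt (m p)"
      using m_pos[OF p] by simp
    finally show "\<bar>th p\<bar> * m p
      \<le> (if c l p = c l z then 2 * \<bar>w k p * D k t p\<bar> * sqrt (m p) * sqrt (m p) else 0)"
      by (simp add: th_def v_def)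
  qed
  also have "\<dots> \<le> sqrt (\<Sum>p\<in>cell l z. (2 * \<bar>w k p * D k t p\<bar> * sqrt (m p))\<^sup>2) * sqrt (\<Sum>p\<in>cell l z. (sqrt (m p))\<^sup>2)"
    by (rule sum_mult_le_sqrt)
  also have "(\<Sum>p\<in>cell l z. (sqrt (m p))\<^sup>2) = mass l z"
    unfolding mass_def using m_pos by (intro sum.cong) (auto simp: cell_def less_imp_le)
  also have "(\<Sum>p\<in>cell l z. (2 * \<bar>w k p * D k t p\<bar> * sqrt (m p))\<^sup>2) = 4 * X"
    unfolding X_def sum_distrib_left using m_pos
    by (intro sum.cong) (auto simp: cell_def less_imp_le power_mult_distrib)
  finally have X1: "X \<le> Om * (sqrt (4 * X) * sqrt (mass l z))"
    using Om_nonneg by (simp add: mult_left_mono)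
  have "X \<le> 4 * Om\<^sup>2 * mass l z"
  proof (cases "X = 0")
    case True then show ?thesis using mass_pos[OF R, of l] by simp
  next
    case False
    then have "0 < X" using X_nonneg by simp
    have "sqrt X * sqrt X \<le> (2 * Om * sqrt (mass l z)) * sqrt X"
      using X1 X_nonneg by (simp add: real_sqrt_mult mult_ac)
    then have "sqrt X \<le> 2 * Om * sqrt (mass l z)"
      by (rule mult_right_le_imp_le) (use \<open>0 < X\<close> in simp)
    then have "(sqrt X)\<^sup>2 \<le> (2 * Om * sqrt (mass l z))\<^sup>2"
      using X_nonneg by (intro power_mono) auto
    then show ?thesis using X_nonneg mass_pos[OF R, of l]
      by (simp add: power_mult_distrib)
  qed
  then show ?thesis by (simp add: X_def Om_def)
qed

text \<open>Each 8 is a factor 2 from splitting the symbol and a factor 4 from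
  \<open>w \<le> 2\<close>; the added 1 makes the constant positive, so that the embedding can be
  normalised by it.\<close>

definition carleson_const :: real where
  "carleson_const = 8 * B\<^sup>2 + 8 * S\<^sup>2 + 1"

text \<open>Split the symbol into the contributions of the cell of \<open>z\<close> and of its
  complement. The first is bounded by testing and orthogonality of the differences; for the second,
  the bounds of \<open>outside_part\<close> are square-summable in \<open>l - k\<close>. Only
  \<open>k + r \<le> l\<close> occurs, since the difference at level \<open>k\<close> is paired with
  an average at level \<open>k + r\<close>.\<close>

lemma tau_carleson:
  assumes z: "z \<in> P"
  shows "(\<Sum>k | k \<in> {1..N} \<and> k + r \<le> l. \<Sum>p\<in>cell l z. (w k p * D k tau p)\<^sup>2 * m p)
    \<le> carleson_const * mass l z"
proof -
  define t0 where "t0 = (\<lambda>p. \<Sum>q\<in>cell l z. a p q * m q)"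
  define t1 where "t1 = (\<lambda>p. \<Sum>q\<in>P - cell l z. a p q * m q)"
  let ?K = "{k. k \<in> {1..N} \<and> k + r \<le> l}"
  have "tau p = t0 p + t1 p" for p
    unfolding tau_def t0_def t1_def using sum.subset_diff[OF cell_subset finP] by (simp add: add.commute)
  then have "tau = (\<lambda>p. t0 p + t1 p)" by auto
  then have D: "D k tau p = D k t0 p + D k t1 p" for k p
    by (simp add: D_def E_add)
  have "(\<Sum>k\<in>?K. \<Sum>p\<in>cell l z. (w k p * D k tau p)\<^sup>2 * m p)
    \<le> (\<Sum>k\<in>?K. \<Sum>p\<in>cell l z. 8 * ((D k t0 p)\<^sup>2 * m p) + 2 * ((w k p * D k t1 p)\<^sup>2 * m p))"
  proof (intro sum_mono)
    fix k p assume "p \<in> cell l z"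
    then have mp: "0 \<le> m p" using m_pos[of p] by (simp add: cell_def)
    have "(w k p * D k tau p)\<^sup>2 \<le> 2 * (w k p * D k t0 p)\<^sup>2 + 2 * (w k p * D k t1 p)\<^sup>2"
      using sum_squares_bound[of "w k p * D k t0 p" "w k p * D k t1 p"]
      by (simp add: D distrib_left power2_sum)
    also have "\<dots> \<le> 2 * (4 * (D k t0 p)\<^sup>2) + 2 * (w k p * D k t1 p)\<^sup>2"
      using square_w_mult_le by (intro add_right_mono mult_left_mono) auto
    finally have "(w k p * D k tau p)\<^sup>2 * m p \<le> (2 * (4 * (D k t0 p)\<^sup>2) + 2 * (w k p * D k t1 p)\<^sup>2) * m p"
      using mp by (rule mult_right_mono)
    then show "(w k p * D k tau p)\<^sup>2 * m p \<le> 8 * ((D k t0 p)\<^sup>2 * m p) + 2 * ((w k p * D k t1 p)\<^sup>2 * m p)"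
      by (simp add: algebra_simps)
  qed
  also have "\<dots> = 8 * (\<Sum>k\<in>?K. \<Sum>p\<in>cell l z. (D k t0 p)\<^sup>2 * m p)
      + 2 * (\<Sum>k\<in>?K. \<Sum>p\<in>cell l z. (w k p * D k t1 p)\<^sup>2 * m p)"
    by (simp add: sum.distrib sum_distrib_left)
  also have "(\<Sum>k\<in>?K. \<Sum>p\<in>cell l z. (D k t0 p)\<^sup>2 * m p) \<le> (\<Sum>k=1..N. (nrm (D k t0))\<^sup>2)"
  proof -
    have "(\<Sum>k\<in>?K. \<Sum>p\<in>cell l z. (D k t0 p)\<^sup>2 * m p) \<le> (\<Sum>k\<in>?K. (nrm (D k t0))\<^sup>2)"
      unfolding nrm_square_sum using m_pos finP cell_subset
      by (intro sum_mono sum_mono2 mult_nonneg_nonneg) (auto intro: less_imp_le)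
    also have "\<dots> \<le> (\<Sum>k=1..N. (nrm (D k t0))\<^sup>2)" by (intro sum_mono2) auto
    finally show ?thesis .
  qed
  also have "\<dots> \<le> (nrm t0)\<^sup>2" by (rule sum_nrm_D)
  also have "\<dots> \<le> B\<^sup>2 * mass l z"
    unfolding nrm_square_sum t0_def by (rule testing[OF z])
  also have "(\<Sum>k\<in>?K. \<Sum>p\<in>cell l z. (w k p * D k t1 p)\<^sup>2 * m p)
      \<le> (\<Sum>k\<in>?K. 4 * (\<Sum>i<L. if l - k < 2 * i + 2 then om i else 0)\<^sup>2 * mass l z)"
    unfolding t1_def using outside_part[OF _ _ z] by (intro sum_mono) auto
  also have "\<dots> = 4 * mass l z * (\<Sum>k\<in>?K. (\<Sum>i<L. if l - k < 2 * i + 2 then om i else 0)\<^sup>2)"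
    by (simp add: sum_distrib_left mult_ac)
  also have "(\<Sum>k\<in>?K. (\<Sum>i<L. if l - k < 2 * i + 2 then om i else 0)\<^sup>2)
      = (\<Sum>j\<in>(\<lambda>k. l - k) ` ?K. (\<Sum>i<L. if j < 2 * i + 2 then om i else 0)\<^sup>2)"
    by (subst sum.reindex) (auto simp: inj_on_def)
  also have "\<dots> \<le> (\<Sum>j<Suc l. (\<Sum>i<L. if j < 2 * i + 2 then om i else 0)\<^sup>2)"
    by (intro sum_mono2) auto
  also have "\<dots> \<le> (\<Sum>i<L. om i * sqrt (real (2 * i + 2)))\<^sup>2"
    by (rule sum_square_tails_le[OF om_nonneg])
  also have "\<dots> \<le> S\<^sup>2"
    using om_sum' om_nonneg by (intro power_mono sum_nonneg) (auto simp: add.commute)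
  finally have "(\<Sum>k\<in>?K. \<Sum>p\<in>cell l z. (w k p * D k tau p)\<^sup>2 * m p)
      \<le> 8 * (B\<^sup>2 * mass l z) + 2 * (4 * mass l z * S\<^sup>2)"
    using mass_pos[OF z, of l] by (simp add: mult_left_mono)
  also have "\<dots> \<le> carleson_const * mass l z"
    using mass_pos[OF z, of l] by (simp add: carleson_const_def algebra_simps)
  finally show ?thesis .
qed

text \<open>The symbol \<open>tau\<close> is the transpose of the form applied to the constant one.
  Since \<open>w k p * E (k + r) g p\<close> has level \<open>k\<close>, the projection
  \<open>D k\<close> can be moved from \<open>f\<close> onto \<open>tau\<close>, and the Carleson
  embedding applies with the squares of \<open>w * D tau\<close> as densities.\<close>

lemma para_part:
  "(\<Sum>k=1..N. \<bar>\<Sum>p\<in>P. \<Sum>q\<in>P. a p q * m p * m q * h k f p * E (k + r) g p\<bar>)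
    \<le> 2 * sqrt carleson_const * (nrm f * nrm g)"
proof -
  define y where "y k p = w k p * E (k + r) g p * D k tau p" for k p
  have A: "0 < carleson_const" by (simp add: carleson_const_def add_nonneg_pos)
  have "\<bar>\<Sum>p\<in>P. \<Sum>q\<in>P. a p q * m p * m q * h k f p * E (k + r) g p\<bar> \<le> nrm (D k f) * nrm (y k)" for k
  proof -
    have lv: "level k (\<lambda>p. w k p * E (k + r) g p)"
      by (intro level_mult level_w level_mono[OF level_E]) simp
    have "(\<Sum>p\<in>P. \<Sum>q\<in>P. a p q * m p * m q * h k f p * E (k + r) g p)
        = ip (\<lambda>p. w k p * E (k + r) g p * D k f p) tau"
      unfolding ip_def tau_def h_def sum_distrib_left sum_distrib_right
      by (intro sum.cong) auto
    also have "\<dots> = ip (\<lambda>p. w k p * E (k + r) g p * D k f p) (D k tau)"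
      by (rule ip_level_D[OF lv])
    also have "\<dots> = ip (D k f) (y k)" by (simp add: ip_def y_def mult_ac)
    finally show ?thesis using abs_ip_le by simp
  qed
  then have "(\<Sum>k=1..N. \<bar>\<Sum>p\<in>P. \<Sum>q\<in>P. a p q * m p * m q * h k f p * E (k + r) g p\<bar>)
      \<le> (\<Sum>k=1..N. nrm (D k f) * nrm (y k))" by (intro sum_mono)
  also have "\<dots> \<le> sqrt (\<Sum>k=1..N. (nrm (D k f))\<^sup>2) * sqrt (\<Sum>k=1..N. (nrm (y k))\<^sup>2)"
    by (rule sum_mult_le_sqrt)
  also have "\<dots> \<le> nrm f * sqrt (4 * carleson_const * (nrm g)\<^sup>2)"
  proof (intro mult_mono real_sqrt_le_mono)
    show "sqrt (\<Sum>k=1..N. (nrm (D k f))\<^sup>2) \<le> nrm f"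
      using real_sqrt_le_mono[OF sum_nrm_D[where N = N and f = f]] by simp
    show "(\<Sum>k=1..N. (nrm (y k))\<^sup>2) \<le> 4 * carleson_const * (nrm g)\<^sup>2"
    proof -
      \<comment> \<open>Densities are indexed by the level of the average they multiply, so the
        coefficient of level \<open>k\<close> sits at \<open>k + r\<close>.\<close>
      define \<alpha> where "\<alpha> l p = (if r < l \<and> l \<le> N + r then (w (l - r) p * D (l - r) tau p)\<^sup>2 else 0)" for l p
      have "(\<Sum>k=1..N. (nrm (y k))\<^sup>2) = (\<Sum>k=1..N. ip (\<alpha> (k + r)) (\<lambda>p. (E (k + r) g p)\<^sup>2))"
        by (intro sum.cong) (auto simp: nrm_square_sum y_def \<alpha>_def ip_def power_mult_distrib mult_ac)
      also have "\<dots> = (\<Sum>l\<in>(\<lambda>k. k + r) ` {1..N}. ip (\<alpha> l) (\<lambda>p. (E l g p)\<^sup>2))"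
        by (subst sum.reindex) auto
      also have "\<dots> \<le> (\<Sum>l<Suc (N + r). ip (\<alpha> l) (\<lambda>p. (E l g p)\<^sup>2))"
        unfolding ip_def using m_pos
        by (intro sum_mono2) (auto simp: \<alpha>_def intro!: sum_nonneg mult_nonneg_nonneg intro: less_imp_le)
      also have "\<dots> \<le> 4 * carleson_const * (nrm g)\<^sup>2"
      proof (rule carleson_embedding[OF _ A])
        fix l z assume z: "z \<in> P"
        let ?K = "{k. k \<in> {1..N} \<and> k + r \<le> l}"
        have "(\<Sum>j\<le>l. \<Sum>q\<in>cell l z. \<alpha> j q * m q) = (\<Sum>j\<in>(\<lambda>k. k + r) ` ?K. \<Sum>q\<in>cell l z. \<alpha> j q * m q)"
        proof (rule sum.mono_neutral_right)
          show "\<forall>j\<in>{..l} - (\<lambda>k. k + r) ` ?K. (\<Sum>q\<in>cell l z. \<alpha> j q * m q) = 0"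
          proof
            fix j assume j: "j \<in> {..l} - (\<lambda>k. k + r) ` ?K"
            have "\<not> (r < j \<and> j \<le> N + r)"
            proof
              assume "r < j \<and> j \<le> N + r"
              then have "j = (j - r) + r" "j - r \<in> ?K" using j by auto
              then show False using j by blast
            qed
            then have "\<alpha> j q = 0" for q unfolding \<alpha>_def by (simp only: if_False)
            then show "(\<Sum>q\<in>cell l z. \<alpha> j q * m q) = 0" by simp
          qed
        qed auto
        also have "\<dots> = (\<Sum>k\<in>?K. \<Sum>q\<in>cell l z. (w k q * D k tau q)\<^sup>2 * m q)"
          by (subst sum.reindex) (auto simp: \<alpha>_def)
        also have "\<dots> \<le> carleson_const * mass l z" by (rule tau_carleson[OF z])
        finally show "(\<Sum>j\<le>l. \<Sum>q\<in>cell l z. \<alpha> j q * m q) \<le> carleson_const * mass l z" .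
      qed (auto simp: \<alpha>_def)
      finally show ?thesis .
    qed
  qed (auto intro: sum_nonneg)
  finally show ?thesis by (simp add: real_sqrt_mult mult_ac)
qed

section \<open>The form on one grid assembled\<close>

definition half_form_const :: real where
  "half_form_const = 2 * B * sqrt Dn * sqrt (real (r + 1)) + 4 * S + 2 * sqrt carleson_const"

theorem half_form_le:
  assumes \<kappa>: "\<And>k. k - 1 \<le> \<kappa> k \<and> \<kappa> k \<le> k"
  shows "\<bar>\<Sum>k=1..N. \<Sum>p\<in>P. \<Sum>q\<in>P. a p q * m p * m q * (w k p * D k f p) * E (\<kappa> k) g q\<bar>
    \<le> half_form_const * (nrm f * nrm g)"
proof -
  let ?u = "\<lambda>k q. E (\<kappa> k) g q - E (k + r) g q"
  define Near where "Near k = (\<Sum>p\<in>P. \<Sum>q\<in>P. if c (k + r) q = c (k + r) p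
      then a p q * m p * m q * h k f p * ?u k q else 0)" for k
  define Far where "Far k = (\<Sum>p\<in>P. \<Sum>q\<in>P. if c (k + r) q \<noteq> c (k + r) p
      then a p q * m p * m q * h k f p * (E (\<kappa> k) g q - E (k + r) g p) else 0)" for k
  define Para where "Para k = (\<Sum>p\<in>P. \<Sum>q\<in>P. a p q * m p * m q * h k f p * E (k + r) g p)" for k
  have split: "(\<Sum>p\<in>P. \<Sum>q\<in>P. a p q * m p * m q * (w k p * D k f p) * E (\<kappa> k) g q)
      = Near k + Far k + Para k" for k
    unfolding Near_def Far_def Para_def sum.distrib[symmetric]
  proof (intro sum.cong refl)
    fix p q assume pq: "p \<in> P" "q \<in> P"
    \<comment> \<open>Inside a common cell it is immaterial at which of the two points the ancestor
      average is taken, so the near and the far region give off the same paraproduct.\<close>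
    have "E (k + r) g q = E (k + r) g p" if "c (k + r) q = c (k + r) p"
      using levelD[OF level_E] pq that by blast
    then show "a p q * m p * m q * (w k p * D k f p) * E (\<kappa> k) g q
      = (if c (k + r) q = c (k + r) p then a p q * m p * m q * h k f p * ?u k q else 0)
      + (if c (k + r) q \<noteq> c (k + r) p then a p q * m p * m q * h k f p * (E (\<kappa> k) g q - E (k + r) g p) else 0)
      + a p q * m p * m q * h k f p * E (k + r) g p"
      by (simp add: h_def algebra_simps)
  qed
  have near: "(\<Sum>k=1..N. \<bar>Near k\<bar>) \<le> 2 * B * sqrt Dn * sqrt (real (r + 1)) * (nrm f * nrm g)"
  proof -
    have "(\<Sum>k=1..N. \<bar>Near k\<bar>) \<le> (\<Sum>k=1..N. B * sqrt Dn * (nrm (h k f) * nrm (?u k)))"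
    proof (intro sum_mono)
      fix k assume "k \<in> {1..N}"
      moreover have "level (\<kappa> k) (?u k)"
        using \<kappa>[of k] by (intro level_diff level_E level_mono[OF level_E]) auto
      ultimately show "\<bar>Near k\<bar> \<le> B * sqrt Dn * (nrm (h k f) * nrm (?u k))"
        unfolding Near_def using \<kappa>[of k] by (intro near_part) auto
    qed
    also have "\<dots> = B * sqrt Dn * (\<Sum>k=1..N. nrm (h k f) * nrm (?u k))"
      by (simp add: sum_distrib_left)
    also have "\<dots> \<le> B * sqrt Dn * (2 * sqrt (real (r + 1)) * (nrm f * nrm g))"
      using B_nonneg Dn_nonneg
      by (intro mult_left_mono sum_nrm_h_mult_le sum_nrm_E_diff \<kappa>) auto
    finally show ?thesis by (simp add: mult_ac)
  qed
  have far: "(\<Sum>k=1..N. \<bar>Far k\<bar>) \<le> 4 * S * (nrm f * nrm g)"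
  proof -
    have "(\<Sum>k=1..N. \<bar>Far k\<bar>) \<le> (\<Sum>k=1..N. \<Sum>i<L. 2 * om i *
        (nrm (h k f) * nrm (\<lambda>p. E (k - 1) g p - E (k + (2 * i + 2)) g p)))"
      unfolding Far_def using \<kappa> by (intro sum_mono far_part) auto
    also have "\<dots> \<le> 4 * S * (nrm f * nrm g)" by (rule sum_far_part)
    finally show ?thesis .
  qed
  have para: "(\<Sum>k=1..N. \<bar>Para k\<bar>) \<le> 2 * sqrt carleson_const * (nrm f * nrm g)"
    unfolding Para_def by (rule para_part)
  have "\<bar>\<Sum>k=1..N. Near k + Far k + Para k\<bar> \<le> (\<Sum>k=1..N. \<bar>Near k\<bar> + \<bar>Far k\<bar> + \<bar>Para k\<bar>)"
    by (rule order_trans[OF sum_abs], rule sum_mono) linarith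
  also have "\<dots> \<le> half_form_const * (nrm f * nrm g)"
    using near far para by (simp add: sum.distrib half_form_const_def distrib_right)
  finally show ?thesis by (simp only: split)
qed

text \<open>With a single cell at level \<open>N\<close>, the average of \<open>g\<close> is a
  constant and factors out, leaving \<open>E N f\<close> paired with the test function
  \<open>tau\<close> of the whole set.\<close>

lemma top_part:
  assumes top: "\<And>p q. p \<in> P \<Longrightarrow> q \<in> P \<Longrightarrow> c N p = c N q"
  shows "\<bar>\<Sum>p\<in>P. \<Sum>q\<in>P. a p q * m p * m q * E N f p * E N g q\<bar> \<le> B * (nrm f * nrm g)"
proof (cases "P = {}")
  case True
  have "0 \<le> B * (nrm f * nrm g)" using B_nonneg by simp
  then show ?thesis using True by (simp only: sum.empty abs_zero)
next
  case False
  then obtain z where z: "z \<in> P" by blast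
  have E: "E N g q = E N g z" if "q \<in> P" for q
    using levelD[OF level_E that z] top that z by blast
  have cell: "cell N z = P" unfolding cell_def using top z by blast
  have mz: "0 < mass N z" by (rule mass_pos[OF z])
  have "(\<Sum>p\<in>P. \<Sum>q\<in>P. a p q * m p * m q * E N f p * E N g q) = ip (E N f) tau * E N g z"
    unfolding ip_def tau_def sum_distrib_left sum_distrib_right
    by (intro sum.cong) (auto simp: E)
  then have "\<bar>\<Sum>p\<in>P. \<Sum>q\<in>P. a p q * m p * m q * E N f p * E N g q\<bar> = \<bar>ip (E N f) tau\<bar> * \<bar>E N g z\<bar>"
    by (simp add: abs_mult)
  also have "\<dots> \<le> (nrm f * (B * sqrt (mass N z))) * \<bar>E N g z\<bar>"
  proof (intro mult_right_mono)
    have "(nrm tau)\<^sup>2 \<le> B\<^sup>2 * mass N z"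
      using testing[OF z, of N] unfolding nrm_square_sum tau_def cell .
    also have "\<dots> = (B * sqrt (mass N z))\<^sup>2" using mz by (simp add: power_mult_distrib)
    finally have "nrm tau \<le> B * sqrt (mass N z)"
      by (rule power2_le_imp_le) (use B_nonneg mz in auto)
    then have "nrm (E N f) * nrm tau \<le> nrm f * (B * sqrt (mass N z))"
      using nrm_E_le by (intro mult_mono) auto
    then show "\<bar>ip (E N f) tau\<bar> \<le> nrm f * (B * sqrt (mass N z))"
      using abs_ip_le[of "E N f" tau] by linarith
  qed simp
  also have "\<dots> = B * nrm f * nrm (E N g)"
  proof -
    have "(nrm (E N g))\<^sup>2 = (E N g z)\<^sup>2 * mass N z"
      unfolding nrm_square_sum mass_def cell sum_distrib_left using E by (intro sum.cong) auto
    also have "\<dots> = (\<bar>E N g z\<bar> * sqrt (mass N z))\<^sup>2" using mz by (simp add: power_mult_distrib)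
    finally have "nrm (E N g) = \<bar>E N g z\<bar> * sqrt (mass N z)"
      using mz by (subst (asm) power2_eq_iff_nonneg) auto
    then show ?thesis by (simp add: mult_ac)
  qed
  also have "\<dots> \<le> B * nrm f * nrm g"
    using B_nonneg nrm_E_le by (intro mult_left_mono) auto
  finally show ?thesis by (simp add: mult_ac)
qed

end

section \<open>Averaging over shifted lattices\<close>

text \<open>A shift is determined by the residue it produces together with its block of length
  \<open>2 ^ j\<close>; equidistribution of the shifts is this injection.\<close>

lemma card_shifted_residues_le:
  fixes v :: int
  assumes "A \<subseteq> {0..<2 ^ j}" "j \<le> n"
  shows "card {x::nat. x < 2 ^ n \<and> (v + int x) mod 2 ^ j \<in> A} \<le> card A * 2 ^ (n - j)"
proof -
  let ?X = "{x::nat. x < 2 ^ n \<and> (v + int x) mod 2 ^ j \<in> A}"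
  let ?h = "\<lambda>x::nat. ((v + int x) mod 2 ^ j, x div 2 ^ j)"
  have "finite A" using assms(1) finite_subset by blast
  have inj: "inj_on ?h ?X"
  proof (rule inj_onI)
    fix x y :: nat assume "?h x = ?h y"
    then have d: "x div 2 ^ j = y div 2 ^ j" and e: "(v + int x) mod 2 ^ j = (v + int y) mod 2 ^ j" by auto
    have "((v + int x) - v) mod 2 ^ j = ((v + int y) - v) mod 2 ^ j"
      using e by (metis mod_diff_left_eq)
    then have "int x mod 2 ^ j = int y mod 2 ^ j" by simp
    then have "int (x mod 2 ^ j) = int (y mod 2 ^ j)" by (simp add: zmod_int)
    then show "x = y" using d by (metis div_mult_mod_eq of_nat_eq_iff)
  qed
  have "?h ` ?X \<subseteq> A \<times> {..<2 ^ (n - j)}"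
  proof clarsimp
    fix x :: nat assume "x < 2 ^ n"
    then have "x < 2 ^ (n - j) * 2 ^ j" using assms(2) by (simp add: power_add[symmetric])
    then show "x div 2 ^ j < 2 ^ (n - j)" by (rule less_mult_imp_div_less)
  qed
  then have "card ?X \<le> card (A \<times> {..<2 ^ (n - j) :: nat})"
    using card_inj_on_le[OF inj] \<open>finite A\<close> by blast
  then show ?thesis by (simp add: card_cartesian_product)
qed

text \<open>Measured in cells of side \<open>2 ^ k\<close>, the point \<open>x\<close> is at least
  \<open>2 ^ j\<close> cells away from both ends of its ancestor. A displacement below
  \<open>2 ^ (k + j)\<close> changes the cell index by at most \<open>2 ^ j\<close>, so it cannot
  leave the ancestor.\<close>

lemma div_power_eq_of_central:
  fixes x y :: int
  assumes "\<bar>x - y\<bar> < 2 ^ (k + j)"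
    and "2 ^ j \<le> (x div 2 ^ k) mod 2 ^ (2 * j)" "(x div 2 ^ k) mod 2 ^ (2 * j) < 2 ^ (2 * j) - 2 ^ j"
  shows "y div 2 ^ (k + 2 * j) = x div 2 ^ (k + 2 * j)"
proof -
  let ?X = "x div 2 ^ k" and ?Y = "y div 2 ^ k"
  have "?Y \<le> (x + 2 ^ j * 2 ^ k) div 2 ^ k"
    using assms(1) by (intro zdiv_mono1) (auto simp: power_add mult.commute)
  then have Y1: "?Y \<le> ?X + 2 ^ j" by simp
  have "(x + (- (2 ^ j)) * 2 ^ k) div 2 ^ k \<le> ?Y"
    using assms(1) by (intro zdiv_mono1) (auto simp: power_add mult.commute)
  also have "(x + (- (2 ^ j)) * 2 ^ k) div 2 ^ k = - (2 ^ j) + ?X"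
    by (rule div_mult_self1) simp
  finally have Y2: "?X - 2 ^ j \<le> ?Y" by simp
  let ?u = "?X div 2 ^ (2 * j)"
  have X: "?X = 2 ^ (2 * j) * ?u + ?X mod 2 ^ (2 * j)" by simp
  have "?Y div 2 ^ (2 * j) = ?u"
    by (rule int_div_pos_eq[where r = "?Y - 2 ^ (2 * j) * ?u"]) (use X Y1 Y2 assms(2,3) in linarith)+
  then show ?thesis by (simp add: power_add zdiv_zmult2_eq)
qed

text \<open>The low binary digits of a shift determine the partitions up to level \<open>k\<close>;
  the high digits only move these cells inside their ancestors. Separating them makes the
  conditional averaging of \<open>w\<close> possible.\<close>

lemma sum_residues:
  fixes \<phi> :: "nat \<Rightarrow> real"
  shows "(\<Sum>s<2 ^ (k + n). \<phi> s) = (\<Sum>t<2 ^ k. \<Sum>x<2 ^ n. \<phi> (t + 2 ^ k * x))"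
proof -
  have "(\<Sum>s<2 ^ (k + n). \<phi> s) = (\<Sum>(t, x)\<in>{..<2 ^ k} \<times> {..<2 ^ n}. \<phi> (t + 2 ^ k * x))"
  proof (rule sum.reindex_bij_witness[of _ "\<lambda>(t, x). t + 2 ^ k * x" "\<lambda>s. (s mod 2 ^ k, s div 2 ^ k)"])
    fix s :: nat assume "s \<in> {..<2 ^ (k + n)}"
    then have "s < 2 ^ n * 2 ^ k" by (simp add: power_add mult.commute)
    then show "(s mod 2 ^ k, s div 2 ^ k) \<in> {..<2 ^ k} \<times> {..<2 ^ n}"
      by (simp add: less_mult_imp_div_less)
  next
    fix y :: "nat \<times> nat" assume "y \<in> {..<2 ^ k} \<times> {..<2 ^ n}"
    then obtain t x where y: "y = (t, x)" "t < 2 ^ k" "x < 2 ^ n" by auto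
    have "t + 2 ^ k * x < 2 ^ k * Suc x" using y(2) by simp
    also have "\<dots> \<le> 2 ^ k * 2 ^ n" using y(3) by (intro mult_left_mono) auto
    finally show "(case y of (t, x) \<Rightarrow> t + 2 ^ k * x) \<in> {..<2 ^ (k + n)}"
      by (simp add: y(1) power_add)
  qed auto
  then show ?thesis by (simp add: sum.cartesian_product)
qed

lemma sum_half_powers_le: "(\<Sum>i=j..n. (1 / 2 :: real) ^ i) \<le> 2 * (1 / 2) ^ j"
proof (cases "j \<le> n")
  case True
  then have "(\<Sum>i=j..n. (1 / 2 :: real) ^ i) = 2 * (1 / 2) ^ j - (1 / 2) ^ n"
    by (induction n rule: dec_induct) (simp_all add: sum.atLeast_Suc_atMost)
  then show ?thesis by simp
qed simp

text \<open>A multiple of \<open>2 ^ k\<close> in the shift translates all labels of level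
  \<open>j\<close> by the same amount, and hence leaves the partition unchanged.\<close>

lemma shift_div_power:
  fixes y :: int
  assumes "j \<le> k"
  shows "(y + int s) div 2 ^ j = (y + int (s mod 2 ^ k)) div 2 ^ j + 2 ^ (k - j) * int (s div 2 ^ k)"
proof -
  have "int s = int (s mod 2 ^ k + 2 ^ k * (s div 2 ^ k))" by simp
  also have "\<dots> = int (s mod 2 ^ k) + 2 ^ k * int (s div 2 ^ k)" by (simp only: of_nat_add of_nat_mult of_nat_power of_nat_numeral)
  also have "(2 :: int) ^ k = 2 ^ (k - j) * 2 ^ j" using assms by (simp add: power_add[symmetric])
  finally have "y + int s = y + int (s mod 2 ^ k) + (2 ^ (k - j) * int (s div 2 ^ k)) * 2 ^ j"
    by (simp add: mult_ac)
  moreover have "(2 :: int) ^ j \<noteq> 0" by simp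
  ultimately show ?thesis by (metis div_mult_self1 add.commute)
qed

lemma int_div_eq_0_iff:
  fixes x n :: int
  assumes "0 < n" shows "x div n = 0 \<longleftrightarrow> 0 \<le> x \<and> x < n"
  using assms by (auto simp: zdiv_eq_0_iff)

section \<open>The lattice model\<close>

definition lattice_cube :: "'p set \<Rightarrow> ('p \<Rightarrow> 'b \<Rightarrow> int) \<Rightarrow> 'b set \<Rightarrow> ('b \<Rightarrow> int) \<Rightarrow> nat \<Rightarrow> 'p set" where
  "lattice_cube W z Bs u k = {q \<in> W. \<forall>b\<in>Bs. u b \<le> z q b \<and> z q b < u b + 2 ^ k}"

text \<open>Functions will be supported in the cube with coordinates in \<open>[0, 2 ^ M)\<close>.
  The larger window \<open>[- (2 ^ M), 2 ^ (M + 1))\<close> accommodates every top cube of side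
  \<open>2 ^ (M + 1)\<close> shifted by less than \<open>2 ^ M\<close>, and testing is asked only
  for cubes inside it. Smoothness in both variables at once and testing in both orders make the
  hypotheses invariant under transposition. The bound on \<open>i0\<close> ensures that at least
  half of the shifts are good.\<close>

locale lattice_kernel =
  fixes W :: "'p set" and m :: "'p \<Rightarrow> real" and z :: "'p \<Rightarrow> 'b \<Rightarrow> int" and Bs :: "'b set"
    and a :: "'p \<Rightarrow> 'p \<Rightarrow> real" and M i0 :: nat and V om :: "nat \<Rightarrow> real" and B S :: real
  assumes finW: "finite W"
    and m_pos: "p \<in> W \<Longrightarrow> 0 < m p"
    and finBs: "finite Bs"
    and i0: "1 \<le> i0" "8 * card Bs \<le> 2 ^ i0"
    and z_inj: "p \<in> W \<Longrightarrow> q \<in> W \<Longrightarrow> (\<And>b. b \<in> Bs \<Longrightarrow> z p b = z q b) \<Longrightarrow> p = q"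
    and window: "p \<in> W \<Longrightarrow> b \<in> Bs \<Longrightarrow> - (2 ^ M) \<le> z p b \<and> z p b < 2 ^ (M + 1)"
    and B_nonneg: "0 \<le> B"
    and cube_testing: "(\<And>b. b \<in> Bs \<Longrightarrow> - (2 ^ M) \<le> u b \<and> u b + 2 ^ k \<le> 2 ^ (M + 1)) \<Longrightarrow>
      (\<Sum>x\<in>W. (\<Sum>q\<in>lattice_cube W z Bs u k. a x q * m q)\<^sup>2 * m x) \<le> B\<^sup>2 * sum m (lattice_cube W z Bs u k)"
    and cube_testing': "(\<And>b. b \<in> Bs \<Longrightarrow> - (2 ^ M) \<le> u b \<and> u b + 2 ^ k \<le> 2 ^ (M + 1)) \<Longrightarrow>
      (\<Sum>x\<in>W. (\<Sum>q\<in>lattice_cube W z Bs u k. a q x * m q)\<^sup>2 * m x) \<le> B\<^sup>2 * sum m (lattice_cube W z Bs u k)"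
    and V_pos: "0 < V j"
    and ball_mass: "p \<in> W \<Longrightarrow> (\<Sum>q | q \<in> W \<and> (\<forall>b\<in>Bs. \<bar>z p b - z q b\<bar> < 2 ^ (j + 1)). m q) \<le> V j"
    and kernel_smooth: "p \<in> W \<Longrightarrow> p' \<in> W \<Longrightarrow> q \<in> W \<Longrightarrow> q' \<in> W \<Longrightarrow> i0 \<le> i
      \<Longrightarrow> (\<And>b. b \<in> Bs \<Longrightarrow> \<bar>z p b - z p' b\<bar> < 2 ^ k) \<Longrightarrow> (\<And>b. b \<in> Bs \<Longrightarrow> \<bar>z q b - z q' b\<bar> < 2 ^ k)
      \<Longrightarrow> (\<exists>b\<in>Bs. 2 ^ (k + i) \<le> \<bar>z p b - z q b\<bar>)
      \<Longrightarrow> \<bar>a p q - a p' q'\<bar> \<le> om i / V (k + i)"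
    and om_nonneg: "0 \<le> om i"
    and om_sum: "(\<Sum>i<L. om i * sqrt (2 * i + 3)) \<le> S"
begin

text \<open>One shift \<open>s\<close> moves all coordinates simultaneously. The goodness of a cell is then not
  independent of its position, which the weight \<open>w\<close> below compensates for.\<close>

definition c :: "nat \<Rightarrow> nat \<Rightarrow> 'p \<Rightarrow> 'b \<Rightarrow> int" where
  "c s k p = restrict (\<lambda>b. (z p b + int s) div 2 ^ k) Bs"

text \<open>The cell of level \<open>M + 1\<close> whose label is zero. For every shift below
  \<open>2 ^ M\<close> it contains all points with coordinates in \<open>[0, 2 ^ M)\<close>.\<close>

definition P :: "nat \<Rightarrow> 'p set" where
  "P s = {p \<in> W. \<forall>b\<in>Bs. 0 \<le> z p b + int s \<and> z p b + int s < 2 ^ (M + 1)}"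

text \<open>For a good cell, anything within distance \<open>2 ^ i\<close> (in units of its side length, \<open>i \<ge> i0\<close>) lies in
  its ancestor of relative size \<open>2 ^ (2 * i)\<close>.\<close>

definition good :: "nat \<Rightarrow> nat \<Rightarrow> 'p \<Rightarrow> bool" where
  "good s k p \<longleftrightarrow> (\<forall>i\<ge>i0. k + 2 * i \<le> M \<longrightarrow> (\<forall>b\<in>Bs.
     2 ^ i \<le> ((z p b + int s) div 2 ^ k) mod 2 ^ (2 * i) \<and>
     ((z p b + int s) div 2 ^ k) mod 2 ^ (2 * i) < 2 ^ (2 * i) - 2 ^ i))"

definition good_density :: "nat \<Rightarrow> nat \<Rightarrow> 'p \<Rightarrow> real" where
  "good_density s k p = card {x. x < 2 ^ (M - k) \<and> good (s mod 2 ^ k + 2 ^ k * x) k p} / 2 ^ (M - k)"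

text \<open>Cells of level \<open>k\<close> depend on \<open>s mod 2 ^ k\<close> only. Dividing by the density of good shifts in a
  residue class makes the weight have mean one on each class, so inserting it does not change
  averages over \<open>s\<close>.\<close>

definition w :: "nat \<Rightarrow> nat \<Rightarrow> 'p \<Rightarrow> real" where
  "w s k p = (if k \<le> M then of_bool (good s k p) / good_density s k p else 1)"

text \<open>Dyadic size of the maximal coordinate difference in units of \<open>2 ^ k\<close>. The
  value 0 collects all pairs nearer than two units.\<close>

definition lev :: "nat \<Rightarrow> 'p \<Rightarrow> 'p \<Rightarrow> nat" where
  "lev k p q = (LEAST i. \<forall>b\<in>Bs. \<bar>z p b - z q b\<bar> < 2 ^ (k + i + 1))"

lemma c_eq_iff: "c s k p = c s k q \<longleftrightarrow> (\<forall>b\<in>Bs. (z p b + int s) div 2 ^ k = (z q b + int s) div 2 ^ k)"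
  unfolding c_def by (auto simp: fun_eq_iff restrict_def)

lemma c_Suc: "c s k p = c s k q \<Longrightarrow> c s (Suc k) p = c s (Suc k) q"
  unfolding c_eq_iff using zdiv_zmult2_eq[of "2 ^ k" _ 2] by (simp add: power_Suc2 zdiv_zmult2_eq del: power_Suc)

lemma c_mono: "c s k p = c s k q \<Longrightarrow> k \<le> l \<Longrightarrow> c s l p = c s l q"
  by (rotate_tac, induction l rule: dec_induct) (auto intro: c_Suc)

lemma filtration_subset:
  assumes "A \<subseteq> W" shows "filtration A m (c s)"
proof
  show "finite A" by (rule finite_subset[OF assms finW])
  show "0 < m p" if "p \<in> A" for p using m_pos assms that by blast
  show "c s (Suc k) p = c s (Suc k) q" if "c s k p = c s k q" for k p q by (rule c_Suc[OF that])
qed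

lemma P_subset: "P s \<subseteq> W"
  by (auto simp: P_def)

lemmas filtration_P = filtration_subset[OF P_subset]

lemma P_iff: "p \<in> P s \<longleftrightarrow> p \<in> W \<and> (\<forall>b\<in>Bs. (z p b + int s) div 2 ^ (M + 1) = 0)"
  unfolding P_def by (simp only: int_div_eq_0_iff zero_less_power zero_less_numeral mem_Collect_eq)

lemma c_top: "p \<in> P s \<Longrightarrow> q \<in> P s \<Longrightarrow> M + 1 \<le> k \<Longrightarrow> c s k p = c s k q"
  by (rule c_mono[of s "M + 1"]) (auto simp: c_eq_iff P_iff)

lemma P_closed:
  assumes "p \<in> P s" "q \<in> W" "c s k q = c s k p" "k \<le> M + 1"
  shows "q \<in> P s"
  using c_mono[OF assms(3,4)] assms(1,2) by (auto simp: P_iff c_eq_iff)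

text \<open>The statement covers every shift in the residue class of \<open>s\<close>, since the
  density counts all of them.\<close>

lemma good_cong:
  assumes "c s k p = c s k q"
  shows "good (s mod 2 ^ k + 2 ^ k * x) k p = good (s mod 2 ^ k + 2 ^ k * x) k q"
proof -
  have "(z p b + int (s mod 2 ^ k + 2 ^ k * x)) div 2 ^ k = (z q b + int (s mod 2 ^ k + 2 ^ k * x)) div 2 ^ k"
    if "b \<in> Bs" for b
  proof -
    have "(z p b + int s) div 2 ^ k = (z q b + int s) div 2 ^ k" using assms that by (auto simp: c_eq_iff)
    then show ?thesis
      unfolding shift_div_power[OF order_refl, where s = s] shift_div_power[OF order_refl, where s = "s mod 2 ^ k + 2 ^ k * x"]
      by simp
  qed
  then show ?thesis unfolding good_def by simp
qed

lemma w_cong: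
  assumes "c s k p = c s k q"
  shows "w s k p = w s k q"
proof -
  have "good s k p = good s k q" using good_cong[OF assms, of "s div 2 ^ k"] by simp
  moreover have "good_density s k p = good_density s k q"
    unfolding good_density_def using good_cong[OF assms] by simp
  ultimately show ?thesis by (simp add: w_def)
qed

text \<open>A union bound over scales and coordinates, which tolerates the dependence between
  coordinates caused by the common shift. At scale \<open>i\<close> a proportion
  \<open>2 * (1 / 2) ^ i\<close> of the positions is too close to an end of the ancestor; summing
  from \<open>i0\<close> on and over the coordinates gives at most
  \<open>4 * card Bs / 2 ^ i0\<close>, hence at most one half.\<close>

lemma good_density_ge: "1 / 2 \<le> good_density s k p"
proof -
  define n where "n = M - k"
  define v where "v b = (z p b + int (s mod 2 ^ k)) div 2 ^ k" for b
  define A where "A i = {0..<2 ^ i} \<union> {2 ^ (2 * i) - 2 ^ i..<2 ^ (2 * i) :: int}" for i :: nat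
  define X where "X i b = {x::nat. x < 2 ^ n \<and> (v b + int x) mod 2 ^ (2 * i) \<in> A i}" for i b
  define G where "G = {x. x < 2 ^ n \<and> good (s mod 2 ^ k + 2 ^ k * x) k p}"
  have v: "(z p b + int (s mod 2 ^ k + 2 ^ k * x)) div 2 ^ k = v b + int x" for b x
    using shift_div_power[OF order_refl, of "z p b" "s mod 2 ^ k + 2 ^ k * x" k] by (simp add: v_def)
  have A_card: "card (A i) \<le> 2 * 2 ^ i" for i
  proof -
    have "card (A i) \<le> card {0..<2 ^ i :: int} + card {2 ^ (2 * i) - 2 ^ i..<2 ^ (2 * i) :: int}"
      unfolding A_def by (rule card_Un_le)
    then show ?thesis by (simp add: nat_power_eq)
  qed
  have A_sub: "A i \<subseteq> {0..<2 ^ (2 * i)}" for i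
  proof -
    have "(2 :: int) ^ i \<le> 2 ^ (2 * i)" by (intro power_increasing) auto
    then show ?thesis unfolding A_def by auto
  qed
  have X_card: "real (card (X i b)) \<le> 2 * 2 ^ n * (1 / 2) ^ i" if "2 * i \<le> n" for i b
  proof -
    have "card (X i b) \<le> card (A i) * 2 ^ (n - 2 * i)"
      unfolding X_def by (rule card_shifted_residues_le[OF A_sub that])
    also have "\<dots> \<le> 2 * 2 ^ i * 2 ^ (n - 2 * i)" by (intro mult_right_mono A_card) simp
    finally have "real (card (X i b)) \<le> real (2 * 2 ^ i * 2 ^ (n - 2 * i))" by (rule of_nat_mono)
    also have "\<dots> = 2 * 2 ^ n * (1 / 2) ^ i"
    proof -
      have "(2 :: real) ^ n = 2 ^ i * 2 ^ i * 2 ^ (n - 2 * i)"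
        using that by (simp add: power_add[symmetric] mult_2[symmetric])
      then show ?thesis by (simp add: power_one_over field_simps)
    qed
    finally show ?thesis .
  qed
  have "{..<2 ^ n} - G \<subseteq> (\<Union>i\<in>{i0..n div 2}. \<Union>b\<in>Bs. X i b)"
  proof
    fix x assume x: "x \<in> {..<2 ^ n} - G"
    then obtain i b where ib: "i0 \<le> i" "k + 2 * i \<le> M" "b \<in> Bs"
        "\<not> (2 ^ i \<le> (v b + int x) mod 2 ^ (2 * i) \<and> (v b + int x) mod 2 ^ (2 * i) < 2 ^ (2 * i) - 2 ^ i)"
      unfolding G_def good_def v by auto
    then have "(v b + int x) mod 2 ^ (2 * i) \<in> A i" unfolding A_def by auto
    then have "x \<in> X i b" using x by (simp add: X_def)
    moreover have "i \<in> {i0..n div 2}" using ib(1,2) by (auto simp: n_def)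
    ultimately show "x \<in> (\<Union>i\<in>{i0..n div 2}. \<Union>b\<in>Bs. X i b)" using ib(3) by blast
  qed
  then have "card ({..<2 ^ n} - G) \<le> card (\<Union>i\<in>{i0..n div 2}. \<Union>b\<in>Bs. X i b)"
    by (intro card_mono) (auto simp: finBs X_def)
  also have "\<dots> \<le> (\<Sum>i\<in>{i0..n div 2}. card (\<Union>b\<in>Bs. X i b))"
    by (rule card_UN_le) simp
  also have "\<dots> \<le> (\<Sum>i\<in>{i0..n div 2}. \<Sum>b\<in>Bs. card (X i b))"
    by (intro sum_mono card_UN_le finBs)
  finally have "real (card ({..<2 ^ n} - G)) \<le> (\<Sum>i\<in>{i0..n div 2}. \<Sum>b\<in>Bs. real (card (X i b)))"
    by (simp flip: of_nat_sum)
  also have "\<dots> \<le> (\<Sum>i\<in>{i0..n div 2}. \<Sum>b\<in>Bs. 2 * 2 ^ n * (1 / 2) ^ i)"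
    by (intro sum_mono X_card) auto
  also have "\<dots> = 2 * 2 ^ n * card Bs * (\<Sum>i\<in>{i0..n div 2}. (1 / 2) ^ i)"
    by (simp add: sum_distrib_left mult_ac)
  also have "\<dots> \<le> 2 * 2 ^ n * card Bs * (2 * (1 / 2) ^ i0)"
    by (intro mult_left_mono sum_half_powers_le) simp
  also have "\<dots> \<le> 2 ^ n / 2"
  proof -
    have "real (8 * card Bs) \<le> real (2 ^ i0)" using i0(2) by (rule of_nat_mono)
    then have "8 * real (card Bs) * (1 / 2) ^ i0 \<le> 1" by (simp add: power_one_over field_simps)
    then have "2 ^ n / 2 * (8 * real (card Bs) * (1 / 2) ^ i0) \<le> 2 ^ n / 2 * 1" by (intro mult_left_mono) auto
    then show ?thesis by (simp add: field_simps)
  qed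
  finally have bad: "real (card ({..<2 ^ n} - G)) \<le> 2 ^ n / 2" .
  have "G \<subseteq> {..<2 ^ n}" by (auto simp: G_def)
  then have "card ({..<2 ^ n} - G) = 2 ^ n - card G" "card G \<le> 2 ^ n"
    using card_Diff_subset[of G "{..<2 ^ n}"] card_mono[of "{..<2 ^ n}" G] finite_subset by auto
  then have "2 ^ n / 2 \<le> real (card G)" using bad by (simp add: of_nat_diff)
  then show ?thesis by (simp add: good_density_def G_def n_def field_simps)
qed

lemma w_nonneg: "0 \<le> w s k p"
  using good_density_ge[of s k p] by (simp add: w_def)

lemma w_le: "w s k p \<le> 2"
  using good_density_ge[of s k p] by (simp add: w_def field_simps)

text \<open>On a residue class modulo \<open>2 ^ k\<close> the factor \<open>\<phi>\<close> is
  constant, so the sum over the high digits sees only \<open>w\<close>, whose mean there is one by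
  the choice of the density.\<close>

lemma sum_shifts_w:
  assumes k: "k \<le> M" and per: "\<And>s. \<phi> s = \<phi> (s mod 2 ^ k)"
  shows "(\<Sum>s<2 ^ M. \<phi> s * w s k p) = (\<Sum>s<2 ^ M. \<phi> s)"
proof -
  have M: "M = k + (M - k)" using k by simp
  have "(\<Sum>s<2 ^ M. \<phi> s * w s k p) = (\<Sum>t<2 ^ k. \<Sum>x<2 ^ (M - k). \<phi> (t + 2 ^ k * x) * w (t + 2 ^ k * x) k p)"
    by (subst M, rule sum_residues)
  also have "\<dots> = (\<Sum>t<2 ^ k. \<phi> t * 2 ^ (M - k))"
  proof (rule sum.cong)
    fix t :: nat assume "t \<in> {..<2 ^ k}"
    then have t: "(t + 2 ^ k * x) mod 2 ^ k = t" for x by simp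
    let ?g = "good_density t k p"
    have g: "good_density (t + 2 ^ k * x) k p = ?g" for x
      using t[of x] t[of 0] by (simp add: good_density_def)
    have "(\<Sum>x<2 ^ (M - k). \<phi> (t + 2 ^ k * x) * w (t + 2 ^ k * x) k p)
      = (\<Sum>x<2 ^ (M - k). \<phi> t / ?g * of_bool (good (t + 2 ^ k * x) k p))"
    proof (rule sum.cong)
      fix x
      show "\<phi> (t + 2 ^ k * x) * w (t + 2 ^ k * x) k p = \<phi> t / ?g * of_bool (good (t + 2 ^ k * x) k p)"
        using per[of "t + 2 ^ k * x"] unfolding t w_def g using k by simp
    qed simp
    also have "\<dots> = \<phi> t / ?g * (\<Sum>x<2 ^ (M - k). of_bool (good (t + 2 ^ k * x) k p))"
      by (rule sum_distrib_left[symmetric])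
    also have "(\<Sum>x<2 ^ (M - k). of_bool (good (t + 2 ^ k * x) k p)) = ?g * 2 ^ (M - k)"
    proof -
      have "(\<Sum>x<2 ^ (M - k). of_bool (good (t + 2 ^ k * x) k p))
        = real (card {x. x < 2 ^ (M - k) \<and> good (t + 2 ^ k * x) k p})"
        by (simp add: of_bool_def sum.If_cases Int_def lessThan_def)
      then show ?thesis using t[of 0] by (simp add: good_density_def)
    qed
    also have "\<phi> t / ?g * (?g * 2 ^ (M - k)) = \<phi> t * 2 ^ (M - k)"
      using good_density_ge[of t k p] by simp
    finally show "(\<Sum>x<2 ^ (M - k). \<phi> (t + 2 ^ k * x) * w (t + 2 ^ k * x) k p) = \<phi> t * 2 ^ (M - k)" .
  qed simp
  also have "\<dots> = (\<Sum>t<2 ^ k. \<Sum>x<2 ^ (M - k). \<phi> (t + 2 ^ k * x))"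
  proof (rule sum.cong)
    fix t :: nat assume "t \<in> {..<2 ^ k}"
    then have "\<phi> (t + 2 ^ k * x) = \<phi> t" for x using per[of "t + 2 ^ k * x"] by simp
    then show "\<phi> t * 2 ^ (M - k) = (\<Sum>x<2 ^ (M - k). \<phi> (t + 2 ^ k * x))" by simp
  qed simp
  also have "\<dots> = (\<Sum>s<2 ^ M. \<phi> s)"
    by (subst (2) M, rule sum_residues[symmetric])
  finally show ?thesis .
qed

text \<open>Allows the half of the telescoped form in which the difference falls on the second
  argument to be treated as the first half of the transposed kernel.\<close>

lemma lattice_kernel_transpose: "lattice_kernel W m z Bs (\<lambda>p q. a q p) M i0 V om B S"
proof
  show "\<bar>a q p - a q' p'\<bar> \<le> om i / V (k + i)"
    if "p \<in> W" "p' \<in> W" "q \<in> W" "q' \<in> W" "i0 \<le> i"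
      "\<And>b. b \<in> Bs \<Longrightarrow> \<bar>z p b - z p' b\<bar> < 2 ^ k" "\<And>b. b \<in> Bs \<Longrightarrow> \<bar>z q b - z q' b\<bar> < 2 ^ k"
      "\<exists>b\<in>Bs. 2 ^ (k + i) \<le> \<bar>z p b - z q b\<bar>" for p p' q q' i k
    by (rule kernel_smooth) (use that in \<open>simp_all add: abs_minus_commute\<close>)
qed (fact finW m_pos finBs i0 z_inj window B_nonneg V_pos ball_mass om_nonneg om_sum cube_testing cube_testing')+

section \<open>Dyadic distance and good cells\<close>

lemma diff_less:
  assumes "p \<in> W" "q \<in> W" "b \<in> Bs"
  shows "\<bar>z p b - z q b\<bar> < 2 ^ (M + 2)"
proof -
  have "(2::int) ^ (M + 2) = 4 * 2 ^ M" "(2::int) ^ (M + 1) = 2 * 2 ^ M" "(0::int) < 2 ^ M" by simp_all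
  then show ?thesis using window[OF assms(1,3)] window[OF assms(2,3)] by linarith
qed

lemma lev_less:
  assumes "p \<in> W" "q \<in> W" "b \<in> Bs"
  shows "\<bar>z p b - z q b\<bar> < 2 ^ (k + lev k p q + 1)"
proof -
  have "\<forall>b\<in>Bs. \<bar>z p b - z q b\<bar> < 2 ^ (k + (M + 1) + 1)"
  proof
    fix b assume "b \<in> Bs"
    then have "\<bar>z p b - z q b\<bar> < 2 ^ (M + 2)" using diff_less assms by blast
    also have "\<dots> \<le> 2 ^ (k + (M + 1) + 1)" by (intro power_increasing) auto
    finally show "\<bar>z p b - z q b\<bar> < 2 ^ (k + (M + 1) + 1)" .
  qed
  from LeastI[of "\<lambda>i. \<forall>b\<in>Bs. \<bar>z p b - z q b\<bar> < 2 ^ (k + i + 1)", OF this] assms(3)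
  show ?thesis by (simp add: lev_def)
qed

lemma lev_le:
  assumes "p \<in> W" "q \<in> W" shows "lev k p q \<le> M + 1"
  unfolding lev_def
proof (rule Least_le, rule ballI)
  fix b assume "b \<in> Bs"
  then have "\<bar>z p b - z q b\<bar> < 2 ^ (M + 2)" using diff_less assms by blast
  also have "\<dots> \<le> 2 ^ (k + (M + 1) + 1)" by (intro power_increasing) auto
  finally show "\<bar>z p b - z q b\<bar> < 2 ^ (k + (M + 1) + 1)" .
qed

lemma lev_ge:
  assumes "1 \<le> lev k p q"
  shows "\<exists>b\<in>Bs. 2 ^ (k + lev k p q) \<le> \<bar>z p b - z q b\<bar>"
proof (rule ccontr)
  assume "\<not> ?thesis"
  then have "\<forall>b\<in>Bs. \<bar>z p b - z q b\<bar> < 2 ^ (k + (lev k p q - 1) + 1)" using assms by auto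
  then have "lev k p q \<le> lev k p q - 1" unfolding lev_def by (rule Least_le)
  then show False using assms by simp
qed

text \<open>Up to level \<open>M\<close> this is the centrality demanded by \<open>good\<close>;
  beyond it there is only the top cell.\<close>

lemma good_same_cell:
  assumes "p \<in> P s" "q \<in> P s" "k \<le> M \<Longrightarrow> good s k p" "i0 \<le> i"
    and "\<And>b. b \<in> Bs \<Longrightarrow> \<bar>z p b - z q b\<bar> < 2 ^ (k + i)"
  shows "c s (k + 2 * i) q = c s (k + 2 * i) p"
proof (cases "k + 2 * i \<le> M")
  case True
  show ?thesis
    unfolding c_eq_iff
  proof
    fix b assume b: "b \<in> Bs"
    have "good s k p" using True assms(3) by simp
    then show "(z q b + int s) div 2 ^ (k + 2 * i) = (z p b + int s) div 2 ^ (k + 2 * i)"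
      using assms(4) assms(5)[OF b] True b by (intro div_power_eq_of_central) (auto simp: good_def)
  qed
next
  case False
  then show ?thesis using c_top[OF assms(2,1)] by simp
qed

text \<open>Were the distance below \<open>2 ^ (k + i0)\<close>, goodness at scale \<open>i0\<close>
  would put both points into one cell of level \<open>k + 2 * i0\<close>; so separation forces
  \<open>i0 \<le> lev\<close>. Goodness at scale \<open>lev + 1\<close> then yields the common
  ancestor, whence \<open>2 * lev + 2\<close>.\<close>

lemma far_cells:
  assumes "p \<in> P s" "q \<in> P s" "w s k p \<noteq> 0" "c s (k + 2 * i0) q \<noteq> c s (k + 2 * i0) p"
  shows "i0 \<le> lev k p q" "c s (k + 2 * lev k p q + 2) q = c s (k + 2 * lev k p q + 2) p"
proof -
  have pq: "p \<in> W" "q \<in> W" using assms P_subset by auto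
  have g: "k \<le> M \<Longrightarrow> good s k p" using assms(3) by (auto simp: w_def)
  show i: "i0 \<le> lev k p q"
  proof (rule ccontr)
    assume "\<not> ?thesis"
    then have l: "k + lev k p q + 1 \<le> k + i0" by simp
    have "\<bar>z p b - z q b\<bar> < 2 ^ (k + i0)" if "b \<in> Bs" for b
    proof -
      have "(2::int) ^ (k + lev k p q + 1) \<le> 2 ^ (k + i0)" using l by (intro power_increasing) auto
      then show ?thesis using lev_less[OF pq that, of k] by linarith
    qed
    then show False using good_same_cell[OF assms(1,2) g order_refl] assms(4) by blast
  qed
  have "c s (k + 2 * (lev k p q + 1)) q = c s (k + 2 * (lev k p q + 1)) p"
    using i lev_less[OF pq] by (intro good_same_cell[OF assms(1,2) g]) auto
  then show "c s (k + 2 * lev k p q + 2) q = c s (k + 2 * lev k p q + 2) p" by simp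
qed

section \<open>Each shifted grid satisfies the fixed-grid hypotheses\<close>

lemma cell_lattice_cube:
  assumes p: "p \<in> P s" and s: "s < 2 ^ M"
  obtains u j where "{q \<in> P s. c s k q = c s k p} = lattice_cube W z Bs u j"
    "\<And>b. b \<in> Bs \<Longrightarrow> - (2 ^ M) \<le> u b \<and> u b + 2 ^ j \<le> 2 ^ (M + 1)"
proof
  \<comment> \<open>From level \<open>M + 1\<close> on the only cell is all of \<open>P s\<close>;
    capping the exponent keeps the cube inside the window, where testing is available.\<close>
  define j where "j = min k (M + 1)"
  define x where "x b = (z p b + int s) div 2 ^ j" for b
  define u where "u b = 2 ^ j * x b - int s" for b
  have j: "j \<le> M + 1" by (simp add: j_def)
  have c_iff: "c s k q = c s k p \<longleftrightarrow> c s j q = c s j p" if "q \<in> P s" for q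
    using c_top[OF that p] by (auto simp: j_def min_def)
  have div_iff: "(z q b + int s) div 2 ^ j = x b \<longleftrightarrow> u b \<le> z q b \<and> z q b < u b + 2 ^ j" for q b
  proof -
    have "(y div 2 ^ j = e) \<longleftrightarrow> 2 ^ j * e \<le> y \<and> y < 2 ^ j * e + 2 ^ j" for y e :: int
    proof
      assume "y div 2 ^ j = e"
      then have "y = 2 ^ j * e + y mod 2 ^ j" by (metis mult_div_mod_eq)
      moreover have "0 \<le> y mod 2 ^ j" "y mod 2 ^ j < 2 ^ j" by simp_all
      ultimately show "2 ^ j * e \<le> y \<and> y < 2 ^ j * e + 2 ^ j" by linarith
    next
      assume "2 ^ j * e \<le> y \<and> y < 2 ^ j * e + 2 ^ j"
      then show "y div 2 ^ j = e" by (intro int_div_pos_eq[where r = "y - 2 ^ j * e"]) auto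
    qed
    then show ?thesis unfolding u_def by auto
  qed
  show "{q \<in> P s. c s k q = c s k p} = lattice_cube W z Bs u j"
  proof (intro set_eqI iffI)
    fix q assume q: "q \<in> {q \<in> P s. c s k q = c s k p}"
    then have "c s j q = c s j p" using c_iff by blast
    then show "q \<in> lattice_cube W z Bs u j"
      using q P_subset div_iff by (auto simp: lattice_cube_def c_eq_iff x_def)
  next
    fix q assume q: "q \<in> lattice_cube W z Bs u j"
    then have "c s j q = c s j p" using div_iff by (auto simp: lattice_cube_def c_eq_iff x_def)
    moreover from this have "q \<in> P s" using P_closed[OF p _ _ j] q by (auto simp: lattice_cube_def)
    ultimately show "q \<in> {q \<in> P s. c s k q = c s k p}" using c_iff by blast
  qed
  show "- (2 ^ M) \<le> u b \<and> u b + 2 ^ j \<le> 2 ^ (M + 1)" if b: "b \<in> Bs" for b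
  proof
    have zp: "0 \<le> z p b + int s" "z p b + int s < 2 ^ (M + 1)" using p b by (auto simp: P_def)
    have "0 \<le> x b" unfolding x_def using zp by (simp add: pos_imp_zdiv_nonneg_iff)
    then have "0 \<le> 2 ^ j * x b" by simp
    moreover have "int s < 2 ^ M" using s by (metis of_nat_less_iff of_nat_numeral of_nat_power)
    ultimately show "- (2 ^ M) \<le> u b" unfolding u_def by linarith
    have M: "(2::int) ^ (M + 1) = 2 ^ (M + 1 - j) * 2 ^ j" using j by (simp add: power_add[symmetric])
    have "x b < 2 ^ (M + 1 - j)"
    proof (rule ccontr)
      assume "\<not> ?thesis"
      then have "2 ^ (M + 1 - j) * 2 ^ j \<le> x b * 2 ^ j" by simp
      also have "\<dots> \<le> z p b + int s"
      proof -
        have "0 \<le> (z p b + int s) mod 2 ^ j" by simp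
        then show ?thesis unfolding x_def using div_mult_mod_eq[of "z p b + int s" "2 ^ j"] by linarith
      qed
      finally show False using zp M by simp
    qed
    then have "(x b + 1) * 2 ^ j \<le> 2 ^ (M + 1 - j) * 2 ^ j" by (intro mult_right_mono) auto
    then show "u b + 2 ^ j \<le> 2 ^ (M + 1)" unfolding M u_def by (simp add: algebra_simps)
  qed
qed

text \<open>The number of lattice cubes of level \<open>k - 1\<close> in one of level
  \<open>k + 2 * i0\<close>.\<close>

definition Dn :: real where
  "Dn = 2 ^ ((2 * i0 + 1) * card Bs)"

lemma card_cells_le:
  assumes "1 \<le> k"
  shows "real (card (c s (k - 1) ` {q \<in> P s. c s (k + 2 * i0) q = c s (k + 2 * i0) p})) \<le> Dn"
proof -
  let ?n = "2 * i0 + 1"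
  let ?I = "\<lambda>b. {2 ^ ?n * ((z p b + int s) div 2 ^ (k + 2 * i0))..<2 ^ ?n * ((z p b + int s) div 2 ^ (k + 2 * i0)) + 2 ^ ?n}"
  have "c s (k - 1) ` {q \<in> P s. c s (k + 2 * i0) q = c s (k + 2 * i0) p} \<subseteq> PiE Bs ?I"
  proof clarify
    fix q assume "c s (k + 2 * i0) q = c s (k + 2 * i0) p"
    then have e: "(z q b + int s) div 2 ^ (k + 2 * i0) = (z p b + int s) div 2 ^ (k + 2 * i0)" if "b \<in> Bs" for b
      using that by (auto simp: c_eq_iff)
    have k': "k + 2 * i0 = (k - 1) + ?n" using assms by simp
    have "(z q b + int s) div 2 ^ (k - 1) \<in> ?I b" if "b \<in> Bs" for b
    proof -
      let ?y = "(z q b + int s) div 2 ^ (k - 1)"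
      have "?y div 2 ^ ?n = (z p b + int s) div 2 ^ (k + 2 * i0)"
        using e[OF that] unfolding k' power_add[of _ "k - 1"] by (simp only: zdiv_zmult2_eq zero_le_power zero_le_numeral)
      moreover have "?y = 2 ^ ?n * (?y div 2 ^ ?n) + ?y mod 2 ^ ?n" by simp
      moreover have "0 \<le> ?y mod 2 ^ ?n" "?y mod 2 ^ ?n < 2 ^ ?n" by simp_all
      ultimately show ?thesis by (metis add_less_cancel_left atLeastLessThan_iff le_add_same_cancel1)
    qed
    then show "c s (k - 1) q \<in> PiE Bs ?I" by (auto simp: c_def restrict_def PiE_def extensional_def)
  qed
  then have "card (c s (k - 1) ` {q \<in> P s. c s (k + 2 * i0) q = c s (k + 2 * i0) p}) \<le> card (PiE Bs ?I)"
    by (intro card_mono finite_PiE finBs) auto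
  also have "\<dots> = (2 ^ ?n) ^ card Bs" by (simp add: card_PiE finBs nat_power_eq nat_mult_distrib)
  finally have "real (card (c s (k - 1) ` {q \<in> P s. c s (k + 2 * i0) q = c s (k + 2 * i0) p}))
      \<le> real ((2 ^ ?n) ^ card Bs)" by (rule of_nat_mono)
  also have "\<dots> = Dn" unfolding Dn_def power_mult by (simp only: of_nat_power of_nat_numeral)
  finally show ?thesis .
qed

text \<open>The ancestor is taken \<open>2 * i0\<close> levels up, where goodness begins to act, and
  \<open>M + 2\<close> exceeds every dyadic distance in the window.\<close>

lemma testing_kernel_P:
  assumes s: "s < 2 ^ M"
  shows "testing_kernel (P s) m (c s) a (w s) lev V om (2 * i0) (M + 2) B Dn S"
proof -
  interpret F: filtration "P s" m "c s" by (rule filtration_P)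
  note W = subsetD[OF P_subset, of _ s]
  show ?thesis
  proof
    show "w s k p = w s k q" if "c s k p = c s k q" for k p q by (rule w_cong[OF that])
    show "0 \<le> w s k p" "w s k p \<le> 2" for k p by (fact w_nonneg w_le)+
    show "(\<Sum>x\<in>P s. (\<Sum>q\<in>F.cell k p. a x q * m q)\<^sup>2 * m x) \<le> B\<^sup>2 * F.mass k p" if p: "p \<in> P s" for p k
    proof -
      obtain u j where "{q \<in> P s. c s k q = c s k p} = lattice_cube W z Bs u j"
        and u: "\<And>b. b \<in> Bs \<Longrightarrow> - (2 ^ M) \<le> u b \<and> u b + 2 ^ j \<le> 2 ^ (M + 1)"
        by (rule cell_lattice_cube[OF p s, of k]) (rule that)
      then have cube: "F.cell k p = lattice_cube W z Bs u j" by (simp only: F.cell_def)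
      have "(\<Sum>x\<in>P s. (\<Sum>q\<in>F.cell k p. a x q * m q)\<^sup>2 * m x) \<le> (\<Sum>x\<in>W. (\<Sum>q\<in>F.cell k p. a x q * m q)\<^sup>2 * m x)"
        by (rule sum_mono2[OF finW P_subset]) (use m_pos in \<open>auto intro!: mult_nonneg_nonneg intro: less_imp_le\<close>)
      also have "\<dots> \<le> B\<^sup>2 * F.mass k p"
        unfolding F.mass_def cube by (rule cube_testing[OF u])
      finally show ?thesis .
    qed
    show "(\<Sum>q\<in>F.cell (k + 2 * i0) p. m q / F.mass (k - 1) q) \<le> Dn" if "1 \<le> k" for k p
      by (rule order_trans[OF F.sum_mass_ratio_le]) (unfold F.cell_def, rule card_cells_le[OF that])
    show "(\<Sum>q | q \<in> P s \<and> lev k p q = i. m q) \<le> V (k + i)" if p: "p \<in> P s" for p k i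
    proof -
      have "(\<Sum>q | q \<in> P s \<and> lev k p q = i. m q) \<le> (\<Sum>q | q \<in> W \<and> (\<forall>b\<in>Bs. \<bar>z p b - z q b\<bar> < 2 ^ (k + i + 1)). m q)"
        using finW m_pos lev_less[OF W[OF p] W] W by (intro sum_mono2) (auto intro: less_imp_le)
      also have "\<dots> \<le> V (k + i)" by (rule ball_mass[OF W[OF p]])
      finally show ?thesis .
    qed
    show "(\<Sum>p | p \<in> P s \<and> lev k p q = i. m p) \<le> V (k + i)" if q: "q \<in> P s" for q k i
    proof -
      have "(\<Sum>p | p \<in> P s \<and> lev k p q = i. m p) \<le> (\<Sum>p | p \<in> W \<and> (\<forall>b\<in>Bs. \<bar>z q b - z p b\<bar> < 2 ^ (k + i + 1)). m p)"
        using finW m_pos lev_less[OF W W[OF q]] W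
        by (intro sum_mono2) (auto intro: less_imp_le simp: abs_minus_commute[of "z q _"])
      also have "\<dots> \<le> V (k + i)" by (rule ball_mass[OF W[OF q]])
      finally show ?thesis .
    qed
    show "lev k p q < M + 2 \<and> c s (k + 2 * lev k p q + 2) q = c s (k + 2 * lev k p q + 2) p"
      if "p \<in> P s" "q \<in> P s" "w s k p \<noteq> 0" "c s (k + 2 * i0) q \<noteq> c s (k + 2 * i0) p" for k p q
      using far_cells(2)[OF that] lev_le[OF W W, OF that(1,2), of k] by simp
    show "\<bar>a p q - a p' q\<bar> \<le> om (lev k p q) / V (k + lev k p q)"
      if pq: "p \<in> P s" "q \<in> P s" "w s k p \<noteq> 0" "c s (k + 2 * i0) q \<noteq> c s (k + 2 * i0) p"
        and p': "p' \<in> P s" "c s k p' = c s k p" for k p q p'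
    proof (rule kernel_smooth)
      show i: "i0 \<le> lev k p q" by (rule far_cells(1)[OF pq])
      show "\<exists>b\<in>Bs. 2 ^ (k + lev k p q) \<le> \<bar>z p b - z q b\<bar>"
        by (rule lev_ge) (use i i0 in simp)
      fix b assume b: "b \<in> Bs"
      let ?x = "z p b + int s" and ?x' = "z p' b + int s"
      have e: "?x div 2 ^ k = ?x' div 2 ^ k" using p'(2) b by (auto simp: c_eq_iff)
      have "?x = 2 ^ k * (?x div 2 ^ k) + ?x mod 2 ^ k" "?x' = 2 ^ k * (?x div 2 ^ k) + ?x' mod 2 ^ k"
        by (simp, simp add: e)
      moreover have "0 \<le> ?x mod 2 ^ k" "?x mod 2 ^ k < 2 ^ k" "0 \<le> ?x' mod 2 ^ k" "?x' mod 2 ^ k < 2 ^ k"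
        by simp_all
      ultimately show "\<bar>z p b - z p' b\<bar> < 2 ^ k" by linarith
    qed (use pq p' W in auto)
    show "0 \<le> Dn" by (simp add: Dn_def)
  qed (fact B_nonneg V_pos om_nonneg om_sum)+
qed

section \<open>Averaging the form over shifts\<close>

definition C :: real where
  "C = 2 * B * sqrt Dn * sqrt (real (2 * i0 + 1)) + 4 * S + 2 * sqrt (8 * B\<^sup>2 + 8 * S\<^sup>2 + 1)"

text \<open>Agrees with \<open>filtration.E\<close> on \<open>P s\<close> up to level
  \<open>M + 1\<close>, but does not refer to \<open>P s\<close>. At level \<open>k\<close> it
  therefore depends on \<open>s\<close> only modulo \<open>2 ^ k\<close>, which the averaging over
  shifts requires.\<close>

definition av :: "nat \<Rightarrow> nat \<Rightarrow> ('p \<Rightarrow> real) \<Rightarrow> 'p \<Rightarrow> real" where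
  "av s k f p = (\<Sum>q | q \<in> W \<and> c s k q = c s k p. f q * m q) / (\<Sum>q | q \<in> W \<and> c s k q = c s k p. m q)"

definition form :: "('p \<Rightarrow> real) \<Rightarrow> ('p \<Rightarrow> real) \<Rightarrow> real" where
  "form f g = (\<Sum>p\<in>W. \<Sum>q\<in>W. a p q * m p * m q * f p * g q)"

definition norm_W :: "('p \<Rightarrow> real) \<Rightarrow> real" where
  "norm_W f = sqrt (\<Sum>p\<in>W. (f p)\<^sup>2 * m p)"

lemma E_P_av:
  assumes "p \<in> P s" "k \<le> M + 1"
  shows "filtration.E (P s) m (c s) k f p = av s k f p"
proof -
  interpret F: filtration "P s" m "c s" by (rule filtration_P)
  have "F.cell k p = {q. q \<in> W \<and> c s k q = c s k p}"
    unfolding F.cell_def using P_subset P_closed[OF assms(1) _ _ assms(2)] by blast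
  then show ?thesis by (simp add: F.E_def F.mass_def av_def)
qed

lemma av_zero:
  assumes f: "\<And>q. q \<in> W \<Longrightarrow> q \<notin> P s \<Longrightarrow> f q = 0" and "p \<in> W" "p \<notin> P s" "k \<le> M + 1"
  shows "av s k f p = 0"
proof -
  have "f q = 0" if "q \<in> W" "c s k q = c s k p" for q
    using f[OF that(1)] P_closed[of q s p k] that assms(2-4) by fastforce
  then show ?thesis by (simp add: av_def)
qed

lemma av_mod:
  assumes "j \<le> k"
  shows "av s j f p = av (s mod 2 ^ k) j f p"
proof -
  have "c s j q = c s j p \<longleftrightarrow> c (s mod 2 ^ k) j q = c (s mod 2 ^ k) j p" for q
    unfolding c_eq_iff shift_div_power[OF assms, where s = s] by simp
  then show ?thesis by (simp add: av_def)
qed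

lemma nrm_P_le: "filtration.nrm (P s) m f \<le> norm_W f"
proof -
  interpret F: filtration "P s" m "c s" by (rule filtration_P)
  show ?thesis
    unfolding F.nrm_def F.ip_def norm_W_def power2_eq_square
    by (intro real_sqrt_le_mono sum_mono2 finW P_subset) (use m_pos in \<open>auto simp: less_imp_le intro!: mult_nonneg_nonneg[of "_ * _"]\<close>)
qed

lemma support_P:
  assumes "\<And>p. p \<in> W \<Longrightarrow> f p \<noteq> 0 \<Longrightarrow> (\<forall>b\<in>Bs. 0 \<le> z p b \<and> z p b < 2 ^ M)" "s < 2 ^ M" "q \<in> W" "q \<notin> P s"
  shows "f q = 0"
proof (rule ccontr)
  assume "f q \<noteq> 0"
  then have *: "\<forall>b\<in>Bs. 0 \<le> z q b \<and> z q b < 2 ^ M" using assms by blast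
  have "int s < 2 ^ M" using assms(2) by (metis of_nat_less_iff of_nat_numeral of_nat_power)
  moreover have "(2::int) ^ (M + 1) = 2 * 2 ^ M" by simp
  ultimately have "0 \<le> z q b + int s \<and> z q b + int s < 2 ^ (M + 1)" if "b \<in> Bs" for b
    using bspec[OF * that] by linarith
  then have "q \<in> P s" using assms(3) by (simp add: P_def)
  then show False using assms by simp
qed

text \<open>For fixed \<open>k\<close> the summand is periodic in \<open>s\<close> modulo
  \<open>2 ^ k\<close>, because no level above \<open>k\<close> occurs in it; the weight can thus be
  inserted without changing the sum over shifts. At level \<open>M + 1\<close> the weight is one.
  After the sums are exchanged back, the fixed-grid bound applies shift by shift.\<close>

lemma half_average_le:
  assumes f: "\<And>p. p \<in> W \<Longrightarrow> f p \<noteq> 0 \<Longrightarrow> (\<forall>b\<in>Bs. 0 \<le> z p b \<and> z p b < 2 ^ M)"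
    and g: "\<And>p. p \<in> W \<Longrightarrow> g p \<noteq> 0 \<Longrightarrow> (\<forall>b\<in>Bs. 0 \<le> z p b \<and> z p b < 2 ^ M)"
    and \<kappa>: "\<And>k. k - 1 \<le> \<kappa> k \<and> \<kappa> k \<le> k"
  shows "\<bar>\<Sum>s<2 ^ M. \<Sum>k=1..M + 1. form (\<lambda>p. av s (k - 1) f p - av s k f p) (av s (\<kappa> k) g)\<bar>
    \<le> 2 ^ M * (C * (norm_W f * norm_W g))"
proof -
  let ?d = "\<lambda>s k p. av s (k - 1) f p - av s k f p"
  have insert_w: "(\<Sum>s<2 ^ M. form (?d s k) (av s (\<kappa> k) g))
      = (\<Sum>s<2 ^ M. form (\<lambda>p. w s k p * ?d s k p) (av s (\<kappa> k) g))" if k: "k \<le> M + 1" for k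
  proof (cases "k \<le> M")
    case False
    then show ?thesis by (simp add: w_def)
  next
    case True
    define \<phi> where "\<phi> p s = (\<Sum>q\<in>W. a p q * m p * m q * ?d s k p * av s (\<kappa> k) g q)" for p s
    have per: "\<phi> p s = \<phi> p (s mod 2 ^ k)" for p s
      unfolding \<phi>_def using av_mod[of "k - 1" k s] av_mod[of k k s] av_mod[of "\<kappa> k" k s] \<kappa>[of k] by simp
    have "(\<Sum>s<2 ^ M. form (\<lambda>p. w s k p * ?d s k p) (av s (\<kappa> k) g)) = (\<Sum>s<2 ^ M. \<Sum>p\<in>W. \<phi> p s * w s k p)"
      unfolding form_def \<phi>_def sum_distrib_right by (simp add: mult_ac)
    also have "\<dots> = (\<Sum>p\<in>W. \<Sum>s<2 ^ M. \<phi> p s * w s k p)" by (rule sum.swap)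
    also have "\<dots> = (\<Sum>p\<in>W. \<Sum>s<2 ^ M. \<phi> p s)"
      by (intro sum.cong refl sum_shifts_w[OF True] per)
    also have "\<dots> = (\<Sum>s<2 ^ M. \<Sum>p\<in>W. \<phi> p s)" by (rule sum.swap)
    finally show ?thesis by (simp add: form_def \<phi>_def)
  qed
  have fixed: "\<bar>\<Sum>k=1..M + 1. form (\<lambda>p. w s k p * ?d s k p) (av s (\<kappa> k) g)\<bar> \<le> C * (norm_W f * norm_W g)"
    if s: "s < 2 ^ M" for s
  proof -
    interpret T: testing_kernel "P s" m "c s" a "w s" lev V om "2 * i0" "M + 2" B Dn S
      by (rule testing_kernel_P[OF s])
    have "form (\<lambda>p. w s k p * ?d s k p) (av s (\<kappa> k) g)
       = (\<Sum>p\<in>P s. \<Sum>q\<in>P s. a p q * m p * m q * (w s k p * T.D k f p) * T.E (\<kappa> k) g q)"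
      if k: "k \<in> {1..M + 1}" for k
    proof -
      have d0: "?d s k p = 0" if "p \<in> W" "p \<notin> P s" for p
        proof -
        have "k - 1 \<le> M + 1" "k \<le> M + 1" using k by auto
        then show ?thesis using av_zero[OF support_P[of f, OF f s] that] by simp
      qed
      have g0: "av s (\<kappa> k) g q = 0" if "q \<in> W" "q \<notin> P s" for q
        proof -
        have "\<kappa> k \<le> M + 1" using k \<kappa>[of k] by auto
        then show ?thesis using av_zero[OF support_P[of g, OF g s] that] by simp
      qed
      have "form (\<lambda>p. w s k p * ?d s k p) (av s (\<kappa> k) g)
          = (\<Sum>p\<in>P s. \<Sum>q\<in>W. a p q * m p * m q * (w s k p * ?d s k p) * av s (\<kappa> k) g q)"
        unfolding form_def using d0 by (intro sum.mono_neutral_right[OF finW P_subset]) auto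
      also have "\<dots> = (\<Sum>p\<in>P s. \<Sum>q\<in>P s. a p q * m p * m q * (w s k p * ?d s k p) * av s (\<kappa> k) g q)"
        using g0 by (intro sum.cong sum.mono_neutral_right[OF finW P_subset]) auto
      also have "\<dots> = (\<Sum>p\<in>P s. \<Sum>q\<in>P s. a p q * m p * m q * (w s k p * T.D k f p) * T.E (\<kappa> k) g q)"
        unfolding T.D_def using k \<kappa>[of k] by (intro sum.cong) (auto simp: E_P_av)
      finally show ?thesis .
    qed
    then have "\<bar>\<Sum>k=1..M + 1. form (\<lambda>p. w s k p * ?d s k p) (av s (\<kappa> k) g)\<bar>
      = \<bar>\<Sum>k=1..M + 1. \<Sum>p\<in>P s. \<Sum>q\<in>P s. a p q * m p * m q * (w s k p * T.D k f p) * T.E (\<kappa> k) g q\<bar>"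
      by simp
    also have "\<dots> \<le> T.half_form_const * (T.nrm f * T.nrm g)" by (rule T.half_form_le[OF \<kappa>])
    also have "T.half_form_const = C" by (simp add: T.half_form_const_def T.carleson_const_def C_def)
    also have "C * (T.nrm f * T.nrm g) \<le> C * (norm_W f * norm_W g)"
    proof (intro mult_left_mono mult_mono nrm_P_le)
      show "0 \<le> C" unfolding C_def using B_nonneg T.S_nonneg by (simp add: Dn_def)
    qed (simp_all add: norm_W_def sum_nonneg m_pos less_imp_le)
    finally show ?thesis .
  qed
  have "(\<Sum>s<2 ^ M. \<Sum>k=1..M + 1. form (?d s k) (av s (\<kappa> k) g))
      = (\<Sum>k=1..M + 1. \<Sum>s<2 ^ M. form (?d s k) (av s (\<kappa> k) g))" by (rule sum.swap)
  also have "\<dots> = (\<Sum>k=1..M + 1. \<Sum>s<2 ^ M. form (\<lambda>p. w s k p * ?d s k p) (av s (\<kappa> k) g))"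
    by (rule sum.cong[OF refl]) (rule insert_w, simp)
  also have "\<dots> = (\<Sum>s<2 ^ M. \<Sum>k=1..M + 1. form (\<lambda>p. w s k p * ?d s k p) (av s (\<kappa> k) g))" by (rule sum.swap)
  also have "\<bar>\<dots>\<bar> \<le> (\<Sum>s::nat<2 ^ M. C * (norm_W f * norm_W g))"
    by (rule order_trans[OF sum_abs], rule sum_mono) (use fixed in auto)
  finally show ?thesis by simp
qed

lemma form_diff_left: "form (\<lambda>p. f p - f' p) g = form f g - form f' g"
  by (simp add: form_def algebra_simps sum_subtractf)

lemma form_diff_right: "form f (\<lambda>p. g p - g' p) = form f g - form f g'"
  by (simp add: form_def algebra_simps sum_subtractf)

lemma top_average_le:
  assumes f: "\<And>p. p \<in> W \<Longrightarrow> f p \<noteq> 0 \<Longrightarrow> (\<forall>b\<in>Bs. 0 \<le> z p b \<and> z p b < 2 ^ M)"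
    and g: "\<And>p. p \<in> W \<Longrightarrow> g p \<noteq> 0 \<Longrightarrow> (\<forall>b\<in>Bs. 0 \<le> z p b \<and> z p b < 2 ^ M)"
    and s: "s < 2 ^ M"
  shows "\<bar>form (av s (M + 1) f) (av s (M + 1) g)\<bar> \<le> B * (norm_W f * norm_W g)"
proof -
  interpret T: testing_kernel "P s" m "c s" a "w s" lev V om "2 * i0" "M + 2" B Dn S
    by (rule testing_kernel_P[OF s])
  have f0: "av s (M + 1) f p = 0" if "p \<in> W" "p \<notin> P s" for p
    using av_zero[of s f p, OF support_P[of f, OF f s]] that by simp
  have g0: "av s (M + 1) g q = 0" if "q \<in> W" "q \<notin> P s" for q
    using av_zero[of s g q, OF support_P[of g, OF g s]] that by simp
  have "form (av s (M + 1) f) (av s (M + 1) g)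
      = (\<Sum>p\<in>P s. \<Sum>q\<in>W. a p q * m p * m q * av s (M + 1) f p * av s (M + 1) g q)"
    unfolding form_def using f0 by (intro sum.mono_neutral_right[OF finW P_subset]) auto
  also have "\<dots> = (\<Sum>p\<in>P s. \<Sum>q\<in>P s. a p q * m p * m q * av s (M + 1) f p * av s (M + 1) g q)"
    using g0 by (intro sum.cong sum.mono_neutral_right[OF finW P_subset]) auto
  also have "\<dots> = (\<Sum>p\<in>P s. \<Sum>q\<in>P s. a p q * m p * m q * T.E (M + 1) f p * T.E (M + 1) g q)"
    by (intro sum.cong) (auto simp: E_P_av)
  also have "\<bar>\<dots>\<bar> \<le> B * (T.nrm f * T.nrm g)"
    by (rule T.top_part) (rule c_top, auto)
  also have "\<dots> \<le> B * (norm_W f * norm_W g)"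
    using B_nonneg by (intro mult_left_mono mult_mono nrm_P_le)
      (simp_all add: norm_W_def sum_nonneg m_pos less_imp_le)
  finally show ?thesis .
qed

lemma av_0: "p \<in> W \<Longrightarrow> av s 0 f p = f p"
proof -
  assume p: "p \<in> W"
  have "{q. q \<in> W \<and> c s 0 q = c s 0 p} = {p}"
    using p z_inj[OF _ p] by (auto simp: c_eq_iff)
  then show ?thesis using m_pos[OF p] by (simp add: av_def)
qed

end

text \<open>The form is independent of the shift, so its decomposition may be averaged. The product
  rule for differences puts \<open>E (k - 1) g\<close> next to \<open>D k f\<close> in one half and
  \<open>E k f\<close> next to \<open>D k g\<close> in the other, which are the two admissible
  choices of \<open>\<kappa>\<close>.\<close>

lemma (in lattice_kernel) form_le:
  assumes f: "\<And>p. p \<in> W \<Longrightarrow> f p \<noteq> 0 \<Longrightarrow> (\<forall>b\<in>Bs. 0 \<le> z p b \<and> z p b < 2 ^ M)"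
    and g: "\<And>p. p \<in> W \<Longrightarrow> g p \<noteq> 0 \<Longrightarrow> (\<forall>b\<in>Bs. 0 \<le> z p b \<and> z p b < 2 ^ M)"
  shows "\<bar>form f g\<bar> \<le> (B + 2 * C) * (norm_W f * norm_W g)"
proof -
  interpret t: lattice_kernel W m z Bs "\<lambda>p q. a q p" M i0 V om B S
    by (rule lattice_kernel_transpose)
  have form_t: "t.form g' f' = form f' g'" for f' g'
    unfolding t.form_def form_def by (subst sum.swap) (simp add: mult_ac)
  let ?H1 = "\<lambda>s. \<Sum>k=1..M + 1. form (\<lambda>p. av s (k - 1) f p - av s k f p) (av s (k - 1) g)"
  let ?H2 = "\<lambda>s. \<Sum>k=1..M + 1. form (av s k f) (\<lambda>p. av s (k - 1) g p - av s k g p)"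
  have dec: "form f g = form (av s (M + 1) f) (av s (M + 1) g) + ?H1 s + ?H2 s" for s
  proof -
    let ?b = "\<lambda>k. form (av s k f) (av s k g)"
    have "form f g = ?b 0" unfolding form_def by (simp add: av_0)
    also have "\<dots> = ?b (M + 1) + (\<Sum>k=1..M + 1. ?b (k - 1) - ?b k)"
      using sum_telescope''[of 0 "M + 1" ?b] by (simp add: sum_subtractf sum_negf)
    also have "(\<Sum>k=1..M + 1. ?b (k - 1) - ?b k) = ?H1 s + ?H2 s"
      unfolding sum.distrib[symmetric] form_diff_left form_diff_right by (intro sum.cong) auto
    finally show ?thesis by simp
  qed
  have "2 ^ M * form f g = (\<Sum>s::nat<2 ^ M. form f g)" by simp
  also have "\<dots> = (\<Sum>s<2 ^ M. form (av s (M + 1) f) (av s (M + 1) g) + ?H1 s + ?H2 s)"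
    by (rule sum.cong[OF refl]) (rule dec)
  also have "\<dots> = (\<Sum>s<2 ^ M. form (av s (M + 1) f) (av s (M + 1) g)) + (\<Sum>s<2 ^ M. ?H1 s) + (\<Sum>s<2 ^ M. ?H2 s)"
    by (simp only: sum.distrib)
  finally have eq: "2 ^ M * form f g = \<dots>" .
  have h1: "\<bar>\<Sum>s<2 ^ M. ?H1 s\<bar> \<le> 2 ^ M * (C * (norm_W f * norm_W g))"
    by (rule half_average_le[OF f g]) auto
  have "\<bar>\<Sum>s<2 ^ M. \<Sum>k=1..M + 1. t.form (\<lambda>p. av s (k - 1) g p - av s k g p) (av s k f)\<bar>
      \<le> 2 ^ M * (C * (norm_W g * norm_W f))"
    by (rule t.half_average_le[OF g f]) auto
  then have h2: "\<bar>\<Sum>s<2 ^ M. ?H2 s\<bar> \<le> 2 ^ M * (C * (norm_W f * norm_W g))"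
    unfolding form_t by (simp add: mult.commute[of "norm_W g"])
  have "\<bar>\<Sum>s<2 ^ M. form (av s (M + 1) f) (av s (M + 1) g)\<bar> \<le> (\<Sum>s::nat<2 ^ M. B * (norm_W f * norm_W g))"
    by (rule order_trans[OF sum_abs], rule sum_mono) (use top_average_le[OF f g] in auto)
  then have h0: "\<bar>\<Sum>s<2 ^ M. form (av s (M + 1) f) (av s (M + 1) g)\<bar> \<le> 2 ^ M * (B * (norm_W f * norm_W g))"
    by simp
  have "\<bar>2 ^ M * form f g\<bar> \<le> 2 ^ M * (B * (norm_W f * norm_W g)) + 2 ^ M * (C * (norm_W f * norm_W g)) + 2 ^ M * (C * (norm_W f * norm_W g))"
    unfolding eq using h0 h1 h2 by linarith
  also have "\<dots> = 2 ^ M * ((B + 2 * C) * (norm_W f * norm_W g))" by (simp add: algebra_simps)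
  finally show ?thesis by (simp add: abs_mult)
qed

section \<open>Square-integrable functions and step functions\<close>

lemma L2_measurable: "f \<in> L2 M \<Longrightarrow> f \<in> borel_measurable M"
  and L2_integrable: "f \<in> L2 M \<Longrightarrow> integrable M (\<lambda>x. (norm (f x))\<^sup>2)"
  by (auto simp: L2_def)

lemma L2_norm_nonneg [simp]: "0 \<le> L2_norm M f"
  by (simp add: L2_norm_def)

lemma L2_norm_square: "(L2_norm M f)\<^sup>2 = (LINT x|M. (norm (f x))\<^sup>2)"
  by (simp add: L2_norm_def)

lemma L2_bound:
  assumes "f \<in> L2 M" "g \<in> borel_measurable M" "\<And>x. norm (g x) \<le> c * norm (f x)"
  shows "g \<in> L2 M"
proof -
  have "integrable M (\<lambda>x. (norm (g x))\<^sup>2)"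
  proof (rule Bochner_Integration.integrable_bound)
    show "integrable M (\<lambda>x. c\<^sup>2 * (norm (f x))\<^sup>2)" using L2_integrable[OF assms(1)] by simp
    have "(norm (g x))\<^sup>2 \<le> (c * norm (f x))\<^sup>2" for x using assms(3) by (intro power_mono) auto
    then show "AE x in M. norm ((norm (g x))\<^sup>2) \<le> norm (c\<^sup>2 * (norm (f x))\<^sup>2)"
      by (simp add: power_mult_distrib)
  qed (use assms(2) in measurable)
  then show ?thesis using assms(2) by (simp add: L2_def)
qed

lemma L2_cmult: "f \<in> L2 M \<Longrightarrow> (\<lambda>x. c * f x) \<in> L2 M"
  by (rule L2_bound[where c = "norm c"]) (auto simp: norm_mult dest: L2_measurable)

lemma L2_cnj: "f \<in> L2 M \<Longrightarrow> (\<lambda>x. cnj (f x)) \<in> L2 M"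
proof -
  assume f: "f \<in> L2 M"
  have "(\<lambda>x. cnj (f x)) \<in> borel_measurable M"
    using measurable_compose[OF L2_measurable[OF f] borel_measurable_continuous_onI[OF continuous_on_cnj[OF continuous_on_id]]]
    by simp
  then show ?thesis by (rule L2_bound[OF f, where c = 1]) simp
qed

lemma norm_square_add_le: "(norm (a + b :: complex))\<^sup>2 \<le> 2 * (norm a)\<^sup>2 + 2 * (norm b)\<^sup>2"
proof -
  have "(norm (a + b))\<^sup>2 \<le> (norm a + norm b)\<^sup>2" by (intro power_mono norm_triangle_ineq) auto
  also have "\<dots> \<le> 2 * (norm a)\<^sup>2 + 2 * (norm b)\<^sup>2"
    using sum_squares_bound[of "norm a" "norm b"] by (simp add: power2_sum)
  finally show ?thesis .
qed

lemma L2_add: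
  assumes "f \<in> L2 M" "g \<in> L2 M" shows "(\<lambda>x. f x + g x) \<in> L2 M"
proof -
  have m [measurable]: "f \<in> borel_measurable M" "g \<in> borel_measurable M" using assms by (auto dest: L2_measurable)
  have "integrable M (\<lambda>x. (norm (f x + g x))\<^sup>2)"
  proof (rule Bochner_Integration.integrable_bound)
    show "integrable M (\<lambda>x. 2 * (norm (f x))\<^sup>2 + 2 * (norm (g x))\<^sup>2)"
      using assms[THEN L2_integrable] by simp
  qed (use norm_square_add_le in auto)
  then show ?thesis by (simp add: L2_def)
qed

lemma L2_diff: "f \<in> L2 M \<Longrightarrow> g \<in> L2 M \<Longrightarrow> (\<lambda>x. f x - g x) \<in> L2 M"
  using L2_add[OF _ L2_cmult[where c = "-1"], of f M g] by simp

lemma L2_integrable_mult_norm: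
  assumes "f \<in> L2 M" "g \<in> L2 M" shows "integrable M (\<lambda>x. norm (f x) * norm (g x))"
proof (rule Bochner_Integration.integrable_bound)
  have m [measurable]: "f \<in> borel_measurable M" "g \<in> borel_measurable M" using assms by (auto dest: L2_measurable)
  show "integrable M (\<lambda>x. (norm (f x))\<^sup>2 + (norm (g x))\<^sup>2)" using assms[THEN L2_integrable] by simp
  show "(\<lambda>x. norm (f x) * norm (g x)) \<in> borel_measurable M" by measurable
  have "2 * (norm (f x) * norm (g x)) \<le> (norm (f x))\<^sup>2 + (norm (g x))\<^sup>2" for x
    using sum_squares_bound[of "norm (f x)" "norm (g x)"] by simp
  moreover have "0 \<le> norm (f x) * norm (g x)" for x by simp
  ultimately have "norm (f x) * norm (g x) \<le> (norm (f x))\<^sup>2 + (norm (g x))\<^sup>2" for x by (smt (verit))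
  then show "AE x in M. norm (norm (f x) * norm (g x)) \<le> norm ((norm (f x))\<^sup>2 + (norm (g x))\<^sup>2)" by simp
qed

lemma L2_integrable_mult:
  assumes "f \<in> L2 M" "g \<in> L2 M" shows "integrable M (\<lambda>x. f x * g x)"
proof (rule Bochner_Integration.integrable_bound[OF L2_integrable_mult_norm[OF assms]])
  show "(\<lambda>x. f x * g x) \<in> borel_measurable M"
    using assms[THEN L2_measurable] by measurable
qed (simp add: norm_mult)

section \<open>Cauchy-Schwarz and duality\<close>

lemma quadratic_nonneg_discriminant:
  fixes F G X :: real
  assumes q: "\<And>s. 0 \<le> s\<^sup>2 * F - 2 * s * X + G" and "0 \<le> F"
  shows "X\<^sup>2 \<le> F * G"
proof (cases "F = 0")
  case True
  have "X = 0"
  proof (rule ccontr)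
    assume "X \<noteq> 0"
    \<comment> \<open>Without a quadratic term, this choice makes the expression equal to
      \<open>-1\<close>.\<close>
    then show False using q[of "(G + 1) / (2 * X)"] True by (simp add: field_simps)
  qed
  then show ?thesis using True by simp
next
  case False
  have "(X / F)\<^sup>2 * F - 2 * (X / F) * X + G = G - X\<^sup>2 / F"
    using False by (simp add: power2_eq_square)
  then have "X\<^sup>2 / F \<le> G" using q[of "X / F"] by simp
  then show ?thesis using False \<open>0 \<le> F\<close> by (simp add: pos_divide_le_eq mult.commute)
qed

lemma L2_cauchy_schwarz:
  assumes "f \<in> L2 M" "g \<in> L2 M"
  shows "(LINT x|M. norm (f x) * norm (g x)) \<le> L2_norm M f * L2_norm M g"
proof -
  let ?X = "LINT x|M. norm (f x) * norm (g x)"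
  let ?F = "LINT x|M. (norm (f x))\<^sup>2" and ?G = "LINT x|M. (norm (g x))\<^sup>2"
  note i = assms[THEN L2_integrable] L2_integrable_mult_norm[OF assms]
  have q: "0 \<le> s\<^sup>2 * ?F - 2 * s * ?X + ?G" for s
  proof -
    have "0 \<le> (LINT x|M. (s * norm (f x) - norm (g x))\<^sup>2)" by simp
    also have "\<dots> = (LINT x|M. s\<^sup>2 * (norm (f x))\<^sup>2 - 2 * s * (norm (f x) * norm (g x)) + (norm (g x))\<^sup>2)"
      by (rule Bochner_Integration.integral_cong) (auto simp: power2_diff power_mult_distrib algebra_simps)
    also have "\<dots> = s\<^sup>2 * ?F - 2 * s * ?X + ?G" using i by simp
    finally show ?thesis .
  qed
  have "?X\<^sup>2 \<le> ?F * ?G" by (rule quadratic_nonneg_discriminant[OF q]) simp_all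
  then have "?X\<^sup>2 \<le> (L2_norm M f * L2_norm M g)\<^sup>2" by (simp add: power_mult_distrib L2_norm_square)
  then show ?thesis by (rule power2_le_imp_le) simp
qed

lemma norm_pairing_le:
  assumes "f \<in> L2 M" "g \<in> L2 M"
  shows "norm (pairing M f g) \<le> L2_norm M f * L2_norm M g"
proof -
  have "norm (pairing M f g) \<le> (LINT x|M. norm (f x * g x))"
    unfolding pairing_def by (rule integral_norm_bound)
  also have "\<dots> \<le> L2_norm M f * L2_norm M g" using L2_cauchy_schwarz[OF assms] by (simp add: norm_mult)
  finally show ?thesis .
qed

lemma L2_norm_triangle:
  assumes "f \<in> L2 M" "g \<in> L2 M"
  shows "L2_norm M (\<lambda>x. f x + g x) \<le> L2_norm M f + L2_norm M g"
proof (rule power2_le_imp_le)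
  note i = assms[THEN L2_integrable] L2_integrable_mult_norm[OF assms]
  have "(L2_norm M (\<lambda>x. f x + g x))\<^sup>2 = (LINT x|M. (norm (f x + g x))\<^sup>2)" by (rule L2_norm_square)
  also have "\<dots> \<le> (LINT x|M. (norm (f x))\<^sup>2 + 2 * (norm (f x) * norm (g x)) + (norm (g x))\<^sup>2)"
  proof (rule integral_mono)
    show "integrable M (\<lambda>x. (norm (f x + g x))\<^sup>2)" by (rule L2_integrable[OF L2_add[OF assms]])
    show "integrable M (\<lambda>x. (norm (f x))\<^sup>2 + 2 * (norm (f x) * norm (g x)) + (norm (g x))\<^sup>2)" using i by simp
    fix x
    have "(norm (f x + g x))\<^sup>2 \<le> (norm (f x) + norm (g x))\<^sup>2" by (intro power_mono norm_triangle_ineq) auto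
    then show "(norm (f x + g x))\<^sup>2 \<le> (norm (f x))\<^sup>2 + 2 * (norm (f x) * norm (g x)) + (norm (g x))\<^sup>2"
      by (simp add: power2_sum algebra_simps)
  qed
  also have "\<dots> = (L2_norm M f)\<^sup>2 + 2 * (LINT x|M. norm (f x) * norm (g x)) + (L2_norm M g)\<^sup>2"
    using i by (simp add: L2_norm_square)
  also have "\<dots> \<le> (L2_norm M f + L2_norm M g)\<^sup>2"
    using L2_cauchy_schwarz[OF assms] by (simp add: power2_sum)
  finally show "(L2_norm M (\<lambda>x. f x + g x))\<^sup>2 \<le> (L2_norm M f + L2_norm M g)\<^sup>2" .
qed simp

lemma L2_norm_cnj: "L2_norm M (\<lambda>x. cnj (f x)) = L2_norm M f"
  by (simp add: L2_norm_def)

text \<open>The norm is attained by pairing with the conjugate of \<open>\<phi>\<close>, the pairing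
  being bilinear. Approximating that conjugate from \<open>A\<close> gives
  \<open>N\<^sup>2 \<le> C * N\<close> up to an arbitrarily small error, where \<open>N\<close> is
  the norm of \<open>\<phi>\<close>.\<close>

lemma L2_norm_le_dual:
  assumes \<phi>: "\<phi> \<in> L2 M" and A: "A \<subseteq> L2 M" and "0 \<le> C"
    and dense: "\<And>f \<epsilon>. f \<in> L2 M \<Longrightarrow> 0 < \<epsilon> \<Longrightarrow> \<exists>u\<in>A. L2_norm M (\<lambda>x. f x - u x) < \<epsilon>"
    and bound: "\<And>u. u \<in> A \<Longrightarrow> norm (pairing M \<phi> u) \<le> C * L2_norm M u"
  shows "L2_norm M \<phi> \<le> C"
proof -
  let ?N = "L2_norm M \<phi>" and ?\<psi> = "\<lambda>x. cnj (\<phi> x)"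
  have \<psi>: "?\<psi> \<in> L2 M" by (rule L2_cnj[OF \<phi>])
  have "?N\<^sup>2 \<le> C * ?N + \<epsilon> * (C + ?N)" if e: "0 < \<epsilon>" for \<epsilon>
  proof -
    obtain u where u: "u \<in> A" "L2_norm M (\<lambda>x. ?\<psi> x - u x) < \<epsilon>" using dense[OF \<psi> e] by blast
    have uL: "u \<in> L2 M" using u(1) A by blast
    have dL: "(\<lambda>x. ?\<psi> x - u x) \<in> L2 M" by (rule L2_diff[OF \<psi> uL])
    have "complex_of_real (?N\<^sup>2) = (LINT x|M. complex_of_real ((norm (\<phi> x))\<^sup>2))"
      by (simp only: L2_norm_square integral_complex_of_real)
    also have "\<dots> = (LINT x|M. \<phi> x * u x + \<phi> x * (?\<psi> x - u x))"
      by (rule Bochner_Integration.integral_cong) (simp_all add: algebra_simps complex_norm_square del: of_real_power)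
    also have "\<dots> = pairing M \<phi> u + pairing M \<phi> (\<lambda>x. ?\<psi> x - u x)"
      unfolding pairing_def by (rule Bochner_Integration.integral_add[OF L2_integrable_mult[OF \<phi> uL] L2_integrable_mult[OF \<phi> dL]])
    finally have "?N\<^sup>2 = Re (pairing M \<phi> u + pairing M \<phi> (\<lambda>x. ?\<psi> x - u x))"
      by (metis Re_complex_of_real)
    also have "\<dots> \<le> norm (pairing M \<phi> u) + norm (pairing M \<phi> (\<lambda>x. ?\<psi> x - u x))"
      by (rule order_trans[OF complex_Re_le_cmod norm_triangle_ineq])
    also have "\<dots> \<le> C * L2_norm M u + ?N * \<epsilon>"
    proof (rule add_mono[OF bound[OF u(1)]])
      have "?N * L2_norm M (\<lambda>x. ?\<psi> x - u x) \<le> ?N * \<epsilon>" using u(2) by (intro mult_left_mono) auto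
      then show "norm (pairing M \<phi> (\<lambda>x. ?\<psi> x - u x)) \<le> ?N * \<epsilon>"
        using norm_pairing_le[OF \<phi> dL] by linarith
    qed
    also have "\<dots> \<le> C * (?N + \<epsilon>) + ?N * \<epsilon>"
    proof (intro add_right_mono mult_left_mono)
      have "L2_norm M (\<lambda>x. ?\<psi> x + (-1) * (?\<psi> x - u x)) \<le> L2_norm M ?\<psi> + L2_norm M (\<lambda>x. (-1) * (?\<psi> x - u x))"
        by (rule L2_norm_triangle[OF \<psi> L2_cmult[OF dL]])
      moreover have "L2_norm M (\<lambda>x. (-1) * (?\<psi> x - u x)) = L2_norm M (\<lambda>x. ?\<psi> x - u x)"
        by (simp add: L2_norm_def norm_minus_commute)
      ultimately show "L2_norm M u \<le> ?N + \<epsilon>" using u(2) by (simp add: L2_norm_cnj)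
    qed (rule \<open>0 \<le> C\<close>)
    finally show ?thesis by (simp add: algebra_simps)
  qed
  then have le: "?N\<^sup>2 \<le> C * ?N + \<epsilon> * (C + ?N)" if "0 < \<epsilon>" for \<epsilon> using that by blast
  have "?N * ?N \<le> C * ?N"
  proof (rule field_le_epsilon)
    fix e :: real assume e: "0 < e"
    have pos: "0 < C + ?N + 1" using \<open>0 \<le> C\<close> by (simp add: add_nonneg_pos)
    have "?N\<^sup>2 \<le> C * ?N + e / (C + ?N + 1) * (C + ?N)" by (rule le) (use e pos in simp)
    also have "e / (C + ?N + 1) * (C + ?N) \<le> e" using e pos by (simp add: field_simps)
    finally show "?N * ?N \<le> C * ?N + e" by (simp add: power2_eq_square)
  qed
  then show ?thesis
    using \<open>0 \<le> C\<close> by (metis L2_norm_nonneg less_eq_real_def mult_right_le_imp_le)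
qed

lemma norm_integral_indicator_square_le:
  assumes f: "f \<in> L2 M" and A: "A \<in> sets M" "emeasure M A < \<infinity>"
  shows "(norm (LINT x|M. indicator A x * f x))\<^sup>2 \<le> measure M A * (LINT x|M. indicator A x * (norm (f x))\<^sup>2)"
proof -
  let ?g = "\<lambda>x. indicator A x * f x" and ?h = "indicator A :: _ \<Rightarrow> complex"
  have m: "f \<in> borel_measurable M" by (rule L2_measurable[OF f])
  have sq: "(norm (indicator A x :: complex))\<^sup>2 = indicator A x" for x by (simp add: indicator_def)
  have h: "?h \<in> L2 M" using A by (simp add: L2_def sq)
  have g: "?g \<in> L2 M" by (rule L2_bound[OF f, where c = 1]) (use A m in \<open>auto simp: indicator_def\<close>)
  have "(LINT x|M. indicator A x * f x) = pairing M ?h ?g"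
    unfolding pairing_def by (rule Bochner_Integration.integral_cong) (auto simp: indicator_def)
  then have "norm (LINT x|M. indicator A x * f x) \<le> L2_norm M ?h * L2_norm M ?g"
    using norm_pairing_le[OF h g] by simp
  then have "(norm (LINT x|M. indicator A x * f x))\<^sup>2 \<le> (L2_norm M ?h * L2_norm M ?g)\<^sup>2"
    by (intro power_mono) auto
  also have "\<dots> = measure M A * (LINT x|M. indicator A x * (norm (f x))\<^sup>2)"
    unfolding power_mult_distrib L2_norm_square sq norm_mult using A sets.sets_into_space[OF A(1)]
    by (simp add: Int_absorb2)
  finally show ?thesis .
qed

text \<open>The mesh \<open>2 ^ - j\<close> of the box \<open>[- 2 ^ j, 2 ^ j)\<close> in each coordinate, indexed from the lower corner of
  the box. Refining the mesh and enlarging the box together makes the step functions nested.\<close>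

definition grid :: "nat \<Rightarrow> 'a::euclidean_space \<Rightarrow> 'a \<Rightarrow> int" where
  "grid j x b = \<lfloor>(x \<bullet> b + 2 ^ j) * 2 ^ j\<rfloor>"

definition grid_cell :: "nat \<Rightarrow> ('a::euclidean_space \<Rightarrow> int) \<Rightarrow> 'a set" where
  "grid_cell j p = {x. \<forall>b\<in>Basis. grid j x b = p b}"

definition grid_box :: "nat \<Rightarrow> 'a::euclidean_space set" where
  "grid_box j = {x. \<forall>b\<in>Basis. - (2 ^ j) \<le> x \<bullet> b \<and> x \<bullet> b < 2 ^ j}"

text \<open>A side of length \<open>2 * 2 ^ j\<close> divided into pieces of length
  \<open>2 ^ - j\<close> has \<open>2 ^ (2 * j + 1)\<close> of them.\<close>

definition grid_index :: "nat \<Rightarrow> ('a::euclidean_space \<Rightarrow> int) set" where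
  "grid_index j = PiE Basis (\<lambda>_. {0..<2 ^ (2 * j + 1)})"

definition step :: "nat \<Rightarrow> ('a::euclidean_space \<Rightarrow> complex) \<Rightarrow> bool" where
  "step j f \<longleftrightarrow> (\<forall>x y. (\<forall>b\<in>Basis. grid j x b = grid j y b) \<longrightarrow> f x = f y) \<and> (\<forall>x. x \<notin> grid_box j \<longrightarrow> f x = 0)"

lemma grid_eq_iff:
  "grid j x b = i \<longleftrightarrow> of_int i / 2 ^ j - 2 ^ j \<le> x \<bullet> b \<and> x \<bullet> b < (of_int i + 1) / 2 ^ j - 2 ^ j"
  unfolding grid_def floor_eq_iff by (simp add: field_simps)

text \<open>Passing to \<open>Suc j\<close> doubles the indices and also moves the lower corner of
  the box; the offset \<open>2 ^ (2 * j)\<close> accounts for the move. Hence each finer index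
  determines the coarser one.\<close>

lemma grid_Suc_eq: "grid j x b = grid (Suc j) x b div 2 - 2 ^ (2 * j)"
proof -
  have "grid (Suc j) x b div 2 = \<lfloor>(x \<bullet> b + 2 ^ Suc j) * 2 ^ Suc j / real_of_int 2\<rfloor>"
    unfolding grid_def by (rule floor_divide_real_eq_div[symmetric]) simp
  also have "(x \<bullet> b + 2 ^ Suc j) * 2 ^ Suc j / real_of_int 2 = (x \<bullet> b + 2 ^ j) * 2 ^ j + of_int (2 ^ (2 * j))"
  proof -
    have "(y + 2 * t) * (2 * t) / 2 = (y + t) * t + t * t" for y t :: real by (simp add: algebra_simps)
    moreover have "real_of_int (2 ^ (2 * j)) = 2 ^ j * 2 ^ j"
      by (simp only: of_int_power of_int_mult of_int_add of_int_numeral mult_2 power_add)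
    ultimately show ?thesis by (simp only: power_Suc of_int_numeral)
  qed
  also have "\<lfloor>\<dots>\<rfloor> = grid j x b + 2 ^ (2 * j)" unfolding grid_def by (rule floor_add_int[symmetric])
  finally show ?thesis by simp
qed

lemma grid_mono: "i \<le> j \<Longrightarrow> grid j x b = grid j y b \<Longrightarrow> grid i x b = grid i y b"
proof (induction j rule: dec_induct)
  case (step n)
  have "grid n x b = grid n y b" unfolding grid_Suc_eq[of n] step.prems ..
  then show ?case by (rule step.IH)
qed

lemma grid_box_mono: "i \<le> j \<Longrightarrow> grid_box i \<subseteq> grid_box j"
proof -
  assume "i \<le> j"
  then have "(2::real) ^ i \<le> 2 ^ j" by (intro power_increasing) auto
  then have "- (2 ^ j) \<le> t \<and> t < 2 ^ j" if "- (2 ^ i) \<le> t \<and> t < 2 ^ i" for t :: real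
    using that by linarith
  then show ?thesis unfolding grid_box_def by blast
qed

lemma step_mono: "step i f \<Longrightarrow> i \<le> j \<Longrightarrow> step j f"
  unfolding step_def using grid_mono grid_box_mono by blast

lemma step_add: "step j f \<Longrightarrow> step j g \<Longrightarrow> step j (\<lambda>x. f x + g x)"
  unfolding step_def by (metis add_0)

lemma step_cmult: "step j f \<Longrightarrow> step j (\<lambda>x. c * f x)"
  unfolding step_def by (metis mult_zero_right)

lemma grid_box_iff: "x \<in> grid_box j \<longleftrightarrow> (\<forall>b\<in>Basis. 0 \<le> grid j x b \<and> grid j x b < 2 ^ (2 * j + 1))"
proof -
  have "0 \<le> grid j x b \<longleftrightarrow> - (2 ^ j) \<le> x \<bullet> b" for b
  proof -
    have "0 \<le> grid j x b \<longleftrightarrow> 0 * 2 ^ j \<le> (x \<bullet> b + 2 ^ j) * 2 ^ j"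
      by (simp add: grid_def zero_le_floor)
    also have "\<dots> \<longleftrightarrow> - (2 ^ j) \<le> x \<bullet> b" by (subst mult_le_cancel_right_pos) auto
    finally show ?thesis .
  qed
  moreover have "grid j x b < 2 ^ (2 * j + 1) \<longleftrightarrow> x \<bullet> b < 2 ^ j" for b
  proof -
    have "grid j x b < 2 ^ (2 * j + 1) \<longleftrightarrow> (x \<bullet> b + 2 ^ j) * 2 ^ j < (2 ^ j + 2 ^ j) * 2 ^ j"
    proof -
      have "real_of_int (2 ^ (2 * j + 1)) = (2 ^ j + 2 ^ j) * 2 ^ j"
        by (simp only: of_int_power of_int_mult of_int_add of_int_numeral mult_2 power_add power_one_right distrib_right distrib_left mult_1)
      then show ?thesis by (simp only: grid_def floor_less_iff)
    qed
    also have "\<dots> \<longleftrightarrow> x \<bullet> b < 2 ^ j" by (subst mult_less_cancel_right_pos) auto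
    finally show ?thesis .
  qed
  ultimately show ?thesis by (simp add: grid_box_def)
qed

lemma grid_cell_altdef: "grid_cell j p = {x. \<forall>b\<in>Basis.
    of_int (p b) / 2 ^ j - 2 ^ j \<le> x \<bullet> b \<and> x \<bullet> b < (of_int (p b) + 1) / 2 ^ j - 2 ^ j}"
  by (simp add: grid_cell_def grid_eq_iff)

lemma borel_half_open_box:
  "{x::'a::euclidean_space. \<forall>b\<in>Basis. l b \<le> x \<bullet> b \<and> x \<bullet> b < u b} \<in> sets borel"
proof -
  have "{x::'a. \<forall>b\<in>Basis. l b \<le> x \<bullet> b \<and> x \<bullet> b < u b} = (\<Inter>b\<in>Basis. {x. l b \<le> x \<bullet> b} \<inter> {x. x \<bullet> b < u b})" by auto
  also have "\<dots> \<in> sets borel"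
    by (intro sets.finite_INT finite_Basis sets.Int nonempty_Basis
        borel_closed[OF closed_halfspace_component_ge] borel_open[OF open_halfspace_component_lt])
  finally show ?thesis .
qed

lemma borel_grid_cell [measurable]: "grid_cell j p \<in> sets borel"
  unfolding grid_cell_altdef by (rule borel_half_open_box)

lemma borel_grid_box [measurable]: "grid_box j \<in> sets borel"
  unfolding grid_box_def by (rule borel_half_open_box)

lemma norm_less_DIM:
  fixes x :: "'a::euclidean_space" and t :: real
  assumes "\<And>b. b \<in> Basis \<Longrightarrow> \<bar>x \<bullet> b\<bar> < t"
  shows "norm x < DIM('a) * t"
proof -
  have "norm x \<le> (\<Sum>b\<in>Basis. \<bar>x \<bullet> b\<bar>)" by (rule norm_le_l1)
  also have "\<dots> < (\<Sum>b\<in>(Basis::'a set). t)" by (rule sum_strict_mono) (use assms in auto)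
  finally show ?thesis by simp
qed

lemma grid_box_subset_ball: "(grid_box j :: 'a::euclidean_space set) \<subseteq> ball 0 (DIM('a) * (2 * 2 ^ j))"
proof
  fix x :: 'a assume "x \<in> grid_box j"
  then have "\<bar>x \<bullet> b\<bar> < 2 * 2 ^ j" if "b \<in> Basis" for b
  proof -
    have "- (2 ^ j) \<le> x \<bullet> b \<and> x \<bullet> b < 2 ^ j" using \<open>x \<in> grid_box j\<close> that by (simp add: grid_box_def)
    moreover have "(0::real) < 2 ^ j" by simp
    ultimately show ?thesis by linarith
  qed
  then show "x \<in> ball 0 (DIM('a) * (2 * 2 ^ j))" using norm_less_DIM[of x] by simp
qed

lemma grid_same_cell_dist:
  fixes x y :: "'a::euclidean_space"
  assumes "\<And>b. b \<in> Basis \<Longrightarrow> grid j x b = grid j y b"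
  shows "dist x y < DIM('a) * (1 / 2 ^ j)"
  unfolding dist_norm
proof (rule norm_less_DIM[of "x - y"])
  fix b :: 'a assume "b \<in> Basis"
  then have "grid j x b = grid j y b" by (rule assms)
  then have x: "of_int (grid j y b) / 2 ^ j - 2 ^ j \<le> x \<bullet> b" "x \<bullet> b < (of_int (grid j y b) + 1) / 2 ^ j - 2 ^ j"
    using grid_eq_iff[of j x b "grid j y b"] by auto
  have y: "of_int (grid j y b) / 2 ^ j - 2 ^ j \<le> y \<bullet> b" "y \<bullet> b < (of_int (grid j y b) + 1) / 2 ^ j - 2 ^ j"
    using grid_eq_iff[of j y b "grid j y b"] by auto
  show "\<bar>(x - y) \<bullet> b\<bar> < 1 / 2 ^ j"
    using x y by (simp add: inner_diff_left add_divide_distrib abs_less_iff)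
qed

lemma finite_grid_index: "finite (grid_index j)"
  unfolding grid_index_def by (intro finite_PiE) auto

definition corner :: "nat \<Rightarrow> ('a::euclidean_space \<Rightarrow> int) \<Rightarrow> 'a" where
  "corner j p = (\<Sum>b\<in>Basis. (of_int (p b) / 2 ^ j - 2 ^ j) *\<^sub>R b)"

lemma corner_inner: "b \<in> Basis \<Longrightarrow> corner j p \<bullet> b = of_int (p b) / 2 ^ j - 2 ^ j"
  by (simp add: corner_def)

lemma corner_in_cell: "corner j p \<in> grid_cell j p"
  unfolding grid_cell_altdef using corner_inner[of _ j p] by (auto simp: divide_strict_right_mono)

lemma grid_cell_disjoint:
  fixes p q :: "'a::euclidean_space \<Rightarrow> int"
  assumes "p \<in> extensional Basis" "q \<in> extensional Basis" "x \<in> grid_cell j p" "x \<in> grid_cell j q"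
  shows "p = q"
proof (rule extensionalityI[OF assms(1,2)])
  fix b :: 'a assume "b \<in> Basis"
  then have "grid j x b = p b" "grid j x b = q b" using assms(3,4) unfolding grid_cell_def by blast+
  then show "p b = q b" by (rule subst)
qed

lemma step_sum_cells:
  fixes f :: "'a::euclidean_space \<Rightarrow> complex"
  assumes f: "step j f"
  shows "f x = (\<Sum>p\<in>grid_index j. f (corner j p) * indicator (grid_cell j p) x)"
proof (cases "x \<in> grid_box j")
  case True
  let ?p = "restrict (grid j x) Basis"
  have p: "?p \<in> grid_index j" using True by (simp add: grid_index_def grid_box_iff)
  have x: "x \<in> grid_cell j ?p" by (simp add: grid_cell_def)
  have "(\<Sum>p\<in>grid_index j. f (corner j p) * indicator (grid_cell j p) x)
      = (\<Sum>p\<in>grid_index j. if p = ?p then f (corner j p) else 0)"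
  proof (rule sum.cong)
    fix q :: "'a \<Rightarrow> int" assume "q \<in> grid_index j"
    then have "q \<in> extensional Basis" by (auto simp: grid_index_def PiE_def)
    then have "x \<in> grid_cell j q \<longleftrightarrow> q = ?p"
      using x grid_cell_disjoint[of q ?p x j] by auto
    then show "f (corner j q) * indicator (grid_cell j q) x = (if q = ?p then f (corner j q) else 0)"
      by (cases "q = ?p") simp_all
  qed simp
  also have "\<dots> = f (corner j ?p)"
    by (subst sum.delta) (use p in \<open>simp_all add: finite_grid_index\<close>)
  also have "\<dots> = f x"
    using f corner_in_cell[of j ?p] unfolding step_def grid_cell_def by auto
  finally show ?thesis by simp
next
  case False
  have "indicator (grid_cell j p) x = (0::complex)" if "p \<in> grid_index j" for p
  proof -
    have "x \<notin> grid_cell j p"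
    proof
      assume "x \<in> grid_cell j p"
      then have "\<forall>b\<in>Basis. 0 \<le> grid j x b \<and> grid j x b < 2 ^ (2 * j + 1)"
        using that unfolding grid_cell_def grid_index_def by (simp add: PiE_iff)
      then show False using False grid_box_iff by blast
    qed
    then show ?thesis by simp
  qed
  then show ?thesis using False f by (simp add: step_def)
qed

section \<open>Density of step functions\<close>

locale locally_finite =
  fixes M :: "'a::euclidean_space measure"
  assumes sets_M: "sets M = sets borel"
    and finite_ball: "emeasure M (ball x \<rho>) < \<infinity>"
begin

lemma space_M: "space M = UNIV"
  using sets_eq_imp_space_eq[OF sets_M] by simp

lemma finite_subset_ball:
  assumes "A \<subseteq> ball x \<rho>" shows "emeasure M A < \<infinity>"
proof -
  have "emeasure M A \<le> emeasure M (ball x \<rho>)" using assms by (intro emeasure_mono) (auto simp: sets_M)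
  then show ?thesis using finite_ball[of x \<rho>] by (rule le_less_trans)
qed

lemma finite_grid_box: "emeasure M (grid_box j) < \<infinity>"
  by (rule finite_subset_ball[OF grid_box_subset_ball])

lemma finite_grid_cell: "emeasure M (grid_cell j p) < \<infinity>"
proof -
  have "dist (corner j p) x < DIM('a) * (1 / 2 ^ j)" if "x \<in> grid_cell j p" for x
    using that corner_in_cell[of j p] by (intro grid_same_cell_dist) (auto simp: grid_cell_def)
  then show ?thesis by (intro finite_subset_ball[of _ "corner j p" "DIM('a) * (1 / 2 ^ j)"]) auto
qed

lemma indicator_L2:
  assumes "A \<in> sets borel" "emeasure M A < \<infinity>" shows "(indicator A :: 'a \<Rightarrow> complex) \<in> L2 M"
proof -
  have sq: "(norm (indicator A x :: complex))\<^sup>2 = indicator A x" for x by (simp add: indicator_def)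
  have "A \<in> sets M" using assms(1) by (simp add: sets_M)
  then show ?thesis unfolding L2_def sq mem_Collect_eq
    using assms(2) by (intro conjI borel_measurable_indicator integrable_real_indicator)
qed

lemma L2_sum: "(\<And>i. i \<in> I \<Longrightarrow> f i \<in> L2 M) \<Longrightarrow> (\<lambda>x. \<Sum>i\<in>I. f i x) \<in> L2 M"
proof (induction I rule: infinite_finite_induct)
  case (insert i I)
  then show ?case using L2_add[of "f i" M "\<lambda>x. \<Sum>i\<in>I. f i x"] by simp
qed (simp_all add: L2_def)

lemma step_L2:
  assumes "step j f" shows "f \<in> L2 M"
proof -
  have "f = (\<lambda>x. \<Sum>p\<in>grid_index j. f (corner j p) * indicator (grid_cell j p) x)"
    using step_sum_cells[OF assms] by blast
  also have "\<dots> \<in> L2 M"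
    by (intro L2_sum L2_cmult indicator_L2 borel_grid_cell finite_grid_cell)
  finally show ?thesis .
qed

definition approximable :: "('a \<Rightarrow> complex) \<Rightarrow> bool" where
  "approximable f \<longleftrightarrow> f \<in> L2 M \<and> (\<forall>\<epsilon>>0. \<exists>j u. step j u \<and> L2_norm M (\<lambda>x. f x - u x) < \<epsilon>)"

lemma approximableD: "approximable f \<Longrightarrow> 0 < \<epsilon> \<Longrightarrow> \<exists>j u. step j u \<and> L2_norm M (\<lambda>x. f x - u x) < \<epsilon>"
  by (simp add: approximable_def)

lemma approximable_add:
  assumes "approximable f" "approximable g" shows "approximable (\<lambda>x. f x + g x)"
  unfolding approximable_def
proof (intro conjI allI impI)
  have fg: "f \<in> L2 M" "g \<in> L2 M" using assms by (auto simp: approximable_def)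
  then show "(\<lambda>x. f x + g x) \<in> L2 M" by (rule L2_add)
  fix \<epsilon> :: real assume "0 < \<epsilon>"
  then obtain i u j v where u: "step i u" "L2_norm M (\<lambda>x. f x - u x) < \<epsilon> / 2"
    and v: "step j v" "L2_norm M (\<lambda>x. g x - v x) < \<epsilon> / 2"
    using assms[THEN approximableD, of "\<epsilon> / 2"] by auto
  have s: "step (max i j) (\<lambda>x. u x + v x)"
    by (intro step_add step_mono[OF u(1)] step_mono[OF v(1)]) auto
  have "L2_norm M (\<lambda>x. (f x - u x) + (g x - v x)) \<le> L2_norm M (\<lambda>x. f x - u x) + L2_norm M (\<lambda>x. g x - v x)"
    by (intro L2_norm_triangle L2_diff fg step_L2[OF u(1)] step_L2[OF v(1)])
  then have "L2_norm M (\<lambda>x. (f x + g x) - (u x + v x)) < \<epsilon>" using u v by (simp add: algebra_simps)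
  then show "\<exists>j w. step j w \<and> L2_norm M (\<lambda>x. (f x + g x) - w x) < \<epsilon>" using s by blast
qed

lemma L2_norm_cmult: "L2_norm M (\<lambda>x. c * f x) = norm c * L2_norm M f"
  by (simp add: L2_norm_def norm_mult power_mult_distrib real_sqrt_mult)

lemma approximable_cmult:
  assumes "approximable f" shows "approximable (\<lambda>x. c * f x)"
  unfolding approximable_def
proof (intro conjI allI impI)
  show "(\<lambda>x. c * f x) \<in> L2 M" using assms by (auto simp: approximable_def intro: L2_cmult)
  fix \<epsilon> :: real assume "0 < \<epsilon>"
  then have "0 < \<epsilon> / (norm c + 1)" by (simp add: add_nonneg_pos)
  then obtain j u where u: "step j u" "L2_norm M (\<lambda>x. f x - u x) < \<epsilon> / (norm c + 1)"
    using approximableD[OF assms] by blast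
  have "L2_norm M (\<lambda>x. c * f x - c * u x) = norm c * L2_norm M (\<lambda>x. f x - u x)"
    using L2_norm_cmult[of c "\<lambda>x. f x - u x"] by (simp add: algebra_simps)
  also have "\<dots> \<le> (norm c + 1) * L2_norm M (\<lambda>x. f x - u x)" by (intro mult_right_mono) auto
  also have "\<dots> < (norm c + 1) * (\<epsilon> / (norm c + 1))"
    using u(2) by (intro mult_strict_left_mono) (auto simp: add_nonneg_pos)
  also have "\<dots> = \<epsilon>" using add_nonneg_pos[OF norm_ge_zero[of c] zero_less_one] by simp
  finally show "\<exists>j v. step j v \<and> L2_norm M (\<lambda>x. c * f x - v x) < \<epsilon>"
    using step_cmult[OF u(1)] by blast
qed

lemma approximable_sum: "(\<And>i. i \<in> I \<Longrightarrow> approximable (f i)) \<Longrightarrow> approximable (\<lambda>x. \<Sum>i\<in>I. f i x)"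
proof (induction I rule: infinite_finite_induct)
  case (insert i I)
  then show ?case using approximable_add[of "f i" "\<lambda>x. \<Sum>i\<in>I. f i x"] by simp
qed (auto simp: approximable_def L2_def step_def L2_norm_def intro!: exI[of _ "\<lambda>_. 0"])

lemma approximable_closure:
  assumes f: "f \<in> L2 M" and "\<And>\<epsilon>. 0 < \<epsilon> \<Longrightarrow> \<exists>g. approximable g \<and> L2_norm M (\<lambda>x. f x - g x) < \<epsilon>"
  shows "approximable f"
  unfolding approximable_def
proof (intro conjI allI impI f)
  fix \<epsilon> :: real assume "0 < \<epsilon>"
  then obtain g where g: "approximable g" "L2_norm M (\<lambda>x. f x - g x) < \<epsilon> / 2" using assms(2)[of "\<epsilon> / 2"] by auto
  then obtain j u where u: "step j u" "L2_norm M (\<lambda>x. g x - u x) < \<epsilon> / 2"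
    using approximableD[OF g(1), of "\<epsilon> / 2"] \<open>0 < \<epsilon>\<close> by auto
  have gL: "g \<in> L2 M" using g(1) by (simp add: approximable_def)
  have "L2_norm M (\<lambda>x. (f x - g x) + (g x - u x)) \<le> L2_norm M (\<lambda>x. f x - g x) + L2_norm M (\<lambda>x. g x - u x)"
    by (intro L2_norm_triangle L2_diff f gL step_L2[OF u(1)])
  then have "L2_norm M (\<lambda>x. f x - u x) < \<epsilon>" using g u by simp
  then show "\<exists>j u. step j u \<and> L2_norm M (\<lambda>x. f x - u x) < \<epsilon>" using u(1) by blast
qed

text \<open>Enclose the set between a compact \<open>K\<close> and an open \<open>U\<close> of
  nearly equal measure. If the mesh is finer than the distance from \<open>K\<close> to the
  complement of \<open>U\<close>, the cells meeting \<open>K\<close> stay inside \<open>U\<close>,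
  so their union differs from the set only within the part of \<open>U - K\<close> in the
  box.\<close>

lemma approximable_indicator:
  assumes A: "A \<in> sets borel" "A \<subseteq> grid_box i"
  shows "approximable (indicator A)"
  unfolding approximable_def
proof (intro conjI allI impI)
  have "emeasure M A \<le> emeasure M (grid_box i)" using A by (intro emeasure_mono) (auto simp: sets_M)
  then have finA: "emeasure M A < \<infinity>" using finite_grid_box[of i] by (rule le_less_trans)
  then show "indicator A \<in> L2 M" by (rule indicator_L2[OF A(1)])
  fix \<epsilon> :: real assume e: "0 < \<epsilon>"
  \<comment> \<open>Restricting the measure to the box makes it finite, so that inner and outer
    regularity apply.\<close>
  define N where "N = density M (indicator (grid_box i))"
  have sN: "sets N = sets borel" by (simp add: N_def sets_M)
  have N: "emeasure N B = emeasure M (grid_box i \<inter> B)" if "B \<in> sets borel" for B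
    unfolding N_def using that
    by (subst emeasure_density) (auto simp: sets_M simp flip: indicator_inter_arith intro!: borel_measurable_indicator)
  have finN: "emeasure N B < \<infinity>" if "B \<in> sets borel" for B
  proof -
    have "emeasure N B \<le> emeasure M (grid_box i)" unfolding N[OF that] by (intro emeasure_mono) (auto simp: sets_M)
    then show ?thesis using finite_grid_box[of i] by (rule le_less_trans)
  qed
  have spN: "emeasure N (space N) \<noteq> \<infinity>" using finN[of UNIV] sets_eq_imp_space_eq[OF sN] by simp
  interpret N: finite_measure N by (rule finite_measureI) (rule spN)
  let ?d = "ennreal (\<epsilon>\<^sup>2 / 2)"
  have d: "0 < ?d" using e by simp
  obtain K where K: "compact K" "K \<subseteq> A" "emeasure N A < emeasure N K + ?d"
  proof (cases "emeasure N A < ?d")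
    case True then show ?thesis using that[of "{}"] by simp
  next
    case False
    have "emeasure N A - ?d < emeasure N A"
    proof (intro ennreal_between)
      have "?d \<le> emeasure N A" using False by simp
      then show "0 < emeasure N A" using d by (rule less_le_trans[rotated])
    qed (use d finN[OF A(1)] in auto)
    also have "\<dots> = (SUP K \<in> {K. K \<subseteq> A \<and> compact K}. emeasure N K)" by (rule inner_regular[OF sN spN A(1)])
    finally obtain K where K: "K \<subseteq> A" "compact K" "emeasure N A - ?d < emeasure N K" by (auto simp: less_SUP_iff)
    have "emeasure N A < emeasure N K + ?d"
      using K(3) False by (simp add: minus_less_iff_ennreal add.commute)
    then show ?thesis using that K by blast
  qed
  obtain U where U: "open U" "A \<subseteq> U" "emeasure N U < emeasure N A + ?d"
  proof -
    have "(INF U \<in> {U. A \<subseteq> U \<and> open U}. emeasure N U) < emeasure N A + ?d"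
      unfolding outer_regular[OF sN spN A(1), symmetric] using d finN[OF A(1)] by (simp add: less_top)
    then show ?thesis using that by (auto simp: INF_less_iff)
  qed
  have "\<exists>\<delta>>0. \<forall>x\<in>K. \<forall>y\<in>-U. \<delta> \<le> dist x y"
    by (rule separate_compact_closed) (use K U in auto)
  then obtain \<delta> where \<delta>: "0 < \<delta>" "\<And>x y. x \<in> K \<Longrightarrow> y \<notin> U \<Longrightarrow> \<delta> \<le> dist x y" by auto
  obtain k where k: "DIM('a) / \<delta> < 2 ^ k" using real_arch_pow[of 2 "DIM('a) / \<delta>"] by auto
  define j where "j = max i k"
  have "(2::real) ^ k \<le> 2 ^ j" by (intro power_increasing) (auto simp: j_def)
  then have "\<delta> * 2 ^ k \<le> \<delta> * 2 ^ j" using \<delta>(1) by (intro mult_left_mono) auto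
  moreover have "DIM('a) < \<delta> * 2 ^ k" using k \<delta>(1) by (simp add: field_simps)
  ultimately have "DIM('a) < \<delta> * 2 ^ j" by linarith
  then have j: "DIM('a) * (1 / 2 ^ j) < \<delta>" "i \<le> j" by (simp_all add: pos_divide_less_eq j_def)
  \<comment> \<open>Intersecting with the box confines the error to where \<open>N\<close> sees it.
    As \<open>i \<le> j\<close>, the box is itself a union of cells of mesh \<open>j\<close>, so
    \<open>G\<close> is one too.\<close>
  define G where "G = {x \<in> grid_box i. \<exists>y\<in>K. \<forall>b\<in>Basis. grid j x b = grid j y b}"
  have GU: "G \<subseteq> U"
  proof
    fix x assume "x \<in> G"
    then obtain y where y: "y \<in> K" "\<forall>b\<in>Basis. grid j x b = grid j y b" by (auto simp: G_def)
    then have "dist x y < \<delta>" using grid_same_cell_dist[of j x y] j by force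
    then show "x \<in> U" using \<delta>(2)[OF y(1), of x] by (auto simp: dist_commute)
  qed
  have KG: "K \<subseteq> G" using K A by (auto simp: G_def)
  have stG: "step j (indicator G)"
    unfolding step_def
  proof (intro conjI allI impI)
    fix x y :: 'a assume xy: "\<forall>b\<in>Basis. grid j x b = grid j y b"
    have "grid i x b = grid i y b" if "b \<in> Basis" for b using grid_mono[OF j(2)] xy that by blast
    then have "x \<in> grid_box i \<longleftrightarrow> y \<in> grid_box i" by (simp add: grid_box_iff)
    then have "x \<in> G \<longleftrightarrow> y \<in> G" using xy unfolding G_def by auto
    then show "indicator G x = (indicator G y :: complex)" by (simp add: indicator_def)
  next
    fix x :: 'a assume "x \<notin> grid_box j"
    then show "indicator G x = (0::complex)" using grid_box_mono[OF j(2)] by (auto simp: G_def indicator_def)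
  qed
  have G: "G \<in> sets borel"
  proof -
    have "(indicator G :: 'a \<Rightarrow> complex) \<in> borel_measurable M" by (rule L2_measurable[OF step_L2[OF stG]])
    then show ?thesis by (simp add: borel_measurable_indicator_iff sets_M space_M)
  qed
  define D where "D = grid_box i \<inter> (U - K)"
  have KU: "K \<in> sets borel" "U \<in> sets borel" using K(1) U(1) by (auto intro: borel_closed compact_imp_closed)
  then have D: "D \<in> sets borel" by (auto simp: D_def)
  have mD: "measure M D < \<epsilon>\<^sup>2"
  proof -
    have "emeasure M D = emeasure N (U - K)" using KU by (simp add: N D_def)
    also have "\<dots> = emeasure N U - emeasure N K"
      using KU K(2) U(2) finN[OF KU(1)] by (intro emeasure_Diff) (auto simp: sN)
    also have "\<dots> < ennreal (\<epsilon>\<^sup>2)"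
    proof -
      have "measure N A < measure N K + \<epsilon>\<^sup>2 / 2" "measure N U < measure N A + \<epsilon>\<^sup>2 / 2"
        using K(3) U(3) e by (simp_all add: N.emeasure_eq_measure ennreal_plus[symmetric] ennreal_less_iff del: ennreal_plus)
      then have "measure N U - measure N K < \<epsilon>\<^sup>2" by (simp add: field_simps)
      then show ?thesis using e by (simp add: N.emeasure_eq_measure ennreal_minus ennreal_lessI)
    qed
    finally have "emeasure M D < ennreal (\<epsilon>\<^sup>2)" .
    moreover from this have "emeasure M D = ennreal (measure M D)"
      by (intro emeasure_eq_ennreal_measure) auto
    ultimately show ?thesis by (simp add: ennreal_less_iff)
  qed
  have "L2_norm M (\<lambda>x. indicator A x - indicator G x) \<le> sqrt (measure M D)"
    unfolding L2_norm_def
  proof (rule real_sqrt_le_mono)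
    have "integrable M (indicator D :: 'a \<Rightarrow> real)"
      using D finite_grid_box[of i] emeasure_mono[of D "grid_box i" M]
      by (auto simp: sets_M space_M D_def intro: le_less_trans)
    moreover have "(norm (indicator A x - indicator G x :: complex))\<^sup>2 \<le> indicator D x" for x
    proof (cases "x \<in> D")
      case False
      have "G \<subseteq> grid_box i" by (auto simp: G_def)
      then have "x \<in> A \<longleftrightarrow> x \<in> G" using False A(2) K(2) KG GU U(2) unfolding D_def by blast
      then show ?thesis by (simp add: indicator_def)
    qed (simp add: indicator_def)
    ultimately have "(LINT x|M. (norm (indicator A x - indicator G x :: complex))\<^sup>2) \<le> (LINT x|M. indicator D x)"
      by (intro integral_mono') auto
    then show "(LINT x|M. (norm (indicator A x - indicator G x :: complex))\<^sup>2) \<le> measure M D"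
      by (simp add: space_M)
  qed
  also have "\<dots> < \<epsilon>" using mD e by (simp add: real_less_lsqrt)
  finally show "\<exists>j u. step j u \<and> L2_norm M (\<lambda>x. indicator A x - u x) < \<epsilon>" using stG by blast
qed

text \<open>Simple approximations cut off to growing boxes converge by domination: they are bounded
  by \<open>2 * norm (f x)\<close>, so the squared error is at most nine times the square of
  \<open>norm (f x)\<close>.\<close>

lemma L2_approximable:
  assumes f: "f \<in> L2 M" shows "approximable f"
proof (rule approximable_closure[OF f])
  fix \<epsilon> :: real assume e: "0 < \<epsilon>"
  have fm [measurable]: "f \<in> borel_measurable M" by (rule L2_measurable[OF f])
  obtain s where s: "\<And>i. simple_function M (s i)" "\<And>x. (\<lambda>i. s i x) \<longlonglongrightarrow> f x"
    "\<And>i x. norm (s i x) \<le> 2 * norm (f x)"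
    using borel_measurable_implies_sequence_metric[OF fm, of 0] by (auto simp: space_M)
  define g where "g i x = s i x * indicator (grid_box i) x" for i x
  have gm [measurable]: "g i \<in> borel_measurable M" for i
  proof -
    have "grid_box i \<in> sets M" by (simp add: sets_M borel_grid_box)
    then show ?thesis unfolding g_def using borel_measurable_simple_function[OF s(1)[of i]] by measurable
  qed
  have g_le: "norm (g i x) \<le> 2 * norm (f x)" for i x
    using s(3)[of i x] by (auto simp: g_def indicator_def)
  have lim: "(\<lambda>i. LINT x|M. (norm (f x - g i x))\<^sup>2) \<longlonglongrightarrow> (LINT x|M. (0::real))"
  proof (rule integral_dominated_convergence)
    show "integrable M (\<lambda>x. 9 * (norm (f x))\<^sup>2)" using L2_integrable[OF f] by simp
    show "AE x in M. norm ((norm (f x - g i x))\<^sup>2) \<le> 9 * (norm (f x))\<^sup>2" for i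
    proof (rule AE_I2)
      fix x
      have "norm (f x - g i x) \<le> 3 * norm (f x)" using norm_triangle_ineq4[of "f x" "g i x"] g_le[of i x] by simp
      then have "(norm (f x - g i x))\<^sup>2 \<le> (3 * norm (f x))\<^sup>2" by (intro power_mono) auto
      then show "norm ((norm (f x - g i x))\<^sup>2) \<le> 9 * (norm (f x))\<^sup>2" by (simp add: power_mult_distrib)
    qed
    show "AE x in M. (\<lambda>i. (norm (f x - g i x))\<^sup>2) \<longlonglongrightarrow> 0"
    proof (rule AE_I2)
      fix x :: 'a
      obtain k where k: "norm x < 2 ^ k" using real_arch_pow[of 2 "norm x"] by auto
      have "x \<in> grid_box k"
      proof -
        have "\<bar>x \<bullet> b\<bar> < 2 ^ k" if "b \<in> Basis" for b using Basis_le_norm[OF that, of x] k by simp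
        then show ?thesis by (force simp: grid_box_def abs_less_iff)
      qed
      then have ev: "\<forall>\<^sub>F i in sequentially. s i x = g i x"
        unfolding eventually_sequentially g_def using grid_box_mono by (intro exI[of _ k]) (auto simp: indicator_def)
      have "(\<lambda>i. g i x) \<longlonglongrightarrow> f x" by (rule Lim_transform_eventually[OF s(2) ev])
      then have "(\<lambda>i. (norm (f x - g i x))\<^sup>2) \<longlonglongrightarrow> (norm (f x - f x))\<^sup>2" by (intro tendsto_intros)
      then show "(\<lambda>i. (norm (f x - g i x))\<^sup>2) \<longlonglongrightarrow> 0" by simp
    qed
  qed measurable
  then have "\<forall>\<^sub>F i in sequentially. (LINT x|M. (norm (f x - g i x))\<^sup>2) < \<epsilon>\<^sup>2"
    using e by (intro order_tendstoD(2)[OF lim]) simp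
  then obtain i where i: "(LINT x|M. (norm (f x - g i x))\<^sup>2) < \<epsilon>\<^sup>2" by (auto simp: eventually_sequentially)
  then have "L2_norm M (\<lambda>x. f x - g i x) < \<epsilon>" unfolding L2_norm_def using e by (intro real_less_lsqrt) auto
  moreover have "approximable (g i)"
  proof -
    have fin: "finite (range (s i))" using s(1)[of i] by (simp add: simple_function_def space_M)
    have "g i x = (\<Sum>c\<in>range (s i). c * indicator ({x. s i x = c} \<inter> grid_box i) x)" for x
    proof -
      have "(\<Sum>c\<in>range (s i). c * indicator ({x. s i x = c} \<inter> grid_box i) x)
          = (\<Sum>c\<in>range (s i). if c = s i x then c * indicator (grid_box i) x else 0)"
        by (intro sum.cong) (auto simp: indicator_def)
      also have "\<dots> = g i x" using fin by (simp add: g_def)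
      finally show ?thesis ..
    qed
    then have eq: "g i = (\<lambda>x. \<Sum>c\<in>range (s i). c * indicator ({x. s i x = c} \<inter> grid_box i) x)" by blast
    show ?thesis
      unfolding eq
    proof (intro approximable_sum approximable_cmult approximable_indicator)
      fix c
      have "s i -` {c} \<inter> space M \<in> sets M"
        by (rule simple_functionD(2)[OF s(1)])
      then have "{x. s i x = c} \<in> sets borel" by (simp add: sets_M space_M vimage_def)
      then show "{x. s i x = c} \<inter> grid_box i \<in> sets borel" by simp
    qed auto
  qed
  ultimately show "\<exists>g. approximable g \<and> L2_norm M (\<lambda>x. f x - g x) < \<epsilon>" by blast
qed

end

section \<open>The modulus of continuity and the kernel\<close>

text \<open>On each interval from \<open>(1 / 2) ^ Suc l\<close> to \<open>(1 / 2) ^ l\<close> the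
  integrand is bounded below by a constant; these intervals are disjoint, so the constants times the
  lengths sum to at most the integral.\<close>

lemma modulus_dyadic_sum_le:
  assumes \<omega>: "modulus_of_continuity \<omega>"
    and int: "(\<integral>\<^sup>+ t\<in>{0<..1}. ennreal (\<omega> t * (1 + ln (1 / t)) powr (1 / 2) / t) \<partial>lborel) < \<infinity>"
  obtains S0 where "\<And>L. (\<Sum>l<L. \<omega> ((1 / 2) ^ l) * sqrt (real l + 1)) \<le> S0"
proof -
  let ?F = "\<lambda>t. \<omega> t * (1 + ln (1 / t)) powr (1 / 2) / t"
  let ?I = "\<integral>\<^sup>+ t\<in>{0<..1}. ennreal (?F t) \<partial>lborel"
  have \<omega>_nonneg: "0 \<le> \<omega> t" if "0 \<le> t" for t using \<omega> that by (simp add: modulus_of_continuity_def)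
  have \<omega>_mono: "\<omega> s \<le> \<omega> t" if "0 \<le> s" "s \<le> t" for s t
    using \<omega> that by (auto simp: modulus_of_continuity_def mono_on_def)
  define A where "A l = {(1 / 2) ^ Suc l<..(1 / 2) ^ l :: real}" for l
  \<comment> \<open>The factors bound \<open>\<omega> t\<close>, the root of the logarithmic term
    and \<open>1 / t\<close> from below on \<open>A l\<close>. The second uses
    \<open>(l + 2) / 4 \<le> 1 + ln (1 / t)\<close>. Multiplied by the length of \<open>A l\<close>,
    the powers of two leave one more factor \<open>1 / 2\<close>.\<close>
  define c where "c l = \<omega> ((1 / 2) ^ Suc l) * (sqrt (real l + 2) / 2) * 2 ^ l" for l
  have c_nonneg: "0 \<le> c l" for l by (simp add: c_def \<omega>_nonneg)
  have c_le: "c l \<le> ?F t" if t: "t \<in> A l" for l t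
  proof -
    have t': "0 < t" "t \<le> (1 / 2) ^ l" "(1 / 2) ^ Suc l \<le> t"
      using t zero_less_power[of "1 / 2 :: real" "Suc l"] by (auto simp: A_def intro: less_trans)
    have inv: "2 ^ l \<le> 1 / t" using t' by (simp add: power_one_over field_simps)
    have "real l * ln 2 = ln (2 ^ l)" by (simp add: ln_realpow)
    also have "\<dots> \<le> ln (1 / t)" using inv t' by (intro ln_mono) auto
    finally have ln_l: "real l * ln 2 \<le> ln (1 / t)" .
    have "real l * (1 / 4) \<le> real l * ln 2"
      using ln2_ge_two_thirds by (intro mult_left_mono) auto
    then have "real l * (1 / 4) \<le> ln (1 / t)" using ln_l by (rule order_trans)
    then have lg: "(real l + 2) / 4 \<le> 1 + ln (1 / t)" by simp
    have "sqrt (real l + 2) / 2 = sqrt ((real l + 2) / 4)" by (simp add: real_sqrt_divide)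
    also have "\<dots> \<le> sqrt (1 + ln (1 / t))" by (rule real_sqrt_le_mono[OF lg])
    also have "\<dots> = (1 + ln (1 / t)) powr (1 / 2)" using lg by (simp add: powr_half_sqrt)
    finally have "c l \<le> \<omega> t * (1 + ln (1 / t)) powr (1 / 2) * (1 / t)"
      unfolding c_def using inv t' by (intro mult_mono \<omega>_mono \<omega>_nonneg mult_nonneg_nonneg) auto
    then show ?thesis by simp
  qed
  have part: "(\<Sum>l<L. \<omega> ((1 / 2) ^ Suc l) * sqrt (real l + 2) / 4) \<le> enn2real ?I" for L
  proof -
    have "(\<Sum>l<L. ennreal (c l) * indicator (A l) t) \<le> ennreal (?F t) * indicator {0<..1} t" for t
    proof (cases "\<exists>l<L. t \<in> A l")
      case True
      then obtain l where l: "l < L" "t \<in> A l" by blast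
      have uniq: "k = l" if "t \<in> A k" for k
      proof (rule ccontr)
        assume "k \<noteq> l"
        then consider "Suc k \<le> l" | "Suc l \<le> k" by linarith
        then show False
        proof cases
          case 1
          then have "(1 / 2 :: real) ^ l \<le> (1 / 2) ^ Suc k" by (intro power_decreasing) auto
          then show False using l(2) that by (simp add: A_def)
        next
          case 2
          then have "(1 / 2 :: real) ^ k \<le> (1 / 2) ^ Suc l" by (intro power_decreasing) auto
          then show False using l(2) that by (simp add: A_def)
        qed
      qed
      have "(\<Sum>k<L. ennreal (c k) * indicator (A k) t) = (\<Sum>k<L. if k = l then ennreal (c l) else 0)"
      proof (rule sum.cong)
        fix k
        show "ennreal (c k) * indicator (A k) t = (if k = l then ennreal (c l) else 0)"
        proof (cases "k = l")
          case True
          then show ?thesis using l(2) by simp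
        next
          case False
          then have "t \<notin> A k" using uniq[of k] by blast
          then show ?thesis using False by simp
        qed
      qed simp
      also have "\<dots> = ennreal (c l)" using l(1) by simp
      also have "\<dots> \<le> ennreal (?F t)" by (intro ennreal_leI c_le l(2))
      also have "\<dots> = ennreal (?F t) * indicator {0<..1} t"
      proof -
        have "(1 / 2) ^ Suc l < t" "t \<le> (1 / 2) ^ l" using l(2) by (simp_all add: A_def del: power_Suc)
        moreover have "0 < (1 / 2 :: real) ^ Suc l" "(1 / 2 :: real) ^ l \<le> 1"
          by (rule zero_less_power, simp, rule power_le_one, simp_all)
        ultimately have "0 < t" "t \<le> 1" by (blast intro: less_trans order_trans)+
        then show ?thesis by simp
      qed
      finally show ?thesis .
    next
      case False
      then have "(\<Sum>l<L. ennreal (c l) * indicator (A l) t) = 0" by (intro sum.neutral) auto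
      then show ?thesis by simp
    qed
    then have "(\<integral>\<^sup>+ t. (\<Sum>l<L. ennreal (c l) * indicator (A l) t) \<partial>lborel) \<le> ?I"
      by (intro nn_integral_mono)
    also have "(\<integral>\<^sup>+ t. (\<Sum>l<L. ennreal (c l) * indicator (A l) t) \<partial>lborel)
        = (\<Sum>l<L. ennreal (\<omega> ((1 / 2) ^ Suc l) * sqrt (real l + 2) / 4))"
    proof (subst nn_integral_sum)
      show "(\<Sum>l<L. \<integral>\<^sup>+ t. ennreal (c l) * indicator (A l) t \<partial>lborel)
        = (\<Sum>l<L. ennreal (\<omega> ((1 / 2) ^ Suc l) * sqrt (real l + 2) / 4))"
      proof (rule sum.cong)
        fix l
        have "(1 / 2 :: real) ^ Suc l \<le> (1 / 2) ^ l" by simp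
        then have "(\<integral>\<^sup>+ t. ennreal (c l) * indicator (A l) t \<partial>lborel) = ennreal (c l) * ennreal ((1 / 2) ^ l - (1 / 2) ^ Suc l)"
          unfolding A_def by (subst nn_integral_cmult_indicator) auto
        also have "\<dots> = ennreal (c l * ((1 / 2) ^ l - (1 / 2) ^ Suc l))"
          by (rule ennreal_mult[symmetric]) (simp_all add: c_nonneg)
        also have "c l * ((1 / 2) ^ l - (1 / 2) ^ Suc l) = \<omega> ((1 / 2) ^ Suc l) * sqrt (real l + 2) / 4"
        proof -
          have "2 ^ l * ((1 / 2) ^ l - (1 / 2) ^ Suc l) = (1 / 2 :: real)" by (simp add: power_one_over field_simps)
          then have "\<omega> ((1 / 2) ^ Suc l) * (sqrt (real l + 2) / 2) * (2 ^ l * ((1 / 2) ^ l - (1 / 2) ^ Suc l))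
            = \<omega> ((1 / 2) ^ Suc l) * (sqrt (real l + 2) / 2) * (1 / 2)" by (simp only:)
          then show ?thesis unfolding c_def by (simp only: mult.assoc)
        qed
        finally show "(\<integral>\<^sup>+ t. ennreal (c l) * indicator (A l) t \<partial>lborel)
          = ennreal (\<omega> ((1 / 2) ^ Suc l) * sqrt (real l + 2) / 4)" .
      qed simp
    qed (simp add: A_def)
    also have "\<dots> = ennreal (\<Sum>l<L. \<omega> ((1 / 2) ^ Suc l) * sqrt (real l + 2) / 4)"
      by (intro sum_ennreal) (simp add: \<omega>_nonneg)
    finally have "enn2real (ennreal (\<Sum>l<L. \<omega> ((1 / 2) ^ Suc l) * sqrt (real l + 2) / 4)) \<le> enn2real ?I"
      using int by (intro enn2real_mono) auto
    then show ?thesis by (simp add: sum_nonneg \<omega>_nonneg)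
  qed
  show ?thesis
  proof
    fix L
    have "(\<Sum>l<L. \<omega> ((1 / 2) ^ l) * sqrt (real l + 1)) \<le> (\<Sum>l<Suc L. \<omega> ((1 / 2) ^ l) * sqrt (real l + 1))"
      by (intro sum_mono2) (auto simp: \<omega>_nonneg)
    \<comment> \<open>The interval \<open>A l\<close> controls the value at its left end, so the
      term \<open>l = 0\<close> is left over and is added to the bound.\<close>
    also have "\<dots> = \<omega> 1 + (\<Sum>l<L. \<omega> ((1 / 2) ^ Suc l) * sqrt (real l + 2))"
      unfolding sum.lessThan_Suc_shift by (simp add: add.commute)
    also have "(\<Sum>l<L. \<omega> ((1 / 2) ^ Suc l) * sqrt (real l + 2))
        = 4 * (\<Sum>l<L. \<omega> ((1 / 2) ^ Suc l) * sqrt (real l + 2) / 4)"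
      unfolding sum_distrib_left by simp
    also have "\<dots> \<le> 4 * enn2real ?I" using part[of L] by simp
    finally show "(\<Sum>l<L. \<omega> ((1 / 2) ^ l) * sqrt (real l + 1)) \<le> \<omega> 1 + 4 * enn2real ?I" by simp
  qed
qed

lemma pairing_commute: "pairing M f g = pairing M g f"
  by (simp add: pairing_def mult.commute)

lemma pairing_cong_AE:
  assumes "f \<in> borel_measurable M" "f' \<in> borel_measurable M" "g \<in> borel_measurable M" "AE x in M. f x = f' x"
  shows "pairing M f g = pairing M f' g"
  unfolding pairing_def using assms by (intro integral_cong_AE) auto

lemma pairing_sum_left:
  assumes "\<And>i. i \<in> I \<Longrightarrow> f i \<in> L2 M" "g \<in> L2 M"
  shows "pairing M (\<lambda>x. \<Sum>i\<in>I. c i * f i x) g = (\<Sum>i\<in>I. c i * pairing M (f i) g)"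
proof -
  have "pairing M (\<lambda>x. \<Sum>i\<in>I. c i * f i x) g = (LINT x|M. (\<Sum>i\<in>I. c i * (f i x * g x)))"
    unfolding pairing_def by (rule Bochner_Integration.integral_cong) (simp_all add: sum_distrib_right mult.assoc)
  also have "\<dots> = (\<Sum>i\<in>I. LINT x|M. c i * (f i x * g x))"
    by (rule Bochner_Integration.integral_sum) (intro integrable_mult_right L2_integrable_mult assms)
  also have "\<dots> = (\<Sum>i\<in>I. c i * pairing M (f i) g)" by (simp add: pairing_def)
  finally show ?thesis .
qed

lemma integrable_complex_indicator:
  assumes "A \<in> sets M" "emeasure M A < \<infinity>"
  shows "integrable M (indicator A :: _ \<Rightarrow> complex)"
proof -
  have "integrable M (\<lambda>x. complex_of_real (indicator A x))"
    by (intro integrable_of_real integrable_real_indicator assms)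
  moreover have "(\<lambda>x. complex_of_real (indicator A x)) = indicator A" by (auto simp: indicator_def)
  ultimately show ?thesis by simp
qed

lemma integral_complex_indicator:
  assumes "A \<in> sets M"
  shows "(LINT x|M. indicator A x) = complex_of_real (measure M A)"
proof -
  have "(LINT x|M. indicator A x) = (LINT x|M. complex_of_real (indicator A x))"
    by (rule Bochner_Integration.integral_cong) (auto simp: indicator_def)
  also have "\<dots> = complex_of_real (LINT x|M. indicator A x)" by (rule integral_complex_of_real)
  also have "(LINT x|M. indicator A x) = measure M A"
    using sets.sets_into_space[OF assms] by (simp add: Int_absorb2)
  finally show ?thesis .
qed

text \<open>The integral condition is represented by the dyadic sum with bound
  \<open>S0\<close>.\<close>

locale T1_setting = locally_finite \<mu>
  for \<mu> :: "'a::euclidean_space measure" +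
  fixes n C\<^sub>0 C\<^sub>1 C\<^sub>2 S0 :: real and \<omega> :: "real \<Rightarrow> real" and K :: "'a \<Rightarrow> 'a \<Rightarrow> complex"
    and S :: "('a \<Rightarrow> complex) set" and T T' :: "('a \<Rightarrow> complex) \<Rightarrow> 'a \<Rightarrow> complex"
  assumes n_pos: "0 < n"
    and ball: "0 < \<rho> \<Longrightarrow> emeasure \<mu> (ball x \<rho>) \<le> ennreal (C\<^sub>0 * \<rho> powr n)"
    and modulus: "modulus_of_continuity \<omega>"
    and CZ: "CZ_operator \<mu> n C\<^sub>1 \<omega> K S T T'"
    and testing: "local_T1 \<mu> C\<^sub>2 T T'"
    and omega_sum: "(\<Sum>l<L. \<omega> ((1 / 2) ^ l) * sqrt (real l + 1)) \<le> S0"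
begin

lemma omega_nonneg: "0 \<le> t \<Longrightarrow> 0 \<le> \<omega> t"
  using modulus by (simp add: modulus_of_continuity_def)

lemma omega_mono: "0 \<le> s \<Longrightarrow> s \<le> t \<Longrightarrow> \<omega> s \<le> \<omega> t"
  using modulus by (auto simp: modulus_of_continuity_def mono_on_def)

text \<open>Continuity at zero is extracted from the summability: a single term is at most
  \<open>S0\<close>, and its weight \<open>sqrt (real l + 1)\<close> grows without bound.\<close>

lemma omega_tendsto_0:
  assumes "0 < \<epsilon>"
  obtains \<delta> where "0 < \<delta>" "\<And>t. 0 \<le> t \<Longrightarrow> t \<le> \<delta> \<Longrightarrow> \<omega> t < \<epsilon>"
proof -
  obtain l :: nat where l: "(S0 / \<epsilon>)\<^sup>2 < real l" using reals_Archimedean2 by blast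
  have S0: "0 \<le> S0" using omega_sum[of 0] by simp
  have "\<omega> ((1 / 2) ^ l) * sqrt (real l + 1) \<le> (\<Sum>l<Suc l. \<omega> ((1 / 2) ^ l) * sqrt (real l + 1))"
    by (rule member_le_sum) (auto simp: omega_nonneg)
  also have "\<dots> \<le> S0" by (rule omega_sum)
  finally have le: "\<omega> ((1 / 2) ^ l) * sqrt (real l + 1) \<le> S0" .
  have "S0 / \<epsilon> < sqrt (real l + 1)"
    by (rule real_less_rsqrt) (use l in simp)
  then have "S0 < \<epsilon> * sqrt (real l + 1)" using assms by (simp add: field_simps)
  then have "\<omega> ((1 / 2) ^ l) * sqrt (real l + 1) < \<epsilon> * sqrt (real l + 1)" using le by linarith
  then have "\<omega> ((1 / 2) ^ l) < \<epsilon>" by (rule mult_right_less_imp_less) simp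
  then show ?thesis using that[of "(1 / 2) ^ l"] omega_mono by (meson le_less_trans zero_less_power half_gt_zero_iff zero_less_one)
qed

lemma kernel: "CZ_kernel n C\<^sub>1 \<omega> K"
  and S_L2: "f \<in> S \<Longrightarrow> f \<in> L2 \<mu>"
  and S_zero: "(\<lambda>x. 0) \<in> S"
  and S_add: "f \<in> S \<Longrightarrow> g \<in> S \<Longrightarrow> (\<lambda>x. f x + g x) \<in> S"
  and S_cmult: "f \<in> S \<Longrightarrow> (\<lambda>x. c * f x) \<in> S"
  and cube_S: "Q \<in> cubes \<mu> \<Longrightarrow> indicator Q \<in> S"
  and T_L2: "f \<in> S \<Longrightarrow> T f \<in> L2 \<mu>" and T'_L2: "f \<in> S \<Longrightarrow> T' f \<in> L2 \<mu>"
  and transpose: "f \<in> S \<Longrightarrow> g \<in> S \<Longrightarrow> pairing \<mu> (T f) g = pairing \<mu> f (T' g)"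
  and T_kernel: "f \<in> S \<Longrightarrow> AE x in \<mu>. x \<notin> ess_supp \<mu> f \<longrightarrow> T f x = (LINT y|\<mu>. K x y * f y)"
  using CZ by (auto simp: CZ_operator_def dense_L2_subspace_def L2_linear_map_def)

lemma S_sum: "(\<And>i. i \<in> I \<Longrightarrow> f i \<in> S) \<Longrightarrow> (\<lambda>x. \<Sum>i\<in>I. f i x) \<in> S"
proof (induction I rule: infinite_finite_induct)
  case (insert i I)
  then show ?case using S_add[of "f i" "\<lambda>x. \<Sum>i\<in>I. f i x"] by simp
qed (simp_all add: S_zero)

section \<open>Kernel estimates off the diagonal\<close>

lemma C1_nonneg: "0 \<le> C\<^sub>1"
proof -
  obtain b :: 'a where b: "b \<in> Basis" using nonempty_Basis by blast
  then have "b \<noteq> 0" using nonzero_Basis by blast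
  then have "norm (K b 0) \<le> C\<^sub>1 * norm (b - 0) powr (- n)" using kernel unfolding CZ_kernel_def by blast
  then have "norm (K b 0) \<le> C\<^sub>1" using b by simp
  then show ?thesis using norm_ge_zero[of "K b 0"] by linarith
qed

lemma kernel_diff_right:
  assumes "x \<noteq> y" "norm (x - x') \<le> norm (x - y) / 2"
  shows "norm (K y x - K y x') \<le> C\<^sub>1 / norm (x - y) powr n * \<omega> (norm (x - x') / norm (x - y))"
proof -
  have "norm (K x y - K x' y) + norm (K y x - K y x') \<le> C\<^sub>1 / norm (x - y) powr n * \<omega> (norm (x - x') / norm (x - y))"
    using kernel assms unfolding CZ_kernel_def by blast
  then show ?thesis using norm_ge_zero[of "K x y - K x' y"] by linarith
qed

lemma kernel_diff_left:
  assumes "x \<noteq> y" "norm (x - x') \<le> norm (x - y) / 2"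
  shows "norm (K x y - K x' y) \<le> C\<^sub>1 / norm (x - y) powr n * \<omega> (norm (x - x') / norm (x - y))"
proof -
  have "norm (K x y - K x' y) + norm (K y x - K y x') \<le> C\<^sub>1 / norm (x - y) powr n * \<omega> (norm (x - x') / norm (x - y))"
    using kernel assms unfolding CZ_kernel_def by blast
  then show ?thesis using norm_ge_zero[of "K y x - K y x'"] by linarith
qed

lemma kernel_size_modulus_mono:
  assumes "0 < D" "D \<le> d" "0 \<le> t" "t \<le> s"
  shows "C\<^sub>1 / d powr n * \<omega> t \<le> C\<^sub>1 / D powr n * \<omega> s"
proof (rule mult_mono)
  show "C\<^sub>1 / d powr n \<le> C\<^sub>1 / D powr n"
    using assms n_pos C1_nonneg by (intro divide_left_mono powr_mono2 mult_pos_pos) auto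
qed (use assms C1_nonneg omega_nonneg omega_mono in auto)

text \<open>Move \<open>x\<close> first and \<open>y\<close> second. After the first move the points
  are still at distance \<open>D / 2\<close>, so both moves are measured against
  \<open>D / 2\<close>, and \<open>4 * d \<le> D\<close> keeps them within the range of the
  smoothness condition.\<close>

lemma kernel_close:
  assumes D: "0 < D" "D \<le> norm (x - y)" and d: "norm (x - x') \<le> d" "norm (y - y') \<le> d" "4 * d \<le> D"
  shows "norm (K y' x' - K y x) \<le> 2 * (C\<^sub>1 / (D / 2) powr n * \<omega> (2 * d / D))"
proof -
  have d0: "0 \<le> d" using d(1) norm_ge_zero[of "x - x'"] by linarith
  have xy: "x \<noteq> y" using D by auto
  have "norm (x - y) \<le> norm (x - x') + norm (x' - y)" using norm_triangle_ineq[of "x - x'" "x' - y"] by simp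
  then have yx: "D / 2 \<le> norm (y - x')" using D d d0 by (simp add: norm_minus_commute[of y x'])
  have "norm (K y x - K y x') \<le> C\<^sub>1 / norm (x - y) powr n * \<omega> (norm (x - x') / norm (x - y))"
    by (rule kernel_diff_right[OF xy]) (use d D d0 in linarith)
  also have "\<dots> \<le> C\<^sub>1 / (D / 2) powr n * \<omega> (2 * d / D)"
  proof (rule kernel_size_modulus_mono)
    have "norm (x - x') / norm (x - y) \<le> d / D" using D d d0 by (intro frac_le) auto
    also have "\<dots> \<le> 2 * d / D" using D d0 by (simp add: divide_right_mono)
    finally show "norm (x - x') / norm (x - y) \<le> 2 * d / D" .
  qed (use D in auto)
  finally have 1: "norm (K y x - K y x') \<le> C\<^sub>1 / (D / 2) powr n * \<omega> (2 * d / D)" .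
  have yx': "y \<noteq> x'" using yx D by auto
  have "norm (K y x' - K y' x') \<le> C\<^sub>1 / norm (y - x') powr n * \<omega> (norm (y - y') / norm (y - x'))"
    by (rule kernel_diff_left[OF yx']) (use d yx d0 in linarith)
  also have "\<dots> \<le> C\<^sub>1 / (D / 2) powr n * \<omega> (2 * d / D)"
  proof (rule kernel_size_modulus_mono)
    have "norm (y - y') / norm (y - x') \<le> d / (D / 2)" using D d d0 yx by (intro frac_le) auto
    then show "norm (y - y') / norm (y - x') \<le> 2 * d / D" by (simp add: mult.commute)
  qed (use D yx in auto)
  finally have 2: "norm (K y x' - K y' x') \<le> C\<^sub>1 / (D / 2) powr n * \<omega> (2 * d / D)" .
  have "norm (K y' x' - K y x) = norm ((K y x - K y x') + (K y x' - K y' x'))" by (simp add: norm_minus_commute)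
  also have "\<dots> \<le> norm (K y x - K y x') + norm (K y x' - K y' x')" by (rule norm_triangle_ineq)
  finally show ?thesis using 1 2 by linarith
qed

text \<open>Supplies the measurability of kernel slices that integration over a cube
  requires.\<close>

lemma kernel_continuous_on:
  assumes "y \<notin> X" shows "continuous_on X (K y)"
  unfolding continuous_on_iff
proof (intro ballI allI impI)
  fix x \<epsilon> assume x: "x \<in> X" and e: "(0::real) < \<epsilon>"
  let ?d = "norm (x - y)"
  have d: "0 < ?d" "x \<noteq> y" using assms x by auto
  \<comment> \<open>The threshold for the modulus divides by this constant, and
    \<open>C\<^sub>1\<close> itself may be zero.\<close>
  have c: "0 < C\<^sub>1 + 1" using C1_nonneg by simp
  obtain \<delta> where \<delta>: "0 < \<delta>" "\<And>t. 0 \<le> t \<Longrightarrow> t \<le> \<delta> \<Longrightarrow> \<omega> t < \<epsilon> * ?d powr n / (C\<^sub>1 + 1)"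
    by (rule omega_tendsto_0[of "\<epsilon> * ?d powr n / (C\<^sub>1 + 1)"]) (use e d c in auto)
  have "dist (K y x') (K y x) < \<epsilon>" if x': "dist x' x < min (?d / 2) (\<delta> * ?d)" for x'
  proof -
    have xx: "norm (x - x') \<le> ?d / 2" "norm (x - x') \<le> \<delta> * ?d" using x' by (auto simp: dist_norm norm_minus_commute)
    have "norm (K y x - K y x') \<le> C\<^sub>1 / ?d powr n * \<omega> (norm (x - x') / ?d)"
      by (rule kernel_diff_right[OF d(2) xx(1)])
    also have "\<dots> \<le> (C\<^sub>1 + 1) / ?d powr n * \<omega> (norm (x - x') / ?d)"
      using d by (intro mult_right_mono divide_right_mono omega_nonneg) auto
    also have "\<dots> < (C\<^sub>1 + 1) / ?d powr n * (\<epsilon> * ?d powr n / (C\<^sub>1 + 1))"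
      using xx d c by (intro mult_strict_left_mono \<delta>) (auto simp: field_simps)
    also have "\<dots> = \<epsilon>" using d c by simp
    finally show ?thesis by (simp add: dist_norm norm_minus_commute)
  qed
  then show "\<exists>d>0. \<forall>x'\<in>X. dist x' x < d \<longrightarrow> dist (K y x') (K y x) < \<epsilon>"
    using d \<delta>(1) by (intro exI[of _ "min (?d / 2) (\<delta> * ?d)"]) auto
qed

text \<open>Separation puts \<open>Y\<close> off the essential support of the indicator of
  \<open>X\<close>, so there the operator is given by the kernel. The pairing is then an integral of
  \<open>K\<close> over a product on which \<open>K\<close> stays within \<open>\<kappa>\<close> of
  \<open>v\<close>.\<close>

lemma pairing_kernel_close:
  assumes X: "X \<in> cubes \<mu>" "X \<in> sets borel" "emeasure \<mu> X < \<infinity>"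
    and Y: "Y \<in> sets borel" "emeasure \<mu> Y < \<infinity>"
    and sep: "0 < e" "\<And>x y. x \<in> X \<Longrightarrow> y \<in> Y \<Longrightarrow> e \<le> dist x y"
    and close: "\<And>x y. x \<in> X \<Longrightarrow> y \<in> Y \<Longrightarrow> norm (K y x - v) \<le> \<kappa>"
    and "0 \<le> \<kappa>"
  shows "norm (pairing \<mu> (T (indicator X)) (indicator Y) - v * (measure \<mu> X * measure \<mu> Y))
    \<le> \<kappa> * (measure \<mu> X * measure \<mu> Y)"
proof -
  let ?m = "measure \<mu>" and ?f = "T (indicator X)"
  have sX: "X \<in> sets \<mu>" "Y \<in> sets \<mu>" using X Y by (auto simp: sets_M)
  have fL: "?f \<in> L2 \<mu>" by (rule T_L2[OF cube_S[OF X(1)]])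
  have YL: "indicator Y \<in> L2 \<mu>" by (rule indicator_L2[OF Y])
  have ind_int: "integrable \<mu> (indicator X :: 'a \<Rightarrow> complex)" "integrable \<mu> (indicator X :: 'a \<Rightarrow> real)"
    "integrable \<mu> (indicator Y :: 'a \<Rightarrow> complex)" "integrable \<mu> (indicator Y :: 'a \<Rightarrow> real)"
    using sX X(3) Y(2) by (auto intro: integrable_real_indicator integrable_complex_indicator)
  have supp: "y \<notin> ess_supp \<mu> (indicator X)" if "y \<in> Y" for y
  proof -
    have "AE x in \<mu>. x \<in> ball y e \<longrightarrow> indicator X x = (0::complex)"
    proof (rule AE_I2, rule impI)
      fix x assume "x \<in> ball y e"
      then have "x \<notin> X" using sep(2)[OF _ that, of x] by (auto simp: dist_commute)
      then show "indicator X x = (0::complex)" by simp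
    qed
    then show ?thesis unfolding ess_supp_def using sep(1) by (auto intro!: exI[of _ "ball y e"])
  qed
  have point: "norm (LINT x|\<mu>. K y x * indicator X x - v * indicator X x) \<le> \<kappa> * ?m X"
    and int: "integrable \<mu> (\<lambda>x. K y x * indicator X x)" if y: "y \<in> Y" for y
  proof -
    have "y \<notin> X" using sep y by fastforce
    then have "(\<lambda>x. indicator X x *\<^sub>R K y x) \<in> borel_measurable borel"
      by (intro borel_measurable_continuous_on_indicator X kernel_continuous_on)
    moreover have "(\<lambda>x. indicator X x *\<^sub>R K y x) = (\<lambda>x. K y x * indicator X x)" by (auto simp: indicator_def)
    ultimately have m: "(\<lambda>x. K y x * indicator X x) \<in> borel_measurable \<mu>"
      by (simp add: measurable_cong_sets[OF sets_M refl])
    have bd: "norm (K y x * indicator X x - v * indicator X x) \<le> \<kappa> * indicator X x" for x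
      using close[OF _ y, of x] by (cases "x \<in> X") auto
    have bd': "norm (K y x * indicator X x) \<le> norm ((\<kappa> + norm v) * indicator X x)" for x
    proof (cases "x \<in> X")
      case True
      have "norm (K y x) \<le> norm (K y x - v) + norm v" using norm_triangle_ineq[of "K y x - v" v] by simp
      then show ?thesis using close[OF True y] True \<open>0 \<le> \<kappa>\<close> by simp
    qed simp
    show int: "integrable \<mu> (\<lambda>x. K y x * indicator X x)"
    proof (rule Bochner_Integration.integrable_bound)
      show "integrable \<mu> (\<lambda>x. (\<kappa> + norm v) * indicator X x)" using ind_int by simp
      show "(\<lambda>x. K y x * indicator X x) \<in> borel_measurable \<mu>" by (rule m)
      show "AE x in \<mu>. norm (K y x * indicator X x) \<le> norm ((\<kappa> + norm v) * indicator X x)" using bd' by simp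
    qed
    have "norm (LINT x|\<mu>. K y x * indicator X x - v * indicator X x) \<le> (LINT x|\<mu>. norm (K y x * indicator X x - v * indicator X x))"
      by (rule integral_norm_bound)
    also have "\<dots> \<le> (LINT x|\<mu>. \<kappa> * indicator X x)"
      using bd int ind_int by (intro integral_mono integrable_norm Bochner_Integration.integrable_diff) auto
    finally show "norm (LINT x|\<mu>. K y x * indicator X x - v * indicator X x) \<le> \<kappa> * ?m X"
      by (simp add: space_M)
  qed
  have ae: "AE y in \<mu>. norm (?f y * indicator Y y - (v * ?m X) * indicator Y y) \<le> \<kappa> * ?m X * indicator Y y"
    using T_kernel[OF cube_S[OF X(1)]]
  proof eventually_elim
    case (elim y)
    show ?case
    proof (cases "y \<in> Y")
      case True
      have "?f y = (LINT x|\<mu>. K y x * indicator X x)" using elim supp[OF True] by blast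
      then have "?f y - v * ?m X = (LINT x|\<mu>. K y x * indicator X x - v * indicator X x)"
        using int[OF True] ind_int by (simp add: integral_complex_indicator sX)
      then show ?thesis using point[OF True] True by simp
    qed simp
  qed
  have i1: "integrable \<mu> (\<lambda>y. ?f y * indicator Y y)" by (rule L2_integrable_mult[OF fL YL])
  have "pairing \<mu> ?f (indicator Y) - v * (?m X * ?m Y) = (LINT y|\<mu>. ?f y * indicator Y y - (v * ?m X) * indicator Y y)"
    using i1 ind_int by (simp add: pairing_def integral_complex_indicator sX mult.assoc)
  also have "norm \<dots> \<le> (LINT y|\<mu>. norm (?f y * indicator Y y - (v * ?m X) * indicator Y y))"
    by (rule integral_norm_bound)
  also have "\<dots> \<le> (LINT y|\<mu>. \<kappa> * ?m X * indicator Y y)"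
    using i1 ind_int ae by (intro integral_mono_AE integrable_norm Bochner_Integration.integrable_diff) auto
  also have "\<dots> = \<kappa> * (?m X * ?m Y)" by (simp add: space_M)
  finally show ?thesis .
qed

end

section \<open>Discretisation\<close>

locale T1_window = T1_setting \<mu> n C\<^sub>0 C\<^sub>1 C\<^sub>2 S0 \<omega> K S T T'
  for \<mu> :: "'a::euclidean_space measure" and n C\<^sub>0 C\<^sub>1 C\<^sub>2 S0 :: real and \<omega> :: "real \<Rightarrow> real"
    and K :: "'a \<Rightarrow> 'a \<Rightarrow> complex" and S :: "('a \<Rightarrow> complex) set" and T T' :: "('a \<Rightarrow> complex) \<Rightarrow> 'a \<Rightarrow> complex" +
  fixes j i0 :: nat
  assumes i0: "1 \<le> i0" "8 * DIM('a) \<le> 2 ^ i0"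
begin

text \<open>With \<open>M = 2 * j + 1\<close>, the cells of \<open>grid_box j\<close> have indices
  in \<open>[0, 2 ^ M)\<close>, and this is the enlarged window of the lattice model.\<close>

definition Win :: "('a \<Rightarrow> int) set" where
  "Win = PiE Basis (\<lambda>_. {- (2 ^ (2 * j + 1))..<2 ^ (2 * j + 1 + 1)})"

definition m :: "('a \<Rightarrow> int) \<Rightarrow> real" where
  "m p = measure \<mu> (grid_cell j p)"

text \<open>Null cells are discarded because the discrete kernel divides by the masses.\<close>

definition W :: "('a \<Rightarrow> int) set" where
  "W = {p \<in> Win. 0 < m p}"

definition e :: "('a \<Rightarrow> int) \<Rightarrow> 'a \<Rightarrow> complex" where
  "e p = indicator (grid_cell j p)"

definition cell_form :: "('a \<Rightarrow> int) \<Rightarrow> ('a \<Rightarrow> int) \<Rightarrow> complex" where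
  "cell_form p q = pairing \<mu> (T (e p)) (e q)"

definition idx :: "'a \<Rightarrow> 'a \<Rightarrow> int" where
  "idx x = restrict (grid j x) Basis"

definition lcube :: "('a \<Rightarrow> int) \<Rightarrow> nat \<Rightarrow> 'a set" where
  "lcube u k = {x. \<forall>b\<in>Basis. u b \<le> grid j x b \<and> grid j x b < u b + 2 ^ k}"

abbreviation LC :: "('a \<Rightarrow> int) \<Rightarrow> nat \<Rightarrow> ('a \<Rightarrow> int) set" where
  "LC u k \<equiv> lattice_cube W (\<lambda>p. p) Basis u k"

lemma finite_W: "finite W"
proof (rule finite_subset)
  show "W \<subseteq> Win" by (auto simp: W_def)
  show "finite Win" unfolding Win_def by (intro finite_PiE) auto
qed

lemma W_Win: "W \<subseteq> Win"
  by (auto simp: W_def)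

lemma idx_cell: "x \<in> grid_cell j (idx x)"
  by (simp add: grid_cell_def idx_def)

lemma in_cell_iff: "p \<in> extensional Basis \<Longrightarrow> x \<in> grid_cell j p \<longleftrightarrow> p = idx x"
  using grid_cell_disjoint[of p "idx x" x j] idx_cell[of x] by (auto simp: idx_def)

lemma Win_ext: "p \<in> Win \<Longrightarrow> p \<in> extensional Basis"
  by (auto simp: Win_def PiE_def)

lemma window_sum:
  fixes f :: "('a \<Rightarrow> int) \<Rightarrow> 'b::semiring_1"
  assumes "A \<subseteq> W"
  shows "(\<Sum>p\<in>A. f p * indicator (grid_cell j p) x) = (if idx x \<in> A then f (idx x) else 0)"
proof -
  have fin: "finite A" using assms finite_W finite_subset by blast
  have "(\<Sum>p\<in>A. f p * indicator (grid_cell j p) x) = (\<Sum>p\<in>A. if p = idx x then f p else 0)"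
  proof (rule sum.cong)
    fix p assume "p \<in> A"
    then have "p \<in> extensional Basis" using assms W_Win Win_ext by blast
    then show "f p * indicator (grid_cell j p) x = (if p = idx x then f p else 0)"
      using in_cell_iff[of p x] by (simp add: indicator_def)
  qed simp
  then show ?thesis using fin by simp
qed

lemma cell_sets [measurable]: "grid_cell j p \<in> sets \<mu>"
  by (simp add: sets_M borel_grid_cell)

text \<open>Finitely many cells are discarded, each of measure zero.\<close>

lemma window_AE: "AE x in \<mu>. idx x \<in> Win \<longrightarrow> idx x \<in> W"
proof -
  have "AE x in \<mu>. \<forall>p\<in>Win. m p = 0 \<longrightarrow> x \<notin> grid_cell j p"
  proof (rule AE_finite_allI)
    show "finite Win" unfolding Win_def by (intro finite_PiE) auto
    fix p
    show "AE x in \<mu>. m p = 0 \<longrightarrow> x \<notin> grid_cell j p"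
    proof (cases "m p = 0")
      case True
      then have "emeasure \<mu> (grid_cell j p) = 0"
        using finite_grid_cell[of j p] emeasure_eq_ennreal_measure[of \<mu> "grid_cell j p"] by (simp add: m_def)
      then have "AE x in \<mu>. x \<notin> grid_cell j p" by (intro AE_not_in null_setsI cell_sets)
      then show ?thesis by auto
    qed simp
  qed
  then show ?thesis
  proof eventually_elim
    case (elim x)
    have "m (idx x) \<noteq> 0" if "idx x \<in> Win" using elim that idx_cell[of x] by blast
    moreover have "0 \<le> m (idx x)" by (simp add: m_def)
    ultimately show ?case by (auto simp: W_def)
  qed
qed

lemma lcube_eq: "lcube u k = {x. \<forall>b\<in>Basis. corner j u \<bullet> b \<le> x \<bullet> b \<and> x \<bullet> b < corner j u \<bullet> b + 2 ^ k / 2 ^ j}"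
proof -
  have "u b \<le> grid j x b \<longleftrightarrow> corner j u \<bullet> b \<le> x \<bullet> b" if "b \<in> Basis" for x b :: 'a
    unfolding corner_inner[OF that] grid_def le_floor_iff by (simp add: field_simps)
  moreover have "grid j x b < u b + 2 ^ k \<longleftrightarrow> x \<bullet> b < corner j u \<bullet> b + 2 ^ k / 2 ^ j" if "b \<in> Basis" for x b :: 'a
    unfolding corner_inner[OF that] grid_def floor_less_iff by (simp add: field_simps)
  ultimately show ?thesis by (auto simp: lcube_def)
qed

lemma lcube_cubes: "lcube u k \<in> cubes \<mu>"
proof -
  have "(0::real) < 2 ^ k / 2 ^ j" by simp
  then show ?thesis unfolding cubes_def lcube_eq by blast
qed

lemma lcube_sets: "lcube u k \<in> sets \<mu>"
  unfolding lcube_eq sets_M by (rule borel_half_open_box)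

lemma cell_lcube: "grid_cell j p = lcube p 0"
  unfolding grid_cell_def lcube_def by force

lemma e_S: "e p \<in> S"
  unfolding e_def cell_lcube by (rule cube_S[OF lcube_cubes])

lemma e_L2: "e p \<in> L2 \<mu>"
  by (rule S_L2[OF e_S])

lemma lcube_AE:
  assumes u: "\<And>b. b \<in> Basis \<Longrightarrow> - (2 ^ (2 * j + 1)) \<le> u b \<and> u b + 2 ^ k \<le> 2 ^ (2 * j + 1 + 1)"
  shows "AE x in \<mu>. indicator (lcube u k) x = (\<Sum>q\<in>LC u k. indicator (grid_cell j q) x :: 'b::semiring_1)"
  using window_AE
proof eventually_elim
  case (elim x)
  have iff: "x \<in> lcube u k \<longleftrightarrow> (\<forall>b\<in>Basis. u b \<le> idx x b \<and> idx x b < u b + 2 ^ k)"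
    by (simp add: lcube_def idx_def)
  have "idx x \<in> Win" if "x \<in> lcube u k"
    unfolding Win_def
  proof (rule PiE_I)
    fix b :: 'a assume b: "b \<in> Basis"
    have "u b \<le> idx x b" "idx x b < u b + 2 ^ k" using that iff b by auto
    then show "idx x b \<in> {- (2 ^ (2 * j + 1))..<2 ^ (2 * j + 1 + 1)}" using u[OF b] by auto
  qed (simp add: idx_def)
  then have "x \<in> lcube u k \<longleftrightarrow> idx x \<in> LC u k"
    using elim iff by (auto simp: lattice_cube_def)
  moreover have "(\<Sum>q\<in>LC u k. indicator (grid_cell j q) x :: 'b) = (if idx x \<in> LC u k then 1 else 0)"
    using window_sum[of "LC u k" "\<lambda>_. 1 :: 'b" x] by (auto simp: lattice_cube_def)
  ultimately show ?case by (simp add: indicator_def)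
qed

lemma measurable_e [measurable]: "e p \<in> borel_measurable \<mu>"
  unfolding e_def by simp

lemma pairing_lcube:
  assumes u: "\<And>b. b \<in> Basis \<Longrightarrow> - (2 ^ (2 * j + 1)) \<le> u b \<and> u b + 2 ^ k \<le> 2 ^ (2 * j + 1 + 1)" and f: "f \<in> L2 \<mu>"
  shows "pairing \<mu> (indicator (lcube u k)) f = (\<Sum>q\<in>LC u k. pairing \<mu> (e q) f)"
proof -
  have "pairing \<mu> (indicator (lcube u k)) f = pairing \<mu> (\<lambda>x. \<Sum>q\<in>LC u k. 1 * e q x) f"
  proof (rule pairing_cong_AE)
    show "AE x in \<mu>. indicator (lcube u k) x = (\<Sum>q\<in>LC u k. 1 * e q x)"
      using lcube_AE[OF u, where 'b = complex] by (simp add: e_def)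
    show "indicator (lcube u k) \<in> borel_measurable \<mu>" using lcube_sets by simp
    show "f \<in> borel_measurable \<mu>" by (rule L2_measurable[OF f])
  qed measurable
  also have "\<dots> = (\<Sum>q\<in>LC u k. 1 * pairing \<mu> (e q) f)"
    by (rule pairing_sum_left[OF e_L2 f])
  finally show ?thesis by simp
qed

lemma integrable_cell: "integrable \<mu> (indicator (grid_cell j p) :: 'a \<Rightarrow> real)"
  by (rule integrable_real_indicator[OF cell_sets finite_grid_cell])

lemma measure_lcube:
  assumes u: "\<And>b. b \<in> Basis \<Longrightarrow> - (2 ^ (2 * j + 1)) \<le> u b \<and> u b + 2 ^ k \<le> 2 ^ (2 * j + 1 + 1)"
  shows "measure \<mu> (lcube u k) = sum m (LC u k)"
proof -
  have "measure \<mu> (lcube u k) = (LINT x|\<mu>. indicator (lcube u k) x)" by (simp add: space_M)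
  also have "\<dots> = (LINT x|\<mu>. (\<Sum>q\<in>LC u k. indicator (grid_cell j q) x))"
  proof (rule integral_cong_AE)
    show "(\<lambda>x. \<Sum>q\<in>LC u k. indicator (grid_cell j q) x :: real) \<in> borel_measurable \<mu>" by measurable
  qed (use lcube_sets lcube_AE[OF u, where 'b = real] in auto)
  also have "\<dots> = sum m (LC u k)"
    by (subst Bochner_Integration.integral_sum)
      (simp_all add: integrable_cell space_M m_def[symmetric])
  finally show ?thesis .
qed

text \<open>Bessel's inequality: the functions \<open>e x\<close> are indicators of disjoint cells,
  hence orthogonal with square norm \<open>m x\<close>.\<close>

lemma sum_pairing_cells_le:
  assumes f: "f \<in> L2 \<mu>"
  shows "(\<Sum>x\<in>W. (norm (pairing \<mu> (e x) f))\<^sup>2 / m x) \<le> (L2_norm \<mu> f)\<^sup>2"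
proof -
  have int: "integrable \<mu> (\<lambda>y. indicator (grid_cell j x) y * (norm (f y))\<^sup>2)" for x
    by (rule integrable_mult_indicator[OF cell_sets L2_integrable[OF f], unfolded real_scaleR_def])
  have "(\<Sum>x\<in>W. (norm (pairing \<mu> (e x) f))\<^sup>2 / m x) \<le> (\<Sum>x\<in>W. LINT y|\<mu>. indicator (grid_cell j x) y * (norm (f y))\<^sup>2)"
  proof (rule sum_mono)
    fix x assume "x \<in> W"
    then have "0 < m x" by (simp add: W_def)
    moreover have "(norm (pairing \<mu> (e x) f))\<^sup>2 \<le> m x * (LINT y|\<mu>. indicator (grid_cell j x) y * (norm (f y))\<^sup>2)"
      unfolding pairing_def e_def m_def
      by (rule norm_integral_indicator_square_le[OF f cell_sets finite_grid_cell])
    ultimately show "(norm (pairing \<mu> (e x) f))\<^sup>2 / m x \<le> (LINT y|\<mu>. indicator (grid_cell j x) y * (norm (f y))\<^sup>2)"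
      by (simp add: pos_divide_le_eq mult.commute)
  qed
  also have "\<dots> = (LINT y|\<mu>. (\<Sum>x\<in>W. indicator (grid_cell j x) y * (norm (f y))\<^sup>2))"
    by (rule Bochner_Integration.integral_sum[symmetric]) (rule int)
  also have "\<dots> \<le> (LINT y|\<mu>. (norm (f y))\<^sup>2)"
  proof (rule integral_mono)
    show "(\<Sum>x\<in>W. indicator (grid_cell j x) y * (norm (f y))\<^sup>2) \<le> (norm (f y))\<^sup>2" for y
      using window_sum[of W "\<lambda>_. (norm (f y))\<^sup>2" y] by (simp add: mult.commute)
  qed (use int L2_integrable[OF f] in auto)
  finally show ?thesis by (simp add: L2_norm_square)
qed

text \<open>The maximum keeps \<open>V\<close> strictly positive.\<close>

definition C0' :: real where "C0' = max C\<^sub>0 1"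

text \<open>The growth bound for a ball around a corner containing all cells whose indices differ by
  less than \<open>2 ^ (k + 1)\<close> in each coordinate.\<close>

definition V :: "nat \<Rightarrow> real" where
  "V k = C0' * (DIM('a) * (2 ^ (k + 1) / 2 ^ j)) powr n"

text \<open>Chosen to match \<open>kernel_average_close\<close>. One factor 2 comes from moving both
  variables, another from comparing two matrix entries with one kernel value;
  \<open>8 * DIM('a)\<close> is the ratio between the radius in \<open>V (k + i)\<close> and the
  distance at which the kernel is estimated.\<close>

definition A0 :: real where
  "A0 = 4 * C\<^sub>1 * C0' * (8 * DIM('a)) powr n"

text \<open>Shifting the index by \<open>i0\<close> absorbs the dimensional factor in the argument
  of \<open>\<omega>\<close>. Below \<open>i0\<close> the kernel hypothesis makes no claim, and zero
  is a default value.\<close>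

definition om :: "nat \<Rightarrow> real" where
  "om i = (if i < i0 then 0 else A0 * \<omega> ((1 / 2) ^ (i - i0)))"

section \<open>Distances, masses and kernel averages of mesh cells\<close>

lemma coord_diff:
  assumes x: "x \<in> grid_cell j p" and y: "y \<in> grid_cell j q" and b: "b \<in> Basis" and pq: "\<bar>p b - q b\<bar> < 2 ^ k"
  shows "\<bar>(x - y) \<bullet> b\<bar> < 2 ^ k / 2 ^ j"
proof -
  have xx: "of_int (p b) / 2 ^ j - 2 ^ j \<le> x \<bullet> b" "x \<bullet> b < (of_int (p b) + 1) / 2 ^ j - 2 ^ j"
    and yy: "of_int (q b) / 2 ^ j - 2 ^ j \<le> y \<bullet> b" "y \<bullet> b < (of_int (q b) + 1) / 2 ^ j - 2 ^ j"
    using x y b by (auto simp: grid_cell_altdef)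
  have "p b - q b + 1 \<le> 2 ^ k" "q b - p b + 1 \<le> 2 ^ k" using pq by auto
  then have "real_of_int (p b - q b + 1) \<le> real_of_int (2 ^ k)" "real_of_int (q b - p b + 1) \<le> real_of_int (2 ^ k)"
    by (simp_all only: of_int_le_iff)
  then have "(of_int (p b) + 1) / 2 ^ j - of_int (q b) / 2 ^ j \<le> 2 ^ k / (2 ^ j :: real)"
    "(of_int (q b) + 1) / 2 ^ j - of_int (p b) / 2 ^ j \<le> 2 ^ k / (2 ^ j :: real)"
    by (simp_all add: diff_divide_distrib[symmetric] divide_right_mono)
  then show ?thesis using xx yy by (simp add: inner_diff_left abs_less_iff)
qed

lemma cell_dist:
  fixes x y :: 'a
  assumes "x \<in> grid_cell j p" "y \<in> grid_cell j q" "\<And>b. b \<in> Basis \<Longrightarrow> \<bar>p b - q b\<bar> < 2 ^ k"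
  shows "norm (x - y) < DIM('a) * (2 ^ k / 2 ^ j)"
  by (rule norm_less_DIM[of "x - y"]) (rule coord_diff[OF assms(1,2) _ assms(3)])

lemma ball_mass_le:
  shows "(\<Sum>q | q \<in> W \<and> (\<forall>b\<in>Basis. \<bar>p b - q b\<bar> < 2 ^ (k + 1)). m q) \<le> V k"
proof -
  let ?A = "{q. q \<in> W \<and> (\<forall>b\<in>Basis. \<bar>p b - q b\<bar> < 2 ^ (k + 1))}"
  let ?\<rho> = "DIM('a) * (2 ^ (k + 1) / 2 ^ j) :: real"
  let ?B = "ball (corner j p) ?\<rho>"
  have B: "integrable \<mu> (indicator ?B :: 'a \<Rightarrow> real)"
    using finite_ball by (intro integrable_real_indicator) (auto simp: sets_M)
  have "sum m ?A = (LINT x|\<mu>. (\<Sum>q\<in>?A. indicator (grid_cell j q) x))"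
    by (subst Bochner_Integration.integral_sum)
      (simp_all add: integrable_cell space_M m_def[symmetric])
  also have "\<dots> \<le> (LINT x|\<mu>. indicator ?B x)"
  proof (rule integral_mono)
    fix x
    have "x \<in> ?B" if "idx x \<in> ?A"
      using cell_dist[OF corner_in_cell[of j p] idx_cell[of x], of "k + 1"] that by (auto simp: dist_norm)
    then show "(\<Sum>q\<in>?A. indicator (grid_cell j q) x) \<le> (indicator ?B x :: real)"
      using window_sum[of ?A "\<lambda>_. 1 :: real" x] by (auto simp: indicator_def)
  qed (use B integrable_cell in auto)
  also have "\<dots> = measure \<mu> ?B" by (simp add: space_M)
  also have "\<dots> \<le> V k"
  proof -
    have r: "0 < ?\<rho>" by simp
    have "emeasure \<mu> ?B \<le> ennreal (C\<^sub>0 * ?\<rho> powr n)" by (rule ball[OF r])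
    also have "\<dots> \<le> ennreal (V k)" unfolding V_def C0'_def by (intro ennreal_leI mult_right_mono) auto
    finally show ?thesis unfolding measure_def by (intro enn2real_leI) (auto simp: V_def C0'_def)
  qed
  finally show ?thesis .
qed

lemma V_pos: "0 < V k"
  by (simp add: V_def C0'_def)

lemma om_nonneg: "0 \<le> om i"
  by (simp add: om_def A0_def C1_nonneg C0'_def omega_nonneg)

definition om_total :: real where
  "om_total = A0 * sqrt (2 * i0 + 3) * S0"

text \<open>After reindexing by \<open>i0\<close>, the weight satisfies
  \<open>2 * (l + i0) + 3 \<le> (2 * i0 + 3) * (l + 1)\<close>, so the shift costs only a constant
  factor.\<close>

lemma om_sum: "(\<Sum>i<L. om i * sqrt (2 * i + 3)) \<le> om_total"
proof -
  have A0: "0 \<le> A0" by (simp add: A0_def C1_nonneg C0'_def)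
  have "(\<Sum>i<L. om i * sqrt (2 * i + 3)) \<le> (\<Sum>i<L + i0. om i * sqrt (2 * i + 3))"
    by (intro sum_mono2) (auto simp: om_nonneg)
  also have "\<dots> = (\<Sum>i=i0..<L + i0. om i * sqrt (2 * i + 3))"
    by (rule sum.mono_neutral_right) (auto simp: om_def)
  also have "\<dots> = (\<Sum>l<L. om (l + i0) * sqrt (2 * (l + i0) + 3))"
    using sum.shift_bounds_nat_ivl[of "\<lambda>i. om i * sqrt (2 * i + 3)" 0 i0 L] by (simp add: lessThan_atLeast0)
  also have "\<dots> \<le> (\<Sum>l<L. A0 * sqrt (2 * i0 + 3) * (\<omega> ((1 / 2) ^ l) * sqrt (real l + 1)))"
  proof (rule sum_mono)
    fix l
    have "real (2 * (l + i0) + 3) \<le> real (2 * i0 + 3) * (real l + 1)" by (simp add: algebra_simps)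
    then have "sqrt (real (2 * (l + i0) + 3)) \<le> sqrt (real (2 * i0 + 3)) * sqrt (real l + 1)"
      unfolding real_sqrt_mult[symmetric] by (rule real_sqrt_le_mono)
    then have "om (l + i0) * sqrt (2 * (l + i0) + 3) \<le> om (l + i0) * (sqrt (real (2 * i0 + 3)) * sqrt (real l + 1))"
      by (rule mult_left_mono[OF _ om_nonneg])
    also have "\<dots> = A0 * sqrt (2 * i0 + 3) * (\<omega> ((1 / 2) ^ l) * sqrt (real l + 1))"
      by (simp add: om_def)
    finally show "om (l + i0) * sqrt (2 * (l + i0) + 3) \<le> A0 * sqrt (2 * i0 + 3) * (\<omega> ((1 / 2) ^ l) * sqrt (real l + 1))" .
  qed
  also have "\<dots> = A0 * sqrt (2 * i0 + 3) * (\<Sum>l<L. \<omega> ((1 / 2) ^ l) * sqrt (real l + 1))"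
    by (simp add: sum_distrib_left)
  also have "\<dots> \<le> om_total" unfolding om_total_def by (intro mult_left_mono omega_sum) (use A0 in auto)
  finally show ?thesis .
qed

text \<open>The mesh parameter \<open>j\<close> does not occur, directly or through
  \<open>om_total\<close>; this uniformity is what the density argument rests on.\<close>

definition T1_const :: real where
  "T1_const = \<bar>C\<^sub>2\<bar> + 2 * (2 * \<bar>C\<^sub>2\<bar> * sqrt (2 ^ ((2 * i0 + 1) * DIM('a))) * sqrt (real (2 * i0 + 1))
     + 4 * om_total + 2 * sqrt (8 * \<bar>C\<^sub>2\<bar>\<^sup>2 + 8 * om_total\<^sup>2 + 1))"

text \<open>All points of the cells \<open>p'\<close> and \<open>q'\<close> are close to the corners
  of \<open>p\<close> and \<open>q\<close> compared with the distance of these corners, so the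
  matrix entry is an average of nearly constant kernel values. The factor one half leaves room for
  comparing two entries through the same reference value.\<close>

lemma kernel_average_close:
  assumes pq: "\<And>b. b \<in> Basis \<Longrightarrow> \<bar>p b - p' b\<bar> < 2 ^ k" "\<And>b. b \<in> Basis \<Longrightarrow> \<bar>q b - q' b\<bar> < 2 ^ k"
    and i: "i0 \<le> i" and far: "\<exists>b\<in>Basis. 2 ^ (k + i) \<le> \<bar>p b - q b\<bar>"
  shows "norm (cell_form p' q' - K (corner j q) (corner j p) * (m p' * m q')) \<le> om i / V (k + i) / 2 * (m p' * m q')"
proof -
  let ?x = "corner j p" and ?y = "corner j q"
  define s where "s = 2 ^ (k + i) / (2 ^ j :: real)"
  define d where "d = DIM('a) * (2 ^ k / 2 ^ j :: real)"
  define D where "D = s / 2"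
  define \<kappa> where "\<kappa> = 2 * (C\<^sub>1 / (D / 2) powr n * \<omega> (2 * d / D))"
  have s: "0 < s" by (simp add: s_def)
  have D: "0 < D" using s by (simp add: D_def)
  have dim: "8 * DIM('a) \<le> (2::real) ^ i"
  proof -
    have "real (8 * DIM('a)) \<le> real (2 ^ i0)" using i0(2) by (rule of_nat_mono)
    also have "\<dots> \<le> 2 ^ i" using i by (simp add: power_increasing)
    finally show ?thesis by simp
  qed
  have dD: "4 * d \<le> D"
  proof -
    define t where "t = 2 ^ k / (2 ^ j :: real)"
    have "8 * DIM('a) * t \<le> (2::real) ^ i * t" using dim by (intro mult_right_mono) (auto simp: t_def)
    moreover have "D = 2 ^ i * t / 2" by (simp add: D_def s_def t_def power_add)
    ultimately show ?thesis by (simp add: d_def t_def[symmetric])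
  qed
  obtain b where b: "b \<in> Basis" "2 ^ (k + i) \<le> \<bar>p b - q b\<bar>" using far by blast
  have xy: "s \<le> norm (?x - ?y)"
  proof -
    have "real_of_int (2 ^ (k + i)) \<le> real_of_int \<bar>p b - q b\<bar>" using b(2) by (simp only: of_int_le_iff)
    then have "s \<le> \<bar>of_int (p b) - of_int (q b)\<bar> / 2 ^ j" unfolding s_def by (intro divide_right_mono) auto
    also have "\<dots> = \<bar>(?x - ?y) \<bullet> b\<bar>"
      by (simp add: inner_diff_left corner_inner[OF b(1)] diff_divide_distrib[symmetric] abs_divide)
    also have "\<dots> \<le> norm (?x - ?y)" by (rule Basis_le_norm[OF b(1)])
    finally show ?thesis .
  qed
  have near: "norm (?x - x') \<le> d" "norm (?y - y') \<le> d" if "x' \<in> grid_cell j p'" "y' \<in> grid_cell j q'" for x' y'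
    unfolding d_def using cell_dist[OF corner_in_cell that(1) pq(1)] cell_dist[OF corner_in_cell that(2) pq(2)] by auto
  have close: "norm (K y' x' - K ?y ?x) \<le> \<kappa>" if "x' \<in> grid_cell j p'" "y' \<in> grid_cell j q'" for x' y'
    unfolding \<kappa>_def by (rule kernel_close[OF D _ near[OF that] dD]) (use xy s D_def in simp)
  have sep: "s / 2 \<le> dist x' y'" if "x' \<in> grid_cell j p'" "y' \<in> grid_cell j q'" for x' y'
  proof -
    have "norm (?x - ?y) \<le> norm (?x - x') + norm (x' - y') + norm (y' - ?y)"
      using norm_triangle_ineq[of "?x - x'" "x' - ?y"] norm_triangle_ineq[of "x' - y'" "y' - ?y"] by simp
    then show ?thesis using near[OF that] xy dD s by (simp add: dist_norm norm_minus_commute[of y'] D_def)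
  qed
  have "norm (cell_form p' q' - K ?y ?x * (m p' * m q')) \<le> \<kappa> * (m p' * m q')"
    unfolding cell_form_def e_def m_def
  proof (rule pairing_kernel_close)
    show "grid_cell j p' \<in> cubes \<mu>" unfolding cell_lcube by (rule lcube_cubes)
    show "0 \<le> \<kappa>" unfolding \<kappa>_def using C1_nonneg omega_nonneg D by (simp add: d_def)
    show "0 < s / 2" using s by simp
    show "emeasure \<mu> (grid_cell j p') < \<infinity>" "emeasure \<mu> (grid_cell j q') < \<infinity>"
      by (rule finite_grid_cell)+
  qed (use sep close in \<open>auto simp: borel_grid_cell\<close>)
  also have "\<dots> \<le> om i / V (k + i) / 2 * (m p' * m q')"
  proof (rule mult_right_mono)
    \<comment> \<open>The argument of the modulus is of order \<open>DIM('a) / 2 ^ i\<close>, and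
      \<open>2 ^ i0\<close> dominates the dimensional factor.\<close>
    have "2 * d / D = 4 * DIM('a) / 2 ^ i" by (simp add: D_def d_def s_def power_add)
    also have "\<dots> \<le> 2 ^ i0 / 2 ^ i"
    proof (rule divide_right_mono)
      have "real (8 * DIM('a)) \<le> real (2 ^ i0)" using i0(2) by (rule of_nat_mono)
      then show "real (4 * DIM('a)) \<le> 2 ^ i0" by simp
    qed simp
    also have "\<dots> = (1 / 2) ^ (i - i0)"
      using i by (simp add: power_one_over power_diff)
    finally have arg: "2 * d / D \<le> (1 / 2) ^ (i - i0)" .
    have V: "V (k + i) = C0' * ((8 * DIM('a)) powr n * (D / 2) powr n)"
    proof -
      have "DIM('a) * (2 ^ (k + i + 1) / 2 ^ j) = real (8 * DIM('a)) * (D / 2)" by (simp add: D_def s_def)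
      moreover have "(real (8 * DIM('a)) * (D / 2)) powr n = (8 * DIM('a)) powr n * (D / 2) powr n"
        by (rule powr_mult)
      ultimately show ?thesis unfolding V_def by (simp only:)
    qed
    have pos: "0 < (8 * DIM('a)) powr n" "0 < (D / 2) powr n" "0 < C0'" using D by (simp_all add: C0'_def)
    have "\<kappa> \<le> 2 * (C\<^sub>1 / (D / 2) powr n * \<omega> ((1 / 2) ^ (i - i0)))"
      unfolding \<kappa>_def using C1_nonneg D arg by (intro mult_left_mono omega_mono) (auto simp: d_def)
    also have "\<dots> = om i / V (k + i) / 2"
      unfolding om_def A0_def V using i pos by simp
    finally show "\<kappa> \<le> om i / V (k + i) / 2" .
  qed (simp add: m_def)
  finally show ?thesis .
qed

text \<open>The sum is carried out inside an integral against a fixed square-integrable function,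
  and transposition then moves the operator onto the indicator of the whole cube. Row and column
  sums thereby become the test functions of the local conditions.\<close>

lemma sum_cell_form_lcube:
  assumes u: "\<And>b. b \<in> Basis \<Longrightarrow> - (2 ^ (2 * j + 1)) \<le> u b \<and> u b + 2 ^ k \<le> 2 ^ (2 * j + 1 + 1)"
  shows "(\<Sum>q\<in>LC u k. cell_form x q) = pairing \<mu> (e x) (T' (indicator (lcube u k)))"
    and "(\<Sum>q\<in>LC u k. cell_form q x) = pairing \<mu> (e x) (T (indicator (lcube u k)))"
proof -
  note QS = cube_S[OF lcube_cubes[of u k]]
  have "(\<Sum>q\<in>LC u k. cell_form x q) = (\<Sum>q\<in>LC u k. pairing \<mu> (e q) (T (e x)))"
    unfolding cell_form_def by (simp only: pairing_commute)
  also have "\<dots> = pairing \<mu> (indicator (lcube u k)) (T (e x))"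
    by (rule pairing_lcube[OF u T_L2[OF e_S], symmetric])
  also have "\<dots> = pairing \<mu> (T (e x)) (indicator (lcube u k))" by (rule pairing_commute)
  also have "\<dots> = pairing \<mu> (e x) (T' (indicator (lcube u k)))" by (rule transpose[OF e_S QS])
  finally show "(\<Sum>q\<in>LC u k. cell_form x q) = pairing \<mu> (e x) (T' (indicator (lcube u k)))" .
  have "(\<Sum>q\<in>LC u k. cell_form q x) = (\<Sum>q\<in>LC u k. pairing \<mu> (e q) (T' (e x)))"
    unfolding cell_form_def by (simp only: transpose[OF e_S e_S])
  also have "\<dots> = pairing \<mu> (indicator (lcube u k)) (T' (e x))"
    by (rule pairing_lcube[OF u T'_L2[OF e_S], symmetric])
  also have "\<dots> = pairing \<mu> (T (indicator (lcube u k))) (e x)" by (rule transpose[OF QS e_S, symmetric])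
  also have "\<dots> = pairing \<mu> (e x) (T (indicator (lcube u k)))" by (rule pairing_commute)
  finally show "(\<Sum>q\<in>LC u k. cell_form q x) = pairing \<mu> (e x) (T (indicator (lcube u k)))" .
qed

end

text \<open>The lattice model is real while the matrix of the operator is complex;
  \<open>\<Lambda>\<close> selects one of its two real components.\<close>

locale T1_window_part = T1_window +
  fixes \<Lambda> :: "complex \<Rightarrow> real"
  assumes \<Lambda>: "\<Lambda> = Re \<or> \<Lambda> = Im"
begin

lemma \<Lambda>_sum: "\<Lambda> (\<Sum>i\<in>I. f i) = (\<Sum>i\<in>I. \<Lambda> (f i))"
  using \<Lambda> by auto

lemma \<Lambda>_diff: "\<Lambda> (x - y) = \<Lambda> x - \<Lambda> y"
  using \<Lambda> by auto

lemma \<Lambda>_real: "\<Lambda> (x * complex_of_real t) = \<Lambda> x * t"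
  using \<Lambda> by auto

lemma \<Lambda>_le: "\<bar>\<Lambda> x\<bar> \<le> norm x"
  using \<Lambda> abs_Re_le_cmod abs_Im_le_cmod by auto

definition a :: "('a \<Rightarrow> int) \<Rightarrow> ('a \<Rightarrow> int) \<Rightarrow> real" where
  "a p q = \<Lambda> (cell_form p q) / (m p * m q)"

lemma m_W: "p \<in> W \<Longrightarrow> 0 < m p"
  by (simp add: W_def)

lemma LC_W: "LC u k \<subseteq> W"
  by (auto simp: lattice_cube_def)

lemma testing_aux:
  assumes f: "f \<in> L2 \<mu>" "L2_norm \<mu> f \<le> C\<^sub>2 * sqrt M" "0 \<le> M"
    and F: "\<And>x. x \<in> W \<Longrightarrow> F x = \<Lambda> (pairing \<mu> (e x) f) / m x"
  shows "(\<Sum>x\<in>W. (F x)\<^sup>2 * m x) \<le> \<bar>C\<^sub>2\<bar>\<^sup>2 * M"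
proof -
  have "(\<Sum>x\<in>W. (F x)\<^sup>2 * m x) \<le> (\<Sum>x\<in>W. (norm (pairing \<mu> (e x) f))\<^sup>2 / m x)"
  proof (rule sum_mono)
    fix x assume x: "x \<in> W"
    have "(F x)\<^sup>2 * m x = (\<Lambda> (pairing \<mu> (e x) f))\<^sup>2 / m x"
      using m_W[OF x] by (simp add: F[OF x] power2_eq_square)
    also have "(\<Lambda> (pairing \<mu> (e x) f))\<^sup>2 \<le> (norm (pairing \<mu> (e x) f))\<^sup>2"
      using \<Lambda>_le by (simp add: abs_le_square_iff[symmetric])
    finally show "(F x)\<^sup>2 * m x \<le> (norm (pairing \<mu> (e x) f))\<^sup>2 / m x"
      using m_W[OF x] by (simp add: divide_right_mono)
  qed
  also have "\<dots> \<le> (L2_norm \<mu> f)\<^sup>2" by (rule sum_pairing_cells_le[OF f(1)])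
  also have "\<dots> \<le> (C\<^sub>2 * sqrt M)\<^sup>2" using f(2) by (intro power_mono) auto
  also have "\<dots> = \<bar>C\<^sub>2\<bar>\<^sup>2 * M" using f(3) by (simp add: power_mult_distrib)
  finally show ?thesis .
qed

lemma lattice: "lattice_kernel W m (\<lambda>p. p) Basis a (2 * j + 1) i0 V om \<bar>C\<^sub>2\<bar> om_total"
proof
  show "p = q" if "p \<in> W" "q \<in> W" "\<And>b. b \<in> Basis \<Longrightarrow> p b = q b" for p q
    using that W_Win Win_ext by (intro extensionalityI[of p Basis q]) auto
  show "- (2 ^ (2 * j + 1)) \<le> p b \<and> p b < 2 ^ (2 * j + 1 + 1)" if "p \<in> W" "b \<in> Basis" for p b
    using that W_Win by (force simp: Win_def PiE_iff)
  have loc: "L2_norm \<mu> (T' (indicator (lcube u k))) \<le> C\<^sub>2 * sqrt (measure \<mu> (lcube u k))"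
    "L2_norm \<mu> (T (indicator (lcube u k))) \<le> C\<^sub>2 * sqrt (measure \<mu> (lcube u k))" for u k
    using testing lcube_cubes[of u k] by (auto simp: local_T1_def)
  show "(\<Sum>x\<in>W. (\<Sum>q\<in>LC u k. a x q * m q)\<^sup>2 * m x) \<le> \<bar>C\<^sub>2\<bar>\<^sup>2 * sum m (LC u k)"
    if u: "\<And>b. b \<in> Basis \<Longrightarrow> - (2 ^ (2 * j + 1)) \<le> u b \<and> u b + 2 ^ k \<le> 2 ^ (2 * j + 1 + 1)" for u k
  proof -
    have "(\<Sum>x\<in>W. (\<Sum>q\<in>LC u k. a x q * m q)\<^sup>2 * m x) \<le> \<bar>C\<^sub>2\<bar>\<^sup>2 * measure \<mu> (lcube u k)"
    proof (rule testing_aux[OF T'_L2[OF cube_S[OF lcube_cubes[of u k]]] loc(1)])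
      fix x assume "x \<in> W"
      have "(\<Sum>q\<in>LC u k. a x q * m q) = (\<Sum>q\<in>LC u k. \<Lambda> (cell_form x q) / m x)"
        using LC_W m_W by (intro sum.cong) (force simp: a_def)+
      then show "(\<Sum>q\<in>LC u k. a x q * m q) = \<Lambda> (pairing \<mu> (e x) (T' (indicator (lcube u k)))) / m x"
        by (simp add: sum_cell_form_lcube(1)[OF u, symmetric] \<Lambda>_sum sum_divide_distrib)
    qed simp
    then show ?thesis by (simp only: measure_lcube[OF u])
  qed
  show "(\<Sum>x\<in>W. (\<Sum>q\<in>LC u k. a q x * m q)\<^sup>2 * m x) \<le> \<bar>C\<^sub>2\<bar>\<^sup>2 * sum m (LC u k)"
    if u: "\<And>b. b \<in> Basis \<Longrightarrow> - (2 ^ (2 * j + 1)) \<le> u b \<and> u b + 2 ^ k \<le> 2 ^ (2 * j + 1 + 1)" for u k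
  proof -
    have "(\<Sum>x\<in>W. (\<Sum>q\<in>LC u k. a q x * m q)\<^sup>2 * m x) \<le> \<bar>C\<^sub>2\<bar>\<^sup>2 * measure \<mu> (lcube u k)"
    proof (rule testing_aux[OF T_L2[OF cube_S[OF lcube_cubes[of u k]]] loc(2)])
      fix x assume "x \<in> W"
      have "(\<Sum>q\<in>LC u k. a q x * m q) = (\<Sum>q\<in>LC u k. \<Lambda> (cell_form q x) / m x)"
        using LC_W m_W by (intro sum.cong) (force simp: a_def)+
      then show "(\<Sum>q\<in>LC u k. a q x * m q) = \<Lambda> (pairing \<mu> (e x) (T (indicator (lcube u k)))) / m x"
        by (simp add: sum_cell_form_lcube(2)[OF u, symmetric] \<Lambda>_sum sum_divide_distrib)
    qed simp
    then show ?thesis by (simp only: measure_lcube[OF u])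
  qed
  show "\<bar>a p q - a p' q'\<bar> \<le> om i / V (k + i)"
    if W: "p \<in> W" "p' \<in> W" "q \<in> W" "q' \<in> W" and i: "i0 \<le> i"
      and d: "\<And>b. b \<in> Basis \<Longrightarrow> \<bar>p b - p' b\<bar> < 2 ^ k" "\<And>b. b \<in> Basis \<Longrightarrow> \<bar>q b - q' b\<bar> < 2 ^ k"
      and far: "\<exists>b\<in>Basis. 2 ^ (k + i) \<le> \<bar>p b - q b\<bar>" for p p' q q' i k
  proof -
    let ?v = "K (corner j q) (corner j p)"
    have "\<bar>a x y - \<Lambda> ?v\<bar> \<le> om i / V (k + i) / 2" if "x \<in> W" "y \<in> W"
      and *: "norm (cell_form x y - ?v * (m x * m y)) \<le> om i / V (k + i) / 2 * (m x * m y)" for x y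
    proof -
      have mm: "0 < m x * m y" using m_W that by simp
      have "\<bar>\<Lambda> (cell_form x y) - \<Lambda> ?v * (m x * m y)\<bar> \<le> om i / V (k + i) / 2 * (m x * m y)"
        using order_trans[OF \<Lambda>_le *] unfolding \<Lambda>_diff \<Lambda>_real[of _ "m x * m y"] .
      moreover have "a x y - \<Lambda> ?v = (\<Lambda> (cell_form x y) - \<Lambda> ?v * (m x * m y)) / (m x * m y)"
        using m_W[OF that(1)] m_W[OF that(2)] by (simp add: a_def diff_divide_distrib)
      ultimately show ?thesis using mm by (simp add: abs_divide pos_divide_le_eq)
    qed
    \<comment> \<open>The same reference value \<open>?v\<close> is used for the pair
      \<open>p, q\<close> itself and for \<open>p', q'\<close>; each comparison takes half of the
      allowed error.\<close>
    from this[OF W(1,3) kernel_average_close[OF _ _ i far]] this[OF W(2,4) kernel_average_close[OF d i far]]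
    show ?thesis by simp
  qed
qed (use finite_W m_W i0 V_pos om_nonneg om_sum ball_mass_le in auto)

lemma form_part_le:
  assumes f: "\<And>p b. p \<in> W \<Longrightarrow> f p \<noteq> 0 \<Longrightarrow> b \<in> Basis \<Longrightarrow> 0 \<le> p b \<and> p b < 2 ^ (2 * j + 1)"
    and g: "\<And>p b. p \<in> W \<Longrightarrow> g p \<noteq> 0 \<Longrightarrow> b \<in> Basis \<Longrightarrow> 0 \<le> p b \<and> p b < 2 ^ (2 * j + 1)"
  shows "\<bar>\<Sum>p\<in>W. \<Sum>q\<in>W. \<Lambda> (cell_form p q) * f p * g q\<bar>
    \<le> T1_const * (sqrt (\<Sum>p\<in>W. (f p)\<^sup>2 * m p) * sqrt (\<Sum>p\<in>W. (g p)\<^sup>2 * m p))"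
proof -
  interpret L: lattice_kernel W m "\<lambda>p. p" Basis a "2 * j + 1" i0 V om "\<bar>C\<^sub>2\<bar>" om_total
    by (rule lattice)
  have "(\<Sum>p\<in>W. \<Sum>q\<in>W. \<Lambda> (cell_form p q) * f p * g q) = L.form f g"
    unfolding L.form_def
  proof (intro sum.cong refl)
    fix p q assume "p \<in> W" "q \<in> W"
    then have "m p \<noteq> 0" "m q \<noteq> 0" using m_W[of p] m_W[of q] by auto
    then show "\<Lambda> (cell_form p q) * f p * g q = a p q * m p * m q * f p * g q" by (simp add: a_def)
  qed
  moreover have "\<bar>L.form f g\<bar> \<le> (\<bar>C\<^sub>2\<bar> + 2 * L.C) * (L.norm_W f * L.norm_W g)"
    by (rule L.form_le) (use f g in blast)+
  moreover have "\<bar>C\<^sub>2\<bar> + 2 * L.C = T1_const" by (simp add: T1_const_def L.C_def L.Dn_def)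
  ultimately show ?thesis by (simp add: L.norm_W_def)
qed

end

section \<open>Step functions as finite sums over cells\<close>

context T1_window
begin

lemma step_corner_idx:
  assumes "step j u" shows "u (corner j (idx x)) = u x"
proof -
  have "grid j (corner j (idx x)) b = grid j x b" if "b \<in> Basis" for b
    using corner_in_cell[of j "idx x"] that by (simp add: grid_cell_def idx_def)
  then show ?thesis using assms by (simp add: step_def)
qed

lemma step_corner_support:
  assumes "step j u" "u (corner j p) \<noteq> 0" "b \<in> Basis"
  shows "0 \<le> p b \<and> p b < 2 ^ (2 * j + 1)"
proof -
  have "corner j p \<in> grid_box j" using assms by (auto simp: step_def)
  moreover have "grid j (corner j p) b = p b"
    using corner_in_cell[of j p] assms(3) by (simp add: grid_cell_def)
  ultimately show ?thesis using assms(3) unfolding grid_box_iff by fastforce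
qed

text \<open>The function \<open>F\<close> covers both the values of \<open>u\<close> and their
  squared norms.\<close>

lemma step_AE:
  fixes F :: "complex \<Rightarrow> 'b::semiring_1"
  assumes u: "step j u" and F: "F 0 = 0"
  shows "AE x in \<mu>. F (u x) = (\<Sum>p\<in>W. F (u (corner j p)) * indicator (grid_cell j p) x)"
  using window_AE
proof eventually_elim
  case (elim x)
  have "F (u x) = 0" if "idx x \<notin> W"
  proof -
    have "idx x \<notin> Win" using that elim by blast
    have "x \<notin> grid_box j"
    proof
      assume "x \<in> grid_box j"
      then have *: "0 \<le> idx x b" "idx x b < 2 ^ (2 * j + 1)" if "b \<in> Basis" for b
        using that by (simp_all add: grid_box_iff idx_def)
      have "idx x \<in> Win"
        unfolding Win_def
      proof (rule PiE_I)
        fix b :: 'a assume b: "b \<in> Basis"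
        have "- (2 ^ (2 * j + 1)) \<le> (0 :: int)" "(2 :: int) ^ (2 * j + 1) \<le> 2 ^ (2 * j + 1 + 1)"
          by simp_all
        then show "idx x b \<in> {- (2 ^ (2 * j + 1))..<2 ^ (2 * j + 1 + 1)}" using *[OF b] by auto
      qed (simp add: idx_def)
      then show False using \<open>idx x \<notin> Win\<close> by simp
    qed
    then show ?thesis using u F by (simp add: step_def)
  qed
  then show ?case
    using window_sum[OF order_refl, of "\<lambda>p. F (u (corner j p))" x] step_corner_idx[OF u, of x] by simp
qed

lemma step_S:
  assumes "step j u" shows "u \<in> S"
proof -
  have "u = (\<lambda>x. \<Sum>p\<in>grid_index j. u (corner j p) * e p x)"
    unfolding e_def using step_sum_cells[OF assms] by blast
  also have "\<dots> \<in> S" by (intro S_sum S_cmult e_S)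
  finally show ?thesis .
qed

lemma step_norm:
  assumes "step j u"
  shows "L2_norm \<mu> u = sqrt (\<Sum>p\<in>W. (norm (u (corner j p)))\<^sup>2 * m p)"
proof -
  have "(LINT x|\<mu>. (norm (u x))\<^sup>2) = (LINT x|\<mu>. (\<Sum>p\<in>W. (norm (u (corner j p)))\<^sup>2 * indicator (grid_cell j p) x))"
  proof (rule integral_cong_AE)
    have [measurable]: "u \<in> borel_measurable \<mu>" by (rule L2_measurable[OF step_L2[OF assms]])
    show "(\<lambda>x. (norm (u x))\<^sup>2) \<in> borel_measurable \<mu>" by measurable
    show "(\<lambda>x. \<Sum>p\<in>W. (norm (u (corner j p)))\<^sup>2 * indicator (grid_cell j p) x) \<in> borel_measurable \<mu>" by measurable
    show "AE x in \<mu>. (norm (u x))\<^sup>2 = (\<Sum>p\<in>W. (norm (u (corner j p)))\<^sup>2 * indicator (grid_cell j p) x)"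
      using step_AE[OF assms, of "\<lambda>c. (norm c)\<^sup>2"] by simp
  qed
  also have "\<dots> = (\<Sum>p\<in>W. (norm (u (corner j p)))\<^sup>2 * m p)"
    by (subst Bochner_Integration.integral_sum)
      (simp_all add: integrable_cell space_M m_def[symmetric])
  finally show ?thesis by (simp add: L2_norm_def)
qed

lemma pairing_step:
  assumes u: "step j u" and f: "f \<in> L2 \<mu>"
  shows "pairing \<mu> u f = (\<Sum>p\<in>W. u (corner j p) * pairing \<mu> (e p) f)"
proof -
  have "pairing \<mu> u f = pairing \<mu> (\<lambda>x. \<Sum>p\<in>W. u (corner j p) * e p x) f"
  proof (rule pairing_cong_AE)
    show "u \<in> borel_measurable \<mu>" by (rule L2_measurable[OF step_L2[OF u]])
    show "f \<in> borel_measurable \<mu>" by (rule L2_measurable[OF f])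
    show "AE x in \<mu>. u x = (\<Sum>p\<in>W. u (corner j p) * e p x)"
      using step_AE[OF u, of "\<lambda>c. c"] by (simp add: e_def)
  qed measurable
  also have "\<dots> = (\<Sum>p\<in>W. u (corner j p) * pairing \<mu> (e p) f)"
    by (rule pairing_sum_left[OF e_L2 f])
  finally show ?thesis .
qed

text \<open>Each argument is expanded while the operator acts on the other one, transposition
  carrying it across; only integrals of finite sums have to be split.\<close>

lemma T_step_pairing:
  assumes u: "step j u" and v: "step j v"
  shows "pairing \<mu> (T u) v = (\<Sum>p\<in>W. \<Sum>q\<in>W. cell_form p q * u (corner j p) * v (corner j q))"
proof -
  have "pairing \<mu> (T u) v = pairing \<mu> u (T' v)" by (rule transpose[OF step_S[OF u] step_S[OF v]])
  also have "\<dots> = (\<Sum>p\<in>W. u (corner j p) * pairing \<mu> (e p) (T' v))"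
    by (rule pairing_step[OF u T'_L2[OF step_S[OF v]]])
  also have "\<dots> = (\<Sum>p\<in>W. u (corner j p) * pairing \<mu> v (T (e p)))"
    by (simp only: transpose[OF e_S step_S[OF v], symmetric] pairing_commute[of _ v])
  also have "\<dots> = (\<Sum>p\<in>W. \<Sum>q\<in>W. cell_form p q * u (corner j p) * v (corner j q))"
    unfolding pairing_step[OF v T_L2[OF e_S]] cell_form_def sum_distrib_left
    by (simp add: pairing_commute[of _ "T _"] mult_ac)
  finally show ?thesis .
qed

lemma T1_const_nonneg: "0 \<le> T1_const"
proof -
  have "0 \<le> om_total" using om_sum[of 0] by simp
  then show ?thesis by (simp add: T1_const_def)
qed

text \<open>Taking real and imaginary parts of the matrix and of both functions gives eight real
  forms. Four enter the real part of the pairing and four the imaginary part, which explains the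
  constant 8.\<close>

lemma T_step_bound:
  assumes u: "step j u" and v: "step j v"
  shows "norm (pairing \<mu> (T u) v) \<le> 8 * T1_const * (L2_norm \<mu> u * L2_norm \<mu> v)"
proof -
  interpret R: T1_window_part \<mu> n C\<^sub>0 C\<^sub>1 C\<^sub>2 S0 \<omega> K S T T' j i0 Re by unfold_locales simp
  interpret I: T1_window_part \<mu> n C\<^sub>0 C\<^sub>1 C\<^sub>2 S0 \<omega> K S T T' j i0 Im by unfold_locales simp
  let ?u = "\<lambda>p. u (corner j p)" and ?v = "\<lambda>p. v (corner j p)"
  define F where "F \<Lambda> f g = (\<Sum>p\<in>W. \<Sum>q\<in>W. \<Lambda> (cell_form p q) * f (?u p) * g (?v q) :: real)" for \<Lambda> f g
  define C where "C = T1_const * (L2_norm \<mu> u * L2_norm \<mu> v)"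
  have part: "sqrt (\<Sum>p\<in>W. (f (x (corner j p)))\<^sup>2 * m p) \<le> L2_norm \<mu> x"
    if "step j x" "f = Re \<or> f = Im" for x f
    unfolding step_norm[OF that(1)]
  proof (intro real_sqrt_le_mono sum_mono mult_right_mono)
    show "(f (x (corner j p)))\<^sup>2 \<le> (norm (x (corner j p)))\<^sup>2" for p
      using that(2) abs_Re_le_cmod[of "x (corner j p)"] abs_Im_le_cmod[of "x (corner j p)"]
      by (auto simp: abs_le_square_iff[symmetric])
  qed (simp add: m_def)
  have bound: "\<bar>F \<Lambda> f g\<bar> \<le> C" if "\<Lambda> = Re \<or> \<Lambda> = Im" "f = Re \<or> f = Im" "g = Re \<or> g = Im" for \<Lambda> f g
  proof -
    have fg0: "f 0 = 0" "g 0 = 0" using that(2,3) by auto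
    have supp: "f (?u p) \<noteq> 0 \<Longrightarrow> b \<in> Basis \<Longrightarrow> 0 \<le> p b \<and> p b < 2 ^ (2 * j + 1)"
      "g (?v p) \<noteq> 0 \<Longrightarrow> b \<in> Basis \<Longrightarrow> 0 \<le> p b \<and> p b < 2 ^ (2 * j + 1)" for p b
      using step_corner_support[OF u, of p b] step_corner_support[OF v, of p b] fg0 by metis+
    have "\<bar>F \<Lambda> f g\<bar> \<le> T1_const * (sqrt (\<Sum>p\<in>W. (f (?u p))\<^sup>2 * m p) * sqrt (\<Sum>p\<in>W. (g (?v p))\<^sup>2 * m p))"
      using that(1)
    proof
      assume "\<Lambda> = Re"
      show ?thesis
        unfolding F_def \<open>\<Lambda> = Re\<close> by (rule R.form_part_le; rule supp; assumption)
    next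
      assume "\<Lambda> = Im"
      show ?thesis
        unfolding F_def \<open>\<Lambda> = Im\<close> by (rule I.form_part_le; rule supp; assumption)
    qed
    also have "\<dots> \<le> C" unfolding C_def
      using part[OF u that(2)] part[OF v that(3)] T1_const_nonneg
      by (intro mult_left_mono mult_mono) (auto intro: sum_nonneg simp: m_def)
    finally show ?thesis .
  qed
  have "Re (pairing \<mu> (T u) v) = F Re Re Re - F Re Im Im - F Im Re Im - F Im Im Re"
    unfolding F_def T_step_pairing[OF u v] Re_sum sum_subtractf[symmetric]
    by (intro sum.cong refl) (simp add: algebra_simps)
  moreover have "Im (pairing \<mu> (T u) v) = F Re Re Im + F Re Im Re + F Im Re Re - F Im Im Im"
    unfolding F_def T_step_pairing[OF u v] Im_sum sum_subtractf[symmetric] sum.distrib[symmetric]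
    by (intro sum.cong refl) (simp add: algebra_simps)
  moreover have "\<bar>F Re Re Re\<bar> \<le> C" "\<bar>F Re Im Im\<bar> \<le> C" "\<bar>F Im Re Im\<bar> \<le> C" "\<bar>F Im Im Re\<bar> \<le> C"
    "\<bar>F Re Re Im\<bar> \<le> C" "\<bar>F Re Im Re\<bar> \<le> C" "\<bar>F Im Re Re\<bar> \<le> C" "\<bar>F Im Im Im\<bar> \<le> C"
    by (rule bound; blast)+
  ultimately have "\<bar>Re (pairing \<mu> (T u) v)\<bar> \<le> 4 * C" "\<bar>Im (pairing \<mu> (T u) v)\<bar> \<le> 4 * C"
    by linarith+
  then show ?thesis using cmod_le[of "pairing \<mu> (T u) v"] by (simp add: C_def)
qed

end

section \<open>From step functions to the whole domain\<close>

context T1_setting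
begin

text \<open>Approximating \<open>f\<close> by step functions does not by itself control
  \<open>T f\<close>, since continuity of \<open>T\<close> is the point at issue. The bound on step
  functions is therefore first passed to \<open>T'\<close> by duality. For arbitrary
  \<open>f\<close> in \<open>S\<close>, the pairing of \<open>T f\<close> with a step function
  \<open>v\<close> equals that of \<open>f\<close> with \<open>T' v\<close>, and a second duality
  concludes.\<close>

theorem T_bounded: "\<exists>C. \<forall>f\<in>S. L2_norm \<mu> (T f) \<le> C * L2_norm \<mu> f"
proof -
  \<comment> \<open>Any number is below its power of two, so this choice meets the lower bound on
    \<open>2 ^ i0\<close>.\<close>
  define i0 where "i0 = 8 * DIM('a)"
  have W: "T1_window \<mu> n C\<^sub>0 C\<^sub>1 C\<^sub>2 S0 \<omega> K S T T' i0"
  proof unfold_locales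
    have "1 \<le> DIM('a)" using DIM_positive[where 'a = 'a] by linarith
    then show "1 \<le> i0" unfolding i0_def by linarith
    show "8 * DIM('a) \<le> 2 ^ i0" unfolding i0_def by (rule less_imp_le[OF less_exp])
  qed
  define C where "C = 8 * T1_window.T1_const TYPE('a) n C\<^sub>0 C\<^sub>1 C\<^sub>2 S0 i0"
  have C: "0 \<le> C" unfolding C_def using T1_window.T1_const_nonneg[OF W] by simp
  define A :: "('a \<Rightarrow> complex) set" where "A = {u. \<exists>j. step j u}"
  have A_L2: "A \<subseteq> L2 \<mu>" using step_L2 by (auto simp: A_def)
  have A_S: "u \<in> S" if "u \<in> A" for u using that T1_window.step_S[OF W] by (auto simp: A_def)
  have dense: "\<exists>u\<in>A. L2_norm \<mu> (\<lambda>x. f x - u x) < \<epsilon>" if "f \<in> L2 \<mu>" "0 < \<epsilon>" for f \<epsilon>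
    using approximableD[OF L2_approximable[OF that(1)] that(2)] by (auto simp: A_def)
  have step_bound: "norm (pairing \<mu> (T u) v) \<le> C * (L2_norm \<mu> u * L2_norm \<mu> v)" if uv: "u \<in> A" "v \<in> A" for u v
  proof -
    obtain i j where ij: "step i u" "step j v" using uv by (auto simp: A_def)
    \<comment> \<open>Nestedness of the meshes gives both functions a common one, and the constant
      is the same for every mesh.\<close>
    have "step (max i j) u" "step (max i j) v"
      by (rule step_mono[OF ij(1)], simp, rule step_mono[OF ij(2)], simp)
    then show ?thesis unfolding C_def by (rule T1_window.T_step_bound[OF W])
  qed
  have T'_bound: "L2_norm \<mu> (T' v) \<le> C * L2_norm \<mu> v" if v: "v \<in> A" for v
  proof (rule L2_norm_le_dual[OF T'_L2[OF A_S[OF v]] A_L2 _ dense])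
    fix u assume u: "u \<in> A"
    have "pairing \<mu> (T' v) u = pairing \<mu> (T u) v"
      using transpose[OF A_S[OF u] A_S[OF v]] by (simp add: pairing_commute)
    then show "norm (pairing \<mu> (T' v) u) \<le> C * L2_norm \<mu> v * L2_norm \<mu> u"
      using step_bound[OF u v] by (simp add: mult_ac)
  qed (use C in auto)
  have "L2_norm \<mu> (T f) \<le> C * L2_norm \<mu> f" if f: "f \<in> S" for f
  proof (rule L2_norm_le_dual[OF T_L2[OF f] A_L2 _ dense])
    fix v assume v: "v \<in> A"
    have "norm (pairing \<mu> (T f) v) \<le> L2_norm \<mu> f * L2_norm \<mu> (T' v)"
      unfolding transpose[OF f A_S[OF v]] by (rule norm_pairing_le[OF S_L2[OF f] T'_L2[OF A_S[OF v]]])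
    also have "\<dots> \<le> L2_norm \<mu> f * (C * L2_norm \<mu> v)" by (intro mult_left_mono T'_bound v) simp
    finally show "norm (pairing \<mu> (T f) v) \<le> C * L2_norm \<mu> f * L2_norm \<mu> v" by (simp add: mult_ac)
  qed (use C in auto)
  then show ?thesis by blast
qed

end

theorem corollary1p2:
  fixes \<mu> :: "'a::euclidean_space measure"
    and n C\<^sub>0 C\<^sub>1 C\<^sub>2 :: real
    and \<omega> :: "real \<Rightarrow> real"
    and K :: "'a \<Rightarrow> 'a \<Rightarrow> complex"
    and S :: "('a \<Rightarrow> complex) set"
    and T T' :: "('a \<Rightarrow> complex) \<Rightarrow> 'a \<Rightarrow> complex"
  assumes "n > 0"
    and "measure_of_order n C\<^sub>0 \<mu>"
    and "modulus_of_continuity \<omega>"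
    and "CZ_operator \<mu> n C\<^sub>1 \<omega> K S T T'"
    and "local_T1 \<mu> C\<^sub>2 T T'"
    and "(\<integral>\<^sup>+ t\<in>{0<..1}. ennreal (\<omega> t * (1 + ln (1 / t)) powr (1 / 2) / t) \<partial>lborel) < \<infinity>"
  shows "\<exists>C. \<forall>f\<in>S. L2_norm \<mu> (T f) \<le> C * L2_norm \<mu> f"
proof -
  have ball: "emeasure \<mu> (ball x \<rho>) \<le> ennreal (C\<^sub>0 * \<rho> powr n)" if "0 < \<rho>" for x \<rho>
    using assms(2) that by (simp add: measure_of_order_def)
  have "emeasure \<mu> (ball x \<rho>) < \<infinity>" for x \<rho>
  proof (cases "0 < \<rho>")
    case True
    show ?thesis using ball[OF True, of x] by (rule le_less_trans) simp
  qed (simp add: ball_empty)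
  moreover obtain S0 where "\<And>L. (\<Sum>l<L. \<omega> ((1 / 2) ^ l) * sqrt (real l + 1)) \<le> S0"
    using modulus_dyadic_sum_le[OF assms(3,6)] by blast
  ultimately interpret T1_setting \<mu> n C\<^sub>0 C\<^sub>1 C\<^sub>2 S0 \<omega> K S T T'
    using assms ball by unfold_locales (auto simp: measure_of_order_def)
  show ?thesis by (rule T_bounded)
qed

end
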